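(* Let $n\ge 3$ and consider the affine Weyl group $W_{\mathrm{aff}}$ of type $A_{n-1}^{(1)}$. Let $\mathbf d=(d_0,\dots,d_{n-1})>c$ be a degree (i.e. $d_i\ge1$ for all $i$ and $\mathbf d\ne c$) and let $m=\min\{d_0,\dots,d_{n-1}\}$. Write $z_{\mathbf d-mc}=s_{\gamma_1}s_{\gamma_2}\cdots s_{\gamma_k}$ ($k\ge0$), where $\gamma_1,\dots,\gamma_k\in\Pi_{\mathrm{aff}}^{\mathrm{re},+}$ are such that for all $i\ne j$ either $\operatorname{supp}(\gamma_i)$ and $\operatorname{supp}(\gamma_j)$ are disconnected, or both $\gamma_i\perp\gamma_j$ and $\gamma_i,\gamma_j$ are comparable. Let $\Pi_{\mathrm{aff}}^{\mathrm{re},+}(\mathbf d-mc)$ be the set of $\beta'\in\Pi_{\mathrm{aff}}^{\mathrm{re},+}$ such that $\beta'<c$ and, for every $i=1,\dots,k$, either $\beta'\cap\gamma_i=\emptyset$, or both $\beta'>\gamma_i$ and $\beta'\perp\gamma_i$. Then: (1) $\Gamma_{\mathbf d}(id)=\{t_{m\beta'}z_{\mathbf d-mc}:\beta'\in\Pi_{\mathrm{aff}}^{\mathrm{re},+}(\mathbf d-mc),\ \alpha_0\notin\operatorname{supp}(\beta')\}\cup\{t_{m(\beta'-c)}z_{\mathbf d-mc}:\beta'\in\Pi_{\mathrm{aff}}^{\mathrm{re},+}(\mathbf d-mc),\ \alpha_0\in\operatorname{supp}(\beta')\}$; (2) $|\Gamma_{\mathbf d}(id)|=|\Pi_{\mathrm{aff}}^{\mathrm{re},+}(\mathbf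 d-mc)|$; (3) $\ell(w)=2m(n-1)+\ell(z_{\mathbf d-mc})$ for all $w\in\Gamma_{\mathbf d}(id)$.
   Context: Roots. Let $n\ge 3$. Let $\alpha_0,\dots,\alpha_{n-1}$ (indices mod $n$) be the affine simple roots of type $A_{n-1}^{(1)}$, $Q_{\mathrm{aff}}=\bigoplus_{i=0}^{n-1}\mathbb Z\alpha_i$, with symmetric form $\langle\alpha_i,\alpha_i\rangle=2$, $\langle\alpha_i,\alpha_{i\pm1}\rangle=-1$, all other $\langle\alpha_i,\alpha_j\rangle=0$; $\perp$ refers to this form. For $a,b\in Q_{\mathrm{aff}}$, $a\le b$ means $b-a$ has non-negative coefficients, and $a<b$ means $a\le b$, $a\ne b$; comparable means $a\le b$ or $b\le a$. Put $c=\sum_{i=0}^{n-1}\alpha_i$ (identified with the imaginary root $\delta$). Let $\Pi=\Pi^+\sqcup\Pi^-$ be the finite root system of type $A_{n-1}$ with simple roots $\alpha_1,\dots,\alpha_{n-1}$. The affine real roots are $\alpha+mc$ with $\alpha\in\Pi$, $m\in\mathbb Z$; such a root is positive if $m>0$, or $m=0$ and $\alpha\in\Pi^+$. The set of positive real roots is $\Pi_{\mathrm{aff}}^{\mathrm{re},+}$. For $\alpha=\sum a_i\alpha_i$, $\operatorname{supp}(\alpha)=\{\alpha_i:a_i\ne0\}$. $\alpha\cap\beta=\emptyset$ means $\operatorname{supp}(\alpha)\cap\operatorname{supp}(\beta)=\emptyset$. Two supports are disconnected if they are disjoint and no simple root in one is adjacent (in the cyclic Dynkin diagram) to a simple root in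 the other. Weyl group. For a real root $\alpha$, $s_\alpha(\mu)=\mu-\langle\mu,\alpha\rangle\alpha$. $W_{\mathrm{aff}}$ is the group generated by $s_i=s_{\alpha_i}$, $0\le i\le n-1$ (a Coxeter group with these generators), with length $\ell$ and Bruhat order $\le$. One has $W_{\mathrm{aff}}=W\ltimes Q$, where $W=\langle s_1,\dots,s_{n-1}\rangle$ and $Q=\bigoplus_{i=1}^{n-1}\mathbb Z\alpha_i$ (root and coroot lattices identified); $t_\mu$ denotes the image of $\mu\in Q$, with $s_{\alpha+mc}=s_\alpha t_{m\alpha}$ for $\alpha\in\Pi$, $m\in\mathbb Z$ (so $t_\mu(\nu)=\nu-\langle\mu,\nu\rangle c$). For a positive real root $\beta'<c$: $\beta'\in Q$ if $\alpha_0\notin\operatorname{supp}(\beta')$, and $\beta'-c\in Q$ if $\alpha_0\in\operatorname{supp}(\beta')$. Hecke product: $u\cdot s_i=us_i$ if $\ell(us_i)>\ell(u)$ and $u\cdot s_i=u$ otherwise; $u\cdot v=u\cdot s_{i_1}\cdots s_{i_k}$ (applied left to right) for any reduced expression $v=s_{i_1}\cdots s_{i_k}$. This is a well-defined associative product. Degrees and $z_{\mathbf d}$. A degree is a tuple $\mathbf d=(d_0,\dots,d_{n-1})\in\mathbb Z_{\ge0}^n$, identified with $\sum d_i\alpha_i$; degrees are ordered componentwise. For a degree $\mathbf d$ with $d_i=0$ for some $i$: $z_{\mathbf 0}=id$, and for $\mathbf d\ne0$, $z_{\mathbf d}=s_\alpha\cdot z_{\mathbf d-\alpha}$ (Hecke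 product) where $\alpha$ is any maximal element of the set of positive real roots $\le\mathbf d$; this is independent of choices. An expression $z_{\mathbf d}=s_{\gamma_1}\cdots s_{\gamma_k}$ with the pairwise properties required in the claim always exists. Curve neighborhoods. The moment graph has vertex set $W_{\mathrm{aff}}$ and an edge $u\stackrel{\alpha}{\longrightarrow}us_\alpha$ of degree $\alpha$ for each $u\in W_{\mathrm{aff}}$, $\alpha\in\Pi_{\mathrm{aff}}^{\mathrm{re},+}$. The degree of a chain (a succession of adjacent edges, possibly empty) is the sum of the degrees of its edges. For $u\in W_{\mathrm{aff}}$, $\Gamma_{\mathbf d}(u)$ is the set of Bruhat-maximal elements of the set of all $v\in W_{\mathrm{aff}}$ that can be joined to some $u'\le u$ by a chain of degree $\le\mathbf d$. *)

theory Defs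
  imports Main "HOL-Library.Function_Algebras"
begin

text \<open>
  An element \<open>\<Sum>i<n. a\<^sub>i \<alpha>\<^sub>i\<close> of the affine root lattice is its coefficient function
  \<open>a :: nat \<Rightarrow> int\<close>, vanishing at all indices \<open>\<ge> n\<close>.  Addition, subtraction and \<open>0\<close> are
  pointwise (Function_Algebras), and the library order on functions is the coefficientwise
  order: \<open>a < b\<close> means \<open>a \<le> b\<close> and \<open>a \<noteq> b\<close>.
\<close>

type_synonym lat = "nat \<Rightarrow> int"

definition simple :: "nat \<Rightarrow> lat" where
  "simple i = (\<lambda>k. if k = i then 1 else 0)"

definition scale :: "int \<Rightarrow> lat \<Rightarrow> lat" where
  "scale k a = (\<lambda>i. k * a i)"

definition adjacent :: "nat \<Rightarrow> nat \<Rightarrow> nat \<Rightarrow> bool" where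
  "adjacent n i j \<longleftrightarrow> j = (i + 1) mod n \<or> i = (j + 1) mod n"

definition cartan :: "nat \<Rightarrow> nat \<Rightarrow> nat \<Rightarrow> int" where
  "cartan n i j = (if i = j then 2 else if adjacent n i j then -1 else 0)"

definition form :: "nat \<Rightarrow> lat \<Rightarrow> lat \<Rightarrow> int" where
  "form n a b = (\<Sum>i<n. \<Sum>j<n. a i * b j * cartan n i j)"

definition perp :: "nat \<Rightarrow> lat \<Rightarrow> lat \<Rightarrow> bool" where
  "perp n a b \<longleftrightarrow> form n a b = 0"

definition comparable :: "lat \<Rightarrow> lat \<Rightarrow> bool" where
  "comparable a b \<longleftrightarrow> a \<le> b \<or> b \<le> a"

definition cc :: "nat \<Rightarrow> lat" where
  "cc n = (\<Sum>i<n. simple i)"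

definition supp :: "lat \<Rightarrow> nat set" where
  "supp a = {i. a i \<noteq> 0}"

definition disconnected :: "nat \<Rightarrow> lat \<Rightarrow> lat \<Rightarrow> bool" where
  "disconnected n a b \<longleftrightarrow> supp a \<inter> supp b = {} \<and> (\<forall>i\<in>supp a. \<forall>j\<in>supp b. \<not> adjacent n i j)"

text \<open>The finite root system of type \<open>A\<close> with simple roots \<open>\<alpha>\<^sub>1, \<dots>, \<alpha>\<^sub>n\<^sub>-\<^sub>1\<close>.\<close>

definition fin_pos_roots :: "nat \<Rightarrow> lat set" where
  "fin_pos_roots n = {\<Sum>k\<in>{i..j}. simple k | i j. 1 \<le> i \<and> i \<le> j \<and> j \<le> n - 1}"

definition fin_roots :: "nat \<Rightarrow> lat set" where
  "fin_roots n = fin_pos_roots n \<union> uminus ` fin_pos_roots n"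

definition pos_real_roots :: "nat \<Rightarrow> lat set" where
  "pos_real_roots n = {a + scale m (cc n) | a m.
     (m > 0 \<and> a \<in> fin_roots n) \<or> (m = 0 \<and> a \<in> fin_pos_roots n)}"

text \<open>
  The affine Weyl group is realised by its (faithful) action on the affine root lattice, with
  composition as the product.  The maps below are given on all of \<open>nat \<Rightarrow> int\<close>; they ignore
  and fix the coefficients at indices \<open>\<ge> n\<close>, so this gives the same group.  Since the generators
  are involutions, the group they generate consists of the finite words in them.
\<close>

type_synonym wel = "lat \<Rightarrow> lat"

definition refl :: "nat \<Rightarrow> lat \<Rightarrow> wel" where
  "refl n a = (\<lambda>v. v - scale (form n v a) a)"

definition sref :: "nat \<Rightarrow> nat \<Rightarrow> wel" where
  "sref n i = refl n (simple i)"

definition word :: "nat \<Rightarrow> nat list \<Rightarrow> wel" where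
  "word n is = foldr (\<circ>) (map (sref n) is) id"

definition Waff :: "nat \<Rightarrow> wel set" where
  "Waff n = {word n is | is. set is \<subseteq> {..<n}}"

definition transl :: "nat \<Rightarrow> lat \<Rightarrow> wel" where
  "transl n \<mu> = (\<lambda>v. v - scale (form n \<mu> v) (cc n))"

definition len :: "nat \<Rightarrow> wel \<Rightarrow> nat" where
  "len n w = (LEAST k. \<exists>is. set is \<subseteq> {..<n} \<and> word n is = w \<and> length is = k)"

definition reduced_word :: "nat \<Rightarrow> wel \<Rightarrow> nat list \<Rightarrow> bool" where
  "reduced_word n w is \<longleftrightarrow> set is \<subseteq> {..<n} \<and> word n is = w \<and> length is = len n w"

definition bruhat_step :: "nat \<Rightarrow> wel \<Rightarrow> wel \<Rightarrow> bool" where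
  "bruhat_step n u v \<longleftrightarrow> u \<in> Waff n \<and>
     (\<exists>a\<in>pos_real_roots n. v = u \<circ> refl n a \<and> len n u < len n v)"

definition bruhat_le :: "nat \<Rightarrow> wel \<Rightarrow> wel \<Rightarrow> bool" where
  "bruhat_le n = (bruhat_step n)\<^sup>*\<^sup>*"

definition hecke_simple :: "nat \<Rightarrow> wel \<Rightarrow> nat \<Rightarrow> wel" where
  "hecke_simple n u i = (if len n (u \<circ> sref n i) > len n u then u \<circ> sref n i else u)"

text \<open>The Hecke product does not depend on the reduced word that is chosen here.\<close>

definition hecke :: "nat \<Rightarrow> wel \<Rightarrow> wel \<Rightarrow> wel" where
  "hecke n u v = foldl (hecke_simple n) u (SOME is. reduced_word n v is)"

definition is_degree :: "nat \<Rightarrow> lat \<Rightarrow> bool" where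
  "is_degree n d \<longleftrightarrow> (\<forall>i. 0 \<le> d i) \<and> (\<forall>i\<ge>n. d i = 0)"

definition maximal_root_below :: "nat \<Rightarrow> lat \<Rightarrow> lat \<Rightarrow> bool" where
  "maximal_root_below n d a \<longleftrightarrow> a \<in> pos_real_roots n \<and> a \<le> d \<and>
     \<not> (\<exists>b\<in>pos_real_roots n. b \<le> d \<and> a < b)"

text \<open>
  \<open>z_rel n d w\<close>: some run of the recursion for \<open>z\<^sub>d\<close> (for \<open>d\<close> with a zero coefficient) returns
  \<open>w\<close>.  All runs return the same element, which is \<open>zel n d\<close>.
\<close>

inductive z_rel :: "nat \<Rightarrow> lat \<Rightarrow> wel \<Rightarrow> bool" for n where
  zero: "z_rel n 0 id"
| step: "is_degree n d \<Longrightarrow> d \<noteq> 0 \<Longrightarrow> \<exists>i<n. d i = 0 \<Longrightarrow> maximal_root_below n d a \<Longrightarrow>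
         z_rel n (d - a) w \<Longrightarrow> z_rel n d (hecke n (refl n a) w)"

definition zel :: "nat \<Rightarrow> lat \<Rightarrow> wel" where
  "zel n d = (SOME w. z_rel n d w)"

text \<open>\<open>chain n u v e\<close>: the moment graph has a chain from \<open>u\<close> to \<open>v\<close> of degree \<open>e\<close>.
  Edges may be traversed both ways, which is automatic as \<open>v = u s\<^sub>a\<close> gives \<open>u = v s\<^sub>a\<close>.\<close>

inductive chain :: "nat \<Rightarrow> wel \<Rightarrow> wel \<Rightarrow> lat \<Rightarrow> bool" for n where
  empty: "u \<in> Waff n \<Longrightarrow> chain n u u 0"
| edge: "chain n u v e \<Longrightarrow> a \<in> pos_real_roots n \<Longrightarrow> chain n u (v \<circ> refl n a) (e + a)"

definition reachable :: "nat \<Rightarrow> lat \<Rightarrow> wel \<Rightarrow> wel set" where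
  "reachable n d u = {v \<in> Waff n. \<exists>u'\<in>Waff n. \<exists>e. bruhat_le n u' u \<and> chain n u' v e \<and> e \<le> d}"

definition curve_nbhd :: "nat \<Rightarrow> lat \<Rightarrow> wel \<Rightarrow> wel set" where
  "curve_nbhd n d u = {v \<in> reachable n d u. \<forall>v'\<in>reachable n d u. bruhat_le n v v' \<longrightarrow> v' = v}"

definition refl_prod :: "nat \<Rightarrow> lat list \<Rightarrow> wel" where
  "refl_prod n gs = foldr (\<circ>) (map (refl n) gs) id"

definition admissible :: "nat \<Rightarrow> lat list \<Rightarrow> bool" where
  "admissible n gs \<longleftrightarrow> set gs \<subseteq> pos_real_roots n \<and>
     (\<forall>i<length gs. \<forall>j<length gs. i \<noteq> j \<longrightarrow>
        disconnected n (gs ! i) (gs ! j) \<or>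
        (perp n (gs ! i) (gs ! j) \<and> comparable (gs ! i) (gs ! j)))"

text \<open>The set \<open>\<Pi>\<^sub>a\<^sub>f\<^sub>f\<^sup>r\<^sup>e\<^sup>,\<^sup>+(d - mc)\<close>, when the reflections in \<open>gs\<close> multiply to \<open>z\<^sub>d\<^sub>-\<^sub>m\<^sub>c\<close>.\<close>

definition compat_roots :: "nat \<Rightarrow> lat list \<Rightarrow> lat set" where
  "compat_roots n gs = {b \<in> pos_real_roots n. b < cc n \<and>
     (\<forall>g\<in>set gs. supp b \<inter> supp g = {} \<or> (g < b \<and> perp n b g))}"

end

theory Submission
  imports Defs
begin

text \<open>
  The affine Weyl group is the group of affine permutations \<open>v\<close> of the integers, and
  \<open>rk v i l = card {a. a \<le> i \<and> l < v a}\<close>.  A reflection of degree \<open>\<alpha>\<close> raises \<open>rk v k k\<close> by at most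
  the \<open>k\<close>-th coefficient of \<open>\<alpha>\<close>, and as long as \<open>v \<noteq> id\<close> some reflection lowers it by exactly
  that much; hence \<open>v\<close> is reachable in degree \<open>d\<close> iff \<open>rk v k k \<le> d\<^sub>k\<close> for all \<open>k\<close>.  If no Bruhat step
  upwards from \<open>v\<close> is reachable, the arcs from \<open>a\<close> to \<open>v a\<close> are pairwise non-crossing, apart from one
  class going up and one class going down by \<open>M\<close> full turns, and \<open>rk v k k = Min\<^sub>j (d\<^sub>j + |k - j|)\<close>.
  Non-crossing arcs are recovered from this function like matching parentheses.  So removing the
  full turns leaves an involution that depends on \<open>d - m c\<close> only, namely \<open>z\<close>, and \<open>M = m\<close>;
  the two long classes form the compatible root.  That \<open>z\<close> has the maximal rank function
  follows from the formula \<open>rk (u \<cdot> v) i j = Min\<^sub>l (rk u l j + rk v i l)\<close> for Hecke products.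
\<close>

text \<open>In the coordinates used here \<open>root a b\<close> is the interval of integers from
  \<open>a\<close> to \<open>b - 1\<close> read modulo \<open>n\<close>: its coefficients count how
  often each residue is covered, and the conditions of the claim on supports, comparability and
  orthogonality become statements about the relative position of intervals. Two obstacles shape the
  argument. The affine Bruhat order is awkward to describe in closed form, so it is never
  characterised: maximality is tested one reflection at a time, and the candidates found in this way
  are recognised as exactly the maximal elements because they all have the same length and the
  lengths of reachable elements are bounded. The element \<open>zel\<close> comes from a recursion
  with choices; it is handled only through its rank function, which attains the largest values that
  the degree permits and so does not depend on the choices. That removing the full turns leaves an
  involution is due to \<open>rk v k k\<close> being unchanged under inversion: the element and its
  inverse show the same pattern of parentheses.\<close>

locale affine =
  fixes n :: nat
  assumes n3: "3 \<le> n"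
begin

subsection \<open>Residues modulo \<open>n\<close> and affine permutations\<close>

abbreviation N :: int where "N \<equiv> int n"

definition eqm :: "int \<Rightarrow> int \<Rightarrow> bool" where "eqm x y \<longleftrightarrow> N dvd x - y"

text \<open>The integers congruent to \<open>k\<close> cut the line into blocks, and this is the
  number of the block containing \<open>x\<close>. Hence \<open>fl k y - fl k x\<close> counts, for
  \<open>x \<le> y\<close>, the integers congruent to \<open>k\<close> in [x, y). The
  \<open>- 1\<close> puts \<open>k\<close> itself at the end of block -1, so that
  \<open>k < x\<close> is the same as \<open>0 \<le> fl k x\<close>.\<close>

definition fl :: "int \<Rightarrow> int \<Rightarrow> int" where "fl k x = (x - k - 1) div N"

lemma N3: "3 \<le> N" using n3 by simp

lemma eqm_refl [simp]: "eqm x x" by (simp add: eqm_def)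
lemma eqm_sym: "eqm x y \<longleftrightarrow> eqm y x" unfolding eqm_def by (rule dvd_diff_commute)
lemma eqm_trans: "eqm x y \<Longrightarrow> eqm y z \<Longrightarrow> eqm x z"
  unfolding eqm_def using dvd_add[of N "x - y" "y - z"] by simp
lemma eqm_E: assumes "eqm x y" obtains t where "x = y + t * N"
proof -
  obtain t where "x - y = N * t" using assms unfolding eqm_def by (elim dvdE)
  then have "x = y + t * N" by (simp add: algebra_simps)
  then show ?thesis using that by blast
qed
lemma eqm_shift [simp]: "eqm (x + t * N) x" "eqm x (x + t * N)" "eqm (x - t * N) x" "eqm x (x - t * N)"
  "eqm (x + N) x" "eqm x (x + N)" "eqm (x - N) x" "eqm x (x - N)"
  unfolding eqm_def by simp_all
lemma eqm_shift_left [simp]: "eqm (x + N) y \<longleftrightarrow> eqm x y" "eqm (x + t * N) y \<longleftrightarrow> eqm x y"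
    "eqm (x - N) y \<longleftrightarrow> eqm x y" "eqm (x - t * N) y \<longleftrightarrow> eqm x y"
  using eqm_shift eqm_trans by blast+
lemma eqm_iff_mod: "eqm x y \<longleftrightarrow> x mod N = y mod N"
  unfolding eqm_def by (simp add: mod_eq_dvd_iff)
lemma eqm_mod [simp]: "eqm (x mod N) x" "eqm x (x mod N)"
  unfolding eqm_iff_mod by simp_all
lemma eqm_close: assumes "eqm x y" "x < y + N" "y < x + N" shows "x = y"
proof -
  obtain t where t: "x = y + t * N" using eqm_E[OF assms(1)] .
  have "t * N < 1 * N" "(-1) * N < t * N" using assms t by simp_all
  then have "t < 1" "-1 < t" using N3 by (simp_all only: mult_less_cancel_right)
  then show ?thesis using t by simp
qed
lemma not_eqm_succ [simp]: "\<not> eqm x (x + 1)" "\<not> eqm (x + 1) x" "\<not> eqm x (x - 1)" "\<not> eqm (x - 1) x"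
  using eqm_close[of x "x+1"] eqm_close[of "x+1" x] eqm_close[of "x-1" x] eqm_close[of x "x-1"] N3 by auto
lemma eqm_add_cancel [simp]: "eqm (x + z) (y + z) \<longleftrightarrow> eqm x y" unfolding eqm_def by simp
lemma eqm_rep: obtains t where "a \<le> x + t * N" "x + t * N < a + N"
proof -
  have "a + (x - a) mod N = x + (- ((x - a) div N)) * N"
    by (simp add: minus_div_mult_eq_mod[symmetric] algebra_simps)
  moreover have "0 \<le> (x - a) mod N" "(x - a) mod N < N" using N3 by simp_all
  ultimately show ?thesis using that[of "- ((x - a) div N)"] by linarith
qed
lemma shift_rep: assumes "\<not> eqm a x" obtains t where "a < x + t * N" "x + t * N < a + N"
proof -
  obtain t where t: "a \<le> x + t * N" "x + t * N < a + N" by (rule eqm_rep)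
  have "a \<noteq> x + t * N" using assms eqm_shift by metis
  then show ?thesis using t that[of t] by linarith
qed

lemma fl_shift [simp]: "fl k (x + t * N) = fl k x + t"
  unfolding fl_def using N3 div_mult_self1[of N "x - k - 1" t] by (simp add: algebra_simps)
lemma fl_shift1 [simp]: "fl k (x + N) = fl k x + 1" using fl_shift[of k x 1] by simp
lemma fl_shiftm [simp]: "fl k (x - t * N) = fl k x - t" using fl_shift[of k x "-t"] by simp
lemma fl_base [simp]: "fl (k + t * N) x = fl k x - t"
  using fl_shift[of k x "-t"] unfolding fl_def by (simp add: algebra_simps)
lemma fl_mono: "x \<le> y \<Longrightarrow> fl k x \<le> fl k y"
  unfolding fl_def using N3 by (intro zdiv_mono1) auto
lemma fl_neg_iff: "fl k x < 0 \<longleftrightarrow> x \<le> k"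
  unfolding fl_def using N3 by (subst pos_imp_zdiv_neg_iff) auto
lemma fl_nonneg_iff: "0 \<le> fl k x \<longleftrightarrow> k < x"
  using fl_neg_iff[of k x] by linarith
lemma fl_less_iff: "fl k x < t \<longleftrightarrow> x \<le> k + t * N"
  using fl_neg_iff[of k "x - t * N"] by (simp add: algebra_simps)
lemma fl_ge_iff: "t \<le> fl k x \<longleftrightarrow> k + t * N < x"
  using fl_less_iff[of k x t] by linarith
lemma fl_eqI: "k + t * N < x \<Longrightarrow> x \<le> k + (t + 1) * N \<Longrightarrow> fl k x = t"
  using fl_ge_iff[of t k x] fl_less_iff[of k x "t+1"] by linarith
lemma fl_self: "fl k k = -1" "fl k (k+1) = 0" using N3 by (auto intro!: fl_eqI)
lemma fl_step: "fl k (x + 1) = fl k x + (if eqm x k then 1 else 0)"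
proof (cases "eqm x k")
  case True
  then obtain t where "x = k + t * N" by (rule eqm_E)
  moreover have "k + t * N + 1 = (k + 1) + t * N" by simp
  ultimately show ?thesis by (simp only: fl_shift fl_self True if_True) simp
next
  case False
  have a: "fl k x \<le> fl k (x+1)" by (rule fl_mono) simp
  define t where "t = fl k (x + 1)"
  have 1: "k + t * N < x + 1" using fl_ge_iff[of t k "x+1"] t_def by simp
  have "k + t * N \<noteq> x" using False by auto
  then have "k + t * N < x" using 1 by simp
  then have "t \<le> fl k x" using fl_ge_iff by simp
  then show ?thesis using a t_def False by simp
qed
lemma fl_base_step: "fl (k + 1) x = fl k x - (if eqm x (k + 1) then 1 else 0)"
proof -
  have "fl (k+1) x = fl k (x - 1)" unfolding fl_def by (simp add: algebra_simps)
  moreover have "eqm (x - 1) k = eqm x (k+1)" unfolding eqm_def by (simp add: algebra_simps)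
  ultimately show ?thesis using fl_step[of k "x - 1"] by simp
qed

section \<open>Periodic functions and sums over one period\<close>

definition psum :: "(int \<Rightarrow> 'a) \<Rightarrow> 'a::comm_monoid_add" where "psum \<phi> = (\<Sum>c\<in>{0..<N}. \<phi> c)"
definition periodic :: "(int \<Rightarrow> 'a) \<Rightarrow> bool" where "periodic \<phi> \<longleftrightarrow> (\<forall>x. \<phi> (x + N) = \<phi> x)"

lemma periodic_shift: assumes "periodic \<phi>" shows "\<phi> (x + t * N) = \<phi> x"
proof (induction t arbitrary: x rule: int_induct[where k = 0])
  case base then show ?case by simp
next
  case (step1 i) have "\<phi> (x + (i+1) * N) = \<phi> ((x + i * N) + N)" by (simp add: algebra_simps)
  then show ?case using step1 assms unfolding periodic_def by simp
next
  case (step2 i) have "\<phi> (x + i * N) = \<phi> ((x + (i - 1) * N) + N)" by (simp add: algebra_simps)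
  then show ?case using step2 assms unfolding periodic_def by simp
qed
lemma periodic_eqm: "periodic \<phi> \<Longrightarrow> eqm x y \<Longrightarrow> \<phi> x = \<phi> y"
  by (metis eqm_E periodic_shift)

definition ashift :: "(int \<Rightarrow> int) \<Rightarrow> bool" where "ashift f \<longleftrightarrow> (\<forall>x. f (x + N) = f x + N)"
lemma ashift_shift: assumes "ashift f" shows "f (x + t * N) = f x + t * N"
proof -
  have "periodic (\<lambda>x. f x - x)" using assms unfolding periodic_def ashift_def by simp
  from periodic_shift[OF this, of x t] show ?thesis by simp
qed
lemma ashift_eqm: "ashift f \<Longrightarrow> eqm x y \<Longrightarrow> eqm (f x) (f y)"
  by (metis ashift_shift eqm_E eqm_shift(1))

text \<open>The vanishing sum excludes the shifts x + c with c nonzero; these rotate the Dynkin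
  diagram, or act trivially when c is a multiple of \<open>N\<close>.\<close>

definition aperm :: "(int \<Rightarrow> int) \<Rightarrow> bool" where
  "aperm f \<longleftrightarrow> bij f \<and> ashift f \<and> psum (\<lambda>c. f c - c) = 0"

lemma aperm_ashift: "aperm f \<Longrightarrow> ashift f" by (simp add: aperm_def)
lemma aperm_inj: "aperm f \<Longrightarrow> f x = f y \<longleftrightarrow> x = y" by (auto simp: aperm_def bij_def inj_def)
lemma ashift_eqm_iff: assumes "bij f" "ashift f" shows "eqm (f x) (f y) \<longleftrightarrow> eqm x y"
proof
  assume "eqm (f x) (f y)"
  then obtain t where "f x = f y + t * N" by (rule eqm_E)
  also have "\<dots> = f (y + t * N)" using ashift_shift[OF assms(2)] by simp
  finally have "x = y + t * N" using assms(1) by (auto simp: bij_def inj_def)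
  then show "eqm x y" by simp
qed (rule ashift_eqm[OF assms(2)])
lemma aperm_eqm_iff: "aperm f \<Longrightarrow> eqm (f x) (f y) \<longleftrightarrow> eqm x y"
  using ashift_eqm_iff unfolding aperm_def by blast

text \<open>Reduced modulo \<open>N\<close>, the values of \<open>f\<close> on one period permute
  the residues, and a periodic function does not notice the reduction.\<close>

lemma psum_reindex: assumes "periodic \<phi>" "bij f" "ashift f" shows "psum (\<lambda>c. \<phi> (f c)) = psum \<phi>"
proof -
  define h where "h = (\<lambda>c. f c mod N)"
  have inj: "inj_on h {0..<N}"
  proof (rule inj_onI)
    fix x y assume xy: "x \<in> {0..<N}" "y \<in> {0..<N}" "h x = h y"
    then have "eqm (f x) (f y)" by (simp add: h_def eqm_iff_mod)
    then have "eqm x y" using ashift_eqm_iff assms by blast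
    then show "x = y" using eqm_close[of x y] xy by auto
  qed
  have sub: "h ` {0..<N} \<subseteq> {0..<N}" using N3 by (auto simp: h_def)
  have "bij_betw h {0..<N} {0..<N}"
    using endo_inj_surj[OF _ sub inj] inj by (simp add: bij_betw_def)
  from sum.reindex_bij_betw[OF this, of \<phi>]
  have "psum (\<lambda>c. \<phi> (h c)) = psum \<phi>" by (simp add: psum_def)
  moreover have "\<phi> (h c) = \<phi> (f c)" for c using periodic_eqm[OF assms(1)] by (simp add: h_def)
  ultimately show ?thesis by simp
qed

lemma psum_single:
  assumes "periodic \<phi>" "\<And>c. \<not> eqm c i \<Longrightarrow> \<phi> c = 0" shows "psum \<phi> = \<phi> i"
proof -
  have m: "i mod N \<in> {0..<N}" using N3 by simp
  have "psum \<phi> = (\<Sum>c\<in>{0..<N}. if c = i mod N then \<phi> c else 0)"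
    unfolding psum_def
  proof (rule sum.cong)
    fix c assume c: "c \<in> {0..<N}"
    then show "\<phi> c = (if c = i mod N then \<phi> c else 0)"
      using assms(2)[of c] by (auto simp: eqm_iff_mod)
  qed simp
  also have "\<dots> = \<phi> (i mod N)" using m by simp
  also have "\<dots> = \<phi> i" using periodic_eqm[OF assms(1)] by simp
  finally show ?thesis .
qed

lemma psum_diff: "psum (\<lambda>c. f c - g c) = psum f - (psum g :: int)"
  unfolding psum_def by (simp add: sum_subtractf)
lemma psum_add: "psum (\<lambda>c. f c + g c) = psum f + (psum g :: int)"
  unfolding psum_def by (simp add: sum.distrib)
lemma psum_mono: "(\<And>c. f c \<le> g c) \<Longrightarrow> psum f \<le> (psum g :: int)"
  unfolding psum_def by (rule sum_mono) simp
lemma psum_nonneg: "(\<And>c. 0 \<le> g c) \<Longrightarrow> 0 \<le> (psum g :: int)"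
  unfolding psum_def by (rule sum_nonneg) simp
lemma psum_ge: assumes "periodic g" "\<And>c. 0 \<le> (g c :: int)" shows "g i \<le> psum g"
proof -
  have "g (i mod N) \<le> psum g" unfolding psum_def
    by (rule member_le_sum) (use assms N3 in auto)
  then show ?thesis using periodic_eqm[OF assms(1), of "i mod N" i] by simp
qed
text \<open>The reflections and translations met below move just two residue classes, so comparing
  ranks or lengths before and after comes down to this difference.\<close>

lemma psum_change2:
  assumes "periodic (\<phi> :: int \<Rightarrow> int)" "periodic \<psi>" "\<not> eqm i j"
    "\<And>c. \<not> eqm c i \<Longrightarrow> \<not> eqm c j \<Longrightarrow> \<phi> c = \<psi> c"
  shows "psum \<phi> - psum \<psi> = (\<phi> i - \<psi> i) + (\<phi> j - \<psi> j)"
proof -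
  let ?a = "\<lambda>c. if eqm c i then \<phi> c - \<psi> c else 0"
  let ?b = "\<lambda>c. if eqm c j then \<phi> c - \<psi> c else 0"
  have p: "eqm (c + N) k = eqm c k" for c k
    by (metis eqm_shift(5,6) eqm_trans)
  have "psum \<phi> - psum \<psi> = psum (\<lambda>c. \<phi> c - \<psi> c)" by (simp add: psum_diff)
  also have "\<dots> = psum (\<lambda>c. ?a c + ?b c)"
    using assms(3,4) unfolding psum_def by (intro sum.cong) (auto, metis eqm_sym eqm_trans)
  also have "\<dots> = psum ?a + psum ?b" by (rule psum_add)
  also have "psum ?a = ?a i" by (rule psum_single) (use assms(1,2) in \<open>auto simp: periodic_def p\<close>)
  also have "psum ?b = ?b j" by (rule psum_single) (use assms(1,2) in \<open>auto simp: periodic_def p\<close>)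
  finally show ?thesis by simp
qed

subsection \<open>The action on the affine root lattice\<close>

text \<open>With \<alpha>_k read as e_k - e_{k+1}, this is \<alpha>_a + ... + \<alpha>_{b-1},
  indices modulo \<open>n\<close>, when \<open>a \<le> b\<close>, and a negative when the ends are
  exchanged. Congruent ends give the multiples of the imaginary root.\<close>

definition root :: "int \<Rightarrow> int \<Rightarrow> lat" where
  "root a b = (\<lambda>k. if k < n then fl (int k) b - fl (int k) a else 0)"

text \<open>The linear map sending each simple root, which is \<open>root i (i + 1)\<close>, to the
  root between the images of its ends. Coordinates from \<open>n\<close> on are left alone, in
  agreement with \<open>refl\<close> and \<open>transl\<close>.\<close>

definition act :: "(int \<Rightarrow> int) \<Rightarrow> wel" where
  "act f = (\<lambda>v k. if k < n then \<Sum>i<n. v i * root (f (int i)) (f (int i + 1)) k else v k)"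

lemma sum_nat_psum: "(\<Sum>i<n. h (int i)) = psum h"
proof -
  have "int ` {..<n} = {0..<N}"
    by (simp add: image_int_atLeastLessThan lessThan_atLeast0)
  moreover have "inj_on int {..<n}" by simp
  ultimately show ?thesis unfolding psum_def by (metis (no_types, lifting) sum.reindex_cong)
qed

lemma root_eq_fl: "root a b (nat (x mod N)) = fl x b - fl x a"
proof -
  have "x = x mod N + (x div N) * N" by simp
  then have "fl x y = fl (x mod N) y - x div N" for y by (metis fl_base)
  then show ?thesis using N3 by (simp add: root_def nat_less_iff)
qed
lemma root_add: "root a b + root b c = root a c"
  by (auto simp: root_def fun_eq_iff)
lemma root_minus: "- root a b = root b a"
  by (auto simp: root_def fun_eq_iff)
lemma root_shift [simp]: "root (a + t * N) (b + t * N) = root a b"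
  by (auto simp: root_def)
lemma root_same [simp]: "root a a = 0" by (auto simp: root_def)
lemma cc_eq: "cc n = (\<lambda>k. if k < n then 1 else 0)"
proof
  fix k
  have "cc n k = (\<Sum>i<n. simple i k)" unfolding cc_def by (induction n) auto
  then show "cc n k = (if k < n then 1 else 0)" by (simp add: simple_def)
qed
lemma root_full: "root a (a + t * N) = scale t (cc n)"
  by (auto simp: root_def scale_def cc_eq fun_eq_iff)
lemma root_simple: "root (int i) (int i + 1) = simple i" if "i < n"
proof -
  have "eqm (int i) (int k) \<longleftrightarrow> i = k" if "k < n" for k
    using eqm_close[of "int i" "int k"] \<open>i < n\<close> that by fastforce
  then show ?thesis using that by (auto simp: root_def simple_def fl_step fun_eq_iff)
qed

text \<open>\<open>root c d\<close> is a sum of consecutive simple roots, so a functional with value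
  \<open>q (x + 1) - q x\<close> on \<alpha>_x telescopes to the two ends; periodicity of the
  differences makes it well defined on residues. Heights, the form and the action on roots are all
  evaluated this way.\<close>

lemma root_telescope:
  assumes "periodic (\<lambda>x. q (x + 1) - q x)"
  shows "(\<Sum>i<n. root c d i * (q (int i + 1) - q (int i))) = q d - (q c :: int)"
proof -
  \<comment> \<open>The sum as a function of the upper end; it has the same increments as
    \<open>q\<close>, so the two differ by a constant.\<close>
  define G where "G = (\<lambda>d. psum (\<lambda>i. fl i d * (q (i + 1) - q i)))"
  have step: "G (d + 1) - G d = q (d + 1) - q d" for d
  proof -
    have "G (d + 1) - G d = psum (\<lambda>i. fl i (d+1) * (q (i + 1) - q i) - fl i d * (q (i + 1) - q i))"
      unfolding G_def by (rule psum_diff[symmetric])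
    also have "\<dots> = psum (\<lambda>i. if eqm i d then q (i + 1) - q i else 0)"
    proof (rule arg_cong[of _ _ psum], rule ext)
      fix i
      show "fl i (d + 1) * (q (i + 1) - q i) - fl i d * (q (i + 1) - q i) = (if eqm i d then q (i + 1) - q i else 0)"
        unfolding fl_step eqm_sym[of d i] by (simp add: algebra_simps)
    qed
    also have "\<dots> = q (d + 1) - q d"
    proof -
      have "periodic (\<lambda>i. if eqm i d then q (i + 1) - q i else 0)"
        using assms unfolding periodic_def by (auto simp: algebra_simps)
      from psum_single[OF this, of d] show ?thesis by simp
    qed
    finally show ?thesis .
  qed
  have const: "G d - q d = G 0 - q 0" for d
  proof (induction d rule: int_induct[where k = 0])
    case base then show ?case by simp
  next
    case (step1 i) then show ?case using step[of i] by simp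
  next
    case (step2 i) then show ?case using step[of "i - 1"] by simp
  qed
  have "(\<Sum>i<n. root c d i * (q (int i + 1) - q (int i)))
      = (\<Sum>i<n. (\<lambda>i. fl i d * (q (i + 1) - q i) - fl i c * (q (i + 1) - q i)) (int i))"
    by (rule sum.cong) (auto simp: root_def algebra_simps)
  also have "\<dots> = psum (\<lambda>i. fl i d * (q (i + 1) - q i) - fl i c * (q (i + 1) - q i))"
    by (rule sum_nat_psum)
  also have "\<dots> = G d - G c" unfolding G_def by (rule psum_diff)
  finally show ?thesis using const[of d] const[of c] by simp
qed

lemma root_height: "(\<Sum>i<n. root c d i) = d - c"
  using root_telescope[of "\<lambda>x. x" c d] by (simp add: periodic_def)

text \<open>The inner product of the basis vectors of two residue classes; with it the form of
  \<open>root c d\<close> and \<open>root a b\<close> becomes that of e_c - e_d and e_a -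
  e_b.\<close>

definition dl :: "int \<Rightarrow> int \<Rightarrow> int" where "dl a x = (if eqm x a then 1 else 0)"

lemma dl_shift [simp]: "dl a (x + t * N) = dl a x" "dl a (x + N) = dl a x"
  unfolding dl_def by (metis eqm_shift eqm_trans)+
lemma dl_succ: "dl (a + 1) (x + 1) = dl a x" unfolding dl_def by simp

lemma cartan_dl: assumes "i < n" "j < n"
  shows "cartan n i j = 2 * dl (int i) (int j) - dl (int i) (int j + 1) - dl (int i + 1) (int j)"
proof -
  have c: "eqm (int k) (int l) \<longleftrightarrow> k = l" if "k < n" "l < n" for k l
    using eqm_close[of "int k" "int l"] that by fastforce
  have s: "l = (k + 1) mod n \<longleftrightarrow> eqm (int l) (int k + 1)" if "k < n" "l < n" for k l
  proof -
    have "(k + 1) mod n < n" using n3 by simp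
    then have "l = (k + 1) mod n \<longleftrightarrow> eqm (int l) (int ((k + 1) mod n))" using c that by simp
    also have "\<dots> \<longleftrightarrow> eqm (int l) (int k + 1)" by (simp add: zmod_int eqm_iff_mod add.commute)
    finally show ?thesis .
  qed
  \<comment> \<open>Two nodes of the cyclic diagram are joined by at most one edge because
    \<open>n\<close> is at least 3.\<close>
  have x: "\<not> (eqm (int j) (int i + 1) \<and> eqm (int j + 1) (int i))"
  proof
    assume "eqm (int j) (int i + 1) \<and> eqm (int j + 1) (int i)"
    then have "eqm (int j + 1) (int i + 1 + 1)" "eqm (int j + 1) (int i)" using eqm_add_cancel by blast+
    then have "eqm (int i + 1 + 1) (int i)" using eqm_sym eqm_trans by blast
    then show False using eqm_close[of "int i + 1 + 1" "int i"] N3 by simp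
  qed
  have e: "\<not> eqm (int j) (int i + 1)" "\<not> eqm (int j + 1) (int i)" if "i = j"
    using that by simp_all
  have y: "i = (j + 1) mod n \<longleftrightarrow> eqm (int j + 1) (int i)" using s[of j i] assms eqm_sym by blast
  show ?thesis unfolding cartan_def adjacent_def s[OF assms] y
    using c[OF assms(2,1)] x e by (auto simp: dl_def)
qed

lemma form_root: "form n v (root a b) =
  (\<Sum>i<n. v i * (dl a (int i) - dl b (int i) - dl a (int i + 1) + dl b (int i + 1)))"
proof -
  have "(\<Sum>j<n. root a b j * cartan n i j) =
     dl a (int i) - dl b (int i) - dl a (int i + 1) + dl b (int i + 1)" if "i < n" for i
  proof -
    let ?q = "\<lambda>j. dl (int i + 1) j - dl (int i) j"
    have "(\<Sum>j<n. root a b j * cartan n i j) = (\<Sum>j<n. root a b j * (?q (int j + 1) - ?q (int j)))"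
      by (rule sum.cong) (auto simp: cartan_dl[OF that] dl_succ)
    also have "\<dots> = ?q b - ?q a"
    proof (rule root_telescope)
      have "?q (x + N + 1) - ?q (x + N) = ?q (x + 1) - ?q x" for x
        using dl_shift(2)[of _ "x+1"] by (simp add: algebra_simps)
      then show "periodic (\<lambda>x. ?q (x + 1) - ?q x)" unfolding periodic_def by blast
    qed
    finally show ?thesis by (simp add: dl_def eqm_sym)
  qed
  then have "(\<Sum>i<n. v i * (dl a (int i) - dl b (int i) - dl a (int i + 1) + dl b (int i + 1)))
     = (\<Sum>i<n. v i * (\<Sum>j<n. root a b j * cartan n i j))" by (intro sum.cong) auto
  also have "\<dots> = form n v (root a b)" unfolding form_def by (simp add: sum_distrib_left mult.assoc)
  finally show ?thesis by simp
qed

lemma form_root_root: "form n (root c d) (root a b) = dl a c - dl b c - dl a d + dl b d"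
proof -
  let ?q = "\<lambda>x. dl b x - dl a x"
  have "form n (root c d) (root a b) = (\<Sum>i<n. root c d i * (?q (int i + 1) - ?q (int i)))"
    unfolding form_root by (intro sum.cong) (auto simp: algebra_simps)
  also have "\<dots> = ?q d - ?q c"
  proof (rule root_telescope)
    have "?q (x + N + 1) - ?q (x + N) = ?q (x + 1) - ?q x" for x
      using dl_shift(2)[of _ "x+1"] by (simp add: algebra_simps)
    then show "periodic (\<lambda>x. ?q (x + 1) - ?q x)" unfolding periodic_def by blast
  qed
  finally show ?thesis by simp
qed

lemma act_root: assumes "ashift f" shows "act f (root a b) = root (f a) (f b)"
proof
  fix k
  show "act f (root a b) k = root (f a) (f b) k"
  proof (cases "k < n")
    case True
    let ?q = "\<lambda>x. fl (int k) (f x)"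
    have "?q (x + N + 1) - ?q (x + N) = ?q (x + 1) - ?q x" for x
    proof -
      have "f (x + N + 1) = f (x + 1) + N" "f (x + N) = f x + N"
        using assms[unfolded ashift_def, rule_format, of "x + 1"] assms[unfolded ashift_def, rule_format, of x]
        by (simp_all add: algebra_simps)
      then show ?thesis by simp
    qed
    then have "periodic (\<lambda>x. ?q (x + 1) - ?q x)" unfolding periodic_def by blast
    from root_telescope[OF this, of a b] True show ?thesis by (simp add: act_def root_def)
  next
    case False then show ?thesis by (simp add: act_def root_def)
  qed
qed

lemma act_comp: assumes "ashift f" shows "act f \<circ> act g = act (f \<circ> g)"
proof (intro ext)
  fix v k
  show "(act f \<circ> act g) v k = act (f \<circ> g) v k"
  proof (cases "k < n")
    case True
    have "(act f \<circ> act g) v k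
      = (\<Sum>i<n. \<Sum>j<n. v j * root (g (int j)) (g (int j + 1)) i * root (f (int i)) (f (int i + 1)) k)"
      using True by (simp add: act_def sum_distrib_right)
    also have "\<dots> = (\<Sum>j<n. \<Sum>i<n. v j * root (g (int j)) (g (int j + 1)) i * root (f (int i)) (f (int i + 1)) k)"
      by (rule sum.swap)
    also have "\<dots> = (\<Sum>j<n. v j * act f (root (g (int j)) (g (int j + 1))) k)"
      using True by (simp add: act_def sum_distrib_left mult.assoc)
    also have "\<dots> = act (f \<circ> g) v k" using True by (simp add: act_root[OF assms] act_def[of "f \<circ> g"])
    finally show ?thesis .
  next
    case False then show ?thesis by (simp add: act_def)
  qed
qed

lemma act_id: "act id = id"
proof (intro ext)
  fix v :: lat and k
  show "act id v k = id v k"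
  proof (cases "k < n")
    case True
    have "(\<Sum>i<n. v i * root (int i) (int i + 1) k) = (\<Sum>i<n. if i = k then v i else 0)"
      by (rule sum.cong) (auto simp: root_simple simple_def)
    then show ?thesis using True by (simp add: act_def)
  qed (simp add: act_def)
qed

text \<open>The heights of the images of roots determine all differences of values of
  \<open>f\<close>; the remaining additive constant is fixed by the vanishing sum in
  \<open>aperm\<close>.\<close>

lemma act_inj: assumes "aperm f" "aperm g" "act f = act g" shows "f = g"
proof -
  have h: "f b - f a = g b - g a" for a b
  proof -
    have "root (f a) (f b) = root (g a) (g b)"
      using act_root[of f a b] act_root[of g a b] assms by (simp add: aperm_def)
    then show ?thesis using root_height by metis
  qed
  define K where "K = f 0 - g 0"
  have "f c - c = (g c - c) + K" for c using h[of c 0] by (simp add: K_def)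
  then have "psum (\<lambda>c. f c - c) = psum (\<lambda>c. g c - c) + N * K"
    by (simp add: psum_def sum.distrib sum_subtractf)
  then have "K = 0" using assms N3 by (simp add: aperm_def)
  then have "f 0 = g 0" by (simp add: K_def)
  then show ?thesis using h[of _ 0] by (auto simp: fun_eq_iff)
qed

section \<open>Reflections as affine transpositions\<close>

definition tr :: "int \<Rightarrow> int \<Rightarrow> int \<Rightarrow> int" where
  "tr a b x = (if eqm x a then x + (b - a) else if eqm x b then x + (a - b) else x)"

lemma tr_vals: "tr a b a = b" "\<not> eqm a b \<Longrightarrow> tr a b b = a"
  "\<not> eqm x a \<Longrightarrow> \<not> eqm x b \<Longrightarrow> tr a b x = x"
  by (auto simp: tr_def eqm_sym)
lemma eqm_add_left: "eqm x a \<Longrightarrow> eqm (x + (b - a)) b"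
  unfolding eqm_def by (simp add: algebra_simps)
lemma tr_tr: assumes "\<not> eqm a b" shows "tr a b (tr a b x) = x"
  using assms eqm_add_left[of x a b] eqm_add_left[of x b a] unfolding tr_def
  by (auto simp: algebra_simps) (metis eqm_sym eqm_trans)+
lemma tr_comp: "\<not> eqm a b \<Longrightarrow> tr a b \<circ> tr a b = id" by (auto simp: tr_tr)
lemma tr_ashift: "ashift (tr a b)"
  unfolding ashift_def tr_def by simp
lemma tr_bij: "\<not> eqm a b \<Longrightarrow> bij (tr a b)" using tr_tr by (intro involuntory_imp_bij) auto
lemma ashift_periodic: "ashift f \<Longrightarrow> periodic (\<lambda>x. f x - x)" unfolding ashift_def periodic_def by simp
lemma ashift_comp: "ashift f \<Longrightarrow> ashift g \<Longrightarrow> ashift (f \<circ> g)" by (simp add: ashift_def)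
lemma tr_aperm: assumes "\<not> eqm a b" shows "aperm (tr a b)"
proof -
  have "psum (\<lambda>c. tr a b c - c) - psum (\<lambda>c. 0) = (tr a b a - a - 0) + (tr a b b - b - 0)"
    by (rule psum_change2) (use assms in \<open>auto simp: ashift_periodic tr_ashift tr_vals periodic_def tr_ashift[unfolded ashift_def]\<close>)
  then show ?thesis using assms by (simp add: aperm_def tr_bij tr_ashift tr_vals psum_def)
qed
lemma psum_comp: assumes "ashift f" "bij g" "ashift g"
  shows "psum (\<lambda>c. (f \<circ> g) c - c) = psum (\<lambda>c. f c - c) + psum (\<lambda>c. g c - c)"
proof -
  have "psum (\<lambda>c. f (g c) - g c) = psum (\<lambda>c. f c - c)"
    using psum_reindex[OF ashift_periodic[OF assms(1)] assms(2,3)] .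
  then show ?thesis using psum_add[of "\<lambda>c. f (g c) - g c" "\<lambda>c. g c - c"] by simp
qed
lemma aperm_comp: "aperm f \<Longrightarrow> aperm g \<Longrightarrow> aperm (f \<circ> g)"
  unfolding aperm_def using psum_comp[of f g] by (auto simp: ashift_comp bij_comp)
lemma aperm_id: "aperm id" by (simp add: aperm_def ashift_def psum_def)
lemma ashift_inv: assumes "bij f" "ashift f" shows "ashift (inv f)"
  unfolding ashift_def
proof
  fix x
  have "f (inv f x + N) = x + N" using assms by (simp add: ashift_def bij_is_surj surj_f_inv_f)
  then show "inv f (x + N) = inv f x + N" using assms(1) by (metis bij_inv_eq_iff)
qed
lemma aperm_inv: assumes "aperm f" shows "aperm (inv f)"
proof -
  have f: "bij f" "ashift f" "psum (\<lambda>c. f c - c) = 0" using assms by (auto simp: aperm_def)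
  have "psum (\<lambda>c. (f \<circ> inv f) c - c) = psum (\<lambda>c. f c - c) + psum (\<lambda>c. inv f c - c)"
    using f by (intro psum_comp) (auto simp: bij_imp_bij_inv ashift_inv)
  moreover have "(f \<circ> inv f) c = c" for c using f by (simp add: bij_is_surj surj_f_inv_f)
  ultimately show ?thesis using f by (simp add: aperm_def bij_imp_bij_inv ashift_inv psum_def)
qed
lemma aperm_inv_f: "aperm f \<Longrightarrow> inv f (f x) = x" "aperm f \<Longrightarrow> f (inv f x) = x"
  by (simp_all add: aperm_def bij_is_inj bij_is_surj surj_f_inv_f)

lemma root_tr: assumes "\<not> eqm a b"
  shows "root (tr a b x) (tr a b y) = root x y - scale (form n (root x y) (root a b)) (root a b)"
proof -
  have s: "root x (tr a b x) = scale (dl a x - dl b x) (root a b)" for x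
  proof -
    have 1: "root x (x + (d - c)) = root c d" if "eqm x c" for c d
    proof -
      obtain t where "x = c + t * N" using \<open>eqm x c\<close> by (rule eqm_E)
      moreover have "c + t * N + (d - c) = d + t * N" by simp
      ultimately show ?thesis by (metis root_shift)
    qed
    have 2: "\<not> (eqm x a \<and> eqm x b)" using assms eqm_sym eqm_trans by blast
    show ?thesis using 1[of a b] 1[of b a] 2 root_minus[of a b] unfolding tr_def dl_def
      by (auto simp: scale_def fun_eq_iff)
  qed
  have "root (tr a b x) (tr a b y) = root x y - root x (tr a b x) + root y (tr a b y)"
    using root_add[of x "tr a b x" "tr a b y"] root_add[of x y "tr a b y"] by (simp add: algebra_simps)
  also have "\<dots> = root x y - scale (form n (root x y) (root a b)) (root a b)"
    unfolding s form_root_root by (auto simp: scale_def fun_eq_iff algebra_simps)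
  finally show ?thesis .
qed

lemma refl_root: assumes "\<not> eqm a b" shows "refl n (root a b) = act (tr a b)"
proof (intro ext)
  fix v :: lat and k
  show "refl n (root a b) v k = act (tr a b) v k"
  proof (cases "k < n")
    case True
    have e: "root (int i) (int i + 1) k * 1 = (if i = k then 1 else 0)" if "i < n" for i
      using that by (simp add: root_simple simple_def)
    have "act (tr a b) v k = (\<Sum>i<n. (if i = k then v i else 0)
        - v i * form n (root (int i) (int i + 1)) (root a b) * root a b k)"
      unfolding act_def using True e
      by (auto simp: root_tr[OF assms] scale_def algebra_simps intro!: sum.cong)
    also have "\<dots> = v k - (\<Sum>i<n. v i * form n (root (int i) (int i + 1)) (root a b)) * root a b k"
      using True by (simp add: sum_subtractf sum_distrib_right)
    also have "(\<Sum>i<n. v i * form n (root (int i) (int i + 1)) (root a b)) = form n v (root a b)"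
      unfolding form_root_root form_root[of v] by (auto intro!: sum.cong)
    finally show ?thesis by (simp add: refl_def scale_def)
  next
    case False then show ?thesis by (simp add: refl_def scale_def act_def root_def)
  qed
qed

lemma sref_act: "i < n \<Longrightarrow> sref n i = act (tr (int i) (int i + 1))"
  using refl_root[of "int i" "int i + 1"] by (simp add: sref_def root_simple)

text \<open>This is the translation by \<open>m\<close> times e_p - e_q, see
  \<open>transl_tsh\<close>.\<close>

definition tsh :: "int \<Rightarrow> int \<Rightarrow> int \<Rightarrow> int \<Rightarrow> int" where
  "tsh m p q x = (if eqm x p then x + m * N else if eqm x q then x - m * N else x)"

lemma form_scale: "form n (scale m a) b = m * form n a b"
  unfolding form_def scale_def by (simp add: sum_distrib_left mult.assoc)
lemma form_add: "form n (a + a') b = form n a b + form n a' b"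
  unfolding form_def by (simp add: sum.distrib algebra_simps)
lemma tsh_ashift: "ashift (tsh m p q)"
  unfolding ashift_def tsh_def by simp

lemma form_sym: "form n a b = form n b a"
proof -
  have "cartan n i j = cartan n j i" for i j unfolding cartan_def adjacent_def by auto
  then have "form n b a = (\<Sum>i<n. \<Sum>j<n. a j * b i * cartan n j i)"
    unfolding form_def by (intro sum.cong) (auto simp: mult.commute mult.left_commute)
  also have "\<dots> = form n a b" unfolding form_def by (rule sum.swap)
  finally show ?thesis by simp
qed

lemma transl_tsh: assumes "\<not> eqm p q" shows "transl n (scale m (root p q)) = act (tsh m p q)"
proof (intro ext)
  fix v :: lat and k
  show "transl n (scale m (root p q)) v k = act (tsh m p q) v k"
  proof (cases "k < n")
    case True
    have s: "root x (tsh m p q x) = scale (m * (dl p x - dl q x)) (cc n)" for x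
    proof -
      have 2: "\<not> (eqm x p \<and> eqm x q)" using assms eqm_sym eqm_trans by blast
      show ?thesis using 2 root_full[of x m] root_full[of x "-m"] unfolding tsh_def dl_def
        by (auto simp: scale_def fun_eq_iff)
    qed
    have t: "root (tsh m p q x) (tsh m p q y) = root x y
        - scale (m * form n (root x y) (root p q)) (cc n)" for x y
    proof -
      have "root (tsh m p q x) (tsh m p q y) = root x y - root x (tsh m p q x) + root y (tsh m p q y)"
        using root_add[of x "tsh m p q x" "tsh m p q y"] root_add[of x y "tsh m p q y"] by (simp add: algebra_simps)
      then show ?thesis unfolding s form_root_root by (auto simp: scale_def fun_eq_iff algebra_simps)
    qed
    have e: "root (int i) (int i + 1) k * 1 = (if i = k then 1 else 0)" if "i < n" for i
      using that by (simp add: root_simple simple_def)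
    have "act (tsh m p q) v k = (\<Sum>i<n. (if i = k then v i else 0)
        - m * (v i * form n (root (int i) (int i + 1)) (root p q)))"
      unfolding act_def using True e
      by (auto simp: t scale_def cc_eq algebra_simps intro!: sum.cong)
    also have "\<dots> = v k - m * (\<Sum>i<n. v i * form n (root (int i) (int i + 1)) (root p q))"
      using True by (simp add: sum_subtractf sum_distrib_left)
    also have "(\<Sum>i<n. v i * form n (root (int i) (int i + 1)) (root p q)) = form n v (root p q)"
      unfolding form_root_root form_root[of v] by (auto intro!: sum.cong)
    finally show ?thesis using True
      by (simp add: transl_def scale_def[of "m * form n (root p q) v"] cc_eq form_scale form_sym[of v])
  next
    case False then show ?thesis by (simp add: transl_def scale_def cc_eq act_def)
  qed
qed

text \<open>The imaginary root lies in the radical of the form. Hence one formula serves both sets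
  in claim (1), and the distinction by \<alpha>_0 disappears.\<close>

lemma transl_cc: "transl n (scale m (b - cc n)) = transl n (scale m b)"
proof -
  have z: "form n (cc n) v = 0" for v
  proof -
    have "form n (cc n) v = form n v (root 0 (0 + 1 * N))"
      unfolding root_full by (simp add: form_sym scale_def)
    also have "\<dots> = 0" unfolding form_root
    proof (rule sum.neutral, rule ballI)
      fix i
      show "v i * (dl 0 (int i) - dl (0 + 1 * N) (int i) - dl 0 (int i + 1) + dl (0 + 1 * N) (int i + 1)) = 0"
      proof -
        have "dl (0 + 1 * N) x = dl 0 x" for x unfolding dl_def
          by (metis eqm_shift(1,2) eqm_trans)
        then show ?thesis by simp
      qed
    qed
    finally show ?thesis .
  qed
  have "form n (scale m (b - cc n)) v = form n (scale m b) v" for v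
    using form_add[of "b - cc n" "cc n" v] by (simp add: form_scale z)
  then show ?thesis by (simp add: transl_def)
qed

subsection \<open>Real roots and rank functions\<close>

lemma root_sum_simple: assumes "i \<le> j" "j < n"
  shows "(\<Sum>k\<in>{i..j}. simple k) = root (int i) (int j + 1)"
  using assms
proof (induction j rule: dec_induct)
  case base then show ?case by (simp add: root_simple)
next
  case (step j)
  have "(\<Sum>k\<in>{i..Suc j}. simple k) = (\<Sum>k\<in>{i..j}. simple k) + simple (Suc j)"
    using step.hyps by (simp add: add.commute)
  also have "\<dots> = root (int i) (int j + 1) + root (int (Suc j)) (int (Suc j) + 1)"
    using step root_simple[of "Suc j"] by simp
  also have "\<dots> = root (int i) (int (Suc j) + 1)"
  proof -
    have "int (Suc j) = int j + 1" by simp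
    then show ?thesis by (simp only: root_add)
  qed
  finally show ?case .
qed

lemma fin_pos_eq: "fin_pos_roots n = {root a b | a b. 1 \<le> a \<and> a < b \<and> b \<le> N}"
proof (intro equalityI subsetI)
  fix x assume "x \<in> fin_pos_roots n"
  then obtain i j where ij: "x = (\<Sum>k\<in>{i..j}. simple k)" "1 \<le> i" "i \<le> j" "j \<le> n - 1"
    unfolding fin_pos_roots_def by blast
  then have "x = root (int i) (int j + 1)" "1 \<le> int i" "int i < int j + 1" "int j + 1 \<le> N"
    using root_sum_simple[of i j] n3 by auto
  then show "x \<in> {root a b | a b. 1 \<le> a \<and> a < b \<and> b \<le> N}" by blast
next
  fix x assume "x \<in> {root a b | a b. 1 \<le> a \<and> a < b \<and> b \<le> N}"
  then obtain a b where ab: "x = root a b" "1 \<le> a" "a < b" "b \<le> N" by blast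
  define i where "i = nat a"
  define j where "j = nat (b - 1)"
  have "int i = a" "int j = b - 1" using ab by (auto simp: i_def j_def)
  moreover from this have "1 \<le> i" "i \<le> j" "j \<le> n - 1" "j < n" using ab by linarith+
  ultimately show "x \<in> fin_pos_roots n" unfolding fin_pos_roots_def using root_sum_simple[of i j] ab(1)
    by (metis (mono_tags, lifting) diff_add_cancel mem_Collect_eq)
qed

lemma fl_base1 [simp]: "fl (k + N) x = fl k x - 1" using fl_base[of k 1] by simp

lemma root_scale_cc: "root a b + scale t (cc n) = root a (b + t * N)"
  using root_add[of a b "b + t * N"] root_full[of b t] by simp

lemma pos_real_roots_eq: "pos_real_roots n = {root a b | a b. a < b \<and> \<not> eqm a b}"
proof (intro equalityI subsetI)
  fix x assume "x \<in> pos_real_roots n"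
  then obtain a m where x: "x = a + scale m (cc n)"
    "(m > 0 \<and> a \<in> fin_roots n) \<or> (m = 0 \<and> a \<in> fin_pos_roots n)"
    unfolding pos_real_roots_def by blast
  then consider (1) "m \<ge> 0" "a \<in> fin_pos_roots n" | (2) "m > 0" "- a \<in> fin_pos_roots n"
    unfolding fin_roots_def by fastforce
  then show "x \<in> {root a b | a b. a < b \<and> \<not> eqm a b}"
  proof cases
    case 1
    then obtain p q where pq: "a = root p q" "1 \<le> p" "p < q" "q \<le> N" unfolding fin_pos_eq by blast
    have "\<not> eqm p q" using eqm_close[of p q] pq by auto
    then have "\<not> eqm p (q + m * N)" using eqm_shift(1) eqm_trans by blast
    moreover have "0 \<le> m * N" using 1 by simp
    then have "p < q + m * N" using pq by linarith
    moreover have "x = root p (q + m * N)" using x(1) pq(1) root_scale_cc by simp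
    ultimately show ?thesis by blast
  next
    case 2
    then obtain p q where pq: "- a = root p q" "1 \<le> p" "p < q" "q \<le> N" unfolding fin_pos_eq by blast
    have "\<not> eqm q p" using eqm_close[of q p] pq by auto
    then have "\<not> eqm q (p + m * N)" using eqm_shift(1) eqm_trans by blast
    moreover have "1 * N \<le> m * N" using 2 by (intro mult_right_mono) auto
    then have "q < p + m * N" using pq by linarith
    moreover have "x = root q (p + m * N)"
      using x(1) pq(1) root_scale_cc[of q p m] root_minus[of p q] by (metis minus_minus)
    ultimately show ?thesis by blast
  qed
next
  fix x assume "x \<in> {root a b | a b. a < b \<and> \<not> eqm a b}"
  then obtain a b where ab: "x = root a b" "a < b" "\<not> eqm a b" by blast
  \<comment> \<open>Both ends are moved into the window from 1 to \<open>N\<close>, whose steps are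
    \<alpha>_1, ..., \<alpha>_{n-1} without \<alpha>_0; the difference of the two shifts becomes the
    multiple of the imaginary root.\<close>
  obtain s where s: "1 \<le> a + s * N" "a + s * N < 1 + N" using eqm_rep[of 1 a] by blast
  obtain t where t: "1 \<le> b + t * N" "b + t * N < 1 + N" using eqm_rep[of 1 b] by blast
  define p q m where "p = a + s * N" and "q = b + t * N" and "m = s - t"
  have x: "x = root p q + scale m (cc n)"
    unfolding root_scale_cc ab(1) p_def q_def m_def
    using root_shift[of a s b] by (simp add: algebra_simps)
  have q: "q + m * N = b + s * N" by (simp add: q_def m_def algebra_simps)
  then have lt: "p < q + m * N" using ab(2) by (simp add: p_def)
  have ne: "p \<noteq> q"
  proof
    assume "p = q"
    then have "eqm a q" using eqm_shift(2)[of a s] by (simp add: p_def)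
    then show False using ab(3) eqm_trans[of a q b] by (simp add: q_def)
  qed
  have m0: "m \<ge> 0"
  proof (rule ccontr)
    assume "\<not> m \<ge> 0"
    then have "m * N \<le> (-1) * N" by (intro mult_right_mono) auto
    then show False using lt s t by (simp add: p_def q_def)
  qed
  show "x \<in> pos_real_roots n"
  proof (cases "p < q")
    case True
    then have "root p q \<in> fin_pos_roots n" unfolding fin_pos_eq using s t by (auto simp: p_def q_def intro!: exI)
    then have "(m > 0 \<and> root p q \<in> fin_roots n) \<or> (m = 0 \<and> root p q \<in> fin_pos_roots n)"
      using m0 unfolding fin_roots_def by auto
    then show ?thesis unfolding pos_real_roots_def using x by blast
  next
    case False
    then have "root q p \<in> fin_pos_roots n" unfolding fin_pos_eq using s t ne by (auto simp: p_def q_def intro!: exI)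
    then have "root p q \<in> fin_roots n" unfolding fin_roots_def using root_minus[of q p] by (metis UnCI imageI)
    moreover have "m > 0" using lt False m0 by (cases "m = 0") auto
    ultimately show ?thesis unfolding pos_real_roots_def using x by blast
  qed
qed

text \<open>In the class of \<open>c\<close>, the integers \<open>c + t * N \<le> i\<close> whose
  image exceeds \<open>l\<close> are those with \<open>t\<close> from \<open>- fl l (v c)\<close> to
  \<open>- fl i c - 1\<close>; the summand is their number.\<close>

definition rk :: "(int \<Rightarrow> int) \<Rightarrow> int \<Rightarrow> int \<Rightarrow> int" where
  "rk v i l = psum (\<lambda>c. max 0 (fl l (v c) - fl i c))"

lemma rk_periodic: "ashift v \<Longrightarrow> periodic (\<lambda>c. max 0 (fl l (v c) - fl i c))"
  by (simp add: periodic_def ashift_def)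
lemma rk_nonneg: "0 \<le> rk v i l" unfolding rk_def by (rule psum_nonneg) simp
lemma rk_shift: "rk v (i + N) (l + N) = rk v i l" unfolding rk_def by simp
lemma rk_step: assumes "ashift v"
  shows "rk v (i + 1) l = rk v i l + (if l < v (i + 1) then 1 else 0)"
proof -
  let ?d = "\<lambda>c. max 0 (fl l (v c) - fl (i+1) c) - max 0 (fl l (v c) - fl i c)"
  have "rk v (i + 1) l - rk v i l = psum ?d" unfolding rk_def by (rule psum_diff[symmetric])
  also have "\<dots> = ?d (i + 1)"
  proof (rule psum_single)
    show "periodic ?d" using assms by (simp add: periodic_def ashift_def)
  qed (simp add: fl_base_step)
  also have "\<dots> = (if l < v (i + 1) then 1 else 0)"
    using fl_nonneg_iff[of l "v (i+1)"] by (auto simp: fl_self)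
  finally show ?thesis by simp
qed

lemma psum_fl_diff: "psum (\<lambda>c. fl l c - fl i c) = i - l"
proof -
  have step: "psum (fl (l + 1)) = psum (fl l) - 1" for l
  proof -
    have "psum (fl (l + 1)) - psum (fl l) = psum (\<lambda>c. fl (l + 1) c - fl l c)" by (rule psum_diff[symmetric])
    also have "\<dots> = fl (l+1) (l+1) - fl l (l+1)"
      by (rule psum_single) (auto simp: periodic_def fl_base_step)
    finally show ?thesis by (simp add: fl_self)
  qed
  have d: "psum (fl l) = psum (fl 0) - l" for l
  proof (induction l rule: int_induct[where k = 0])
    case base then show ?case by simp
  next
    case (step1 i) then show ?case using step[of i] by simp
  next
    case (step2 i) then show ?case using step[of "i - 1"] by simp
  qed
  have "psum (\<lambda>c. fl l c - fl i c) = psum (fl l) - psum (fl i)" by (rule psum_diff)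
  then show ?thesis using d[of l] d[of i] by linarith
qed

text \<open>Up to the factor \<open>N\<close>, \<open>fl l x\<close> is \<open>x\<close> minus a
  constant and a remainder; \<open>v\<close> permutes the remainders, and the displacements sum to
  zero.\<close>

lemma psum_fl_aperm: assumes "aperm v" shows "psum (\<lambda>c. fl l (v c) - fl l c) = 0"
proof -
  let ?r = "\<lambda>x. (x - l - 1) mod N"
  have "periodic ?r" unfolding periodic_def by (metis add_diff_eq diff_add_eq mod_add_self2)
  then have r: "psum (\<lambda>c. ?r (v c)) = psum ?r" by (rule psum_reindex) (use assms in \<open>auto simp: aperm_def\<close>)
  have f: "N * fl l x = x - l - 1 - ?r x" for x
    unfolding fl_def by (simp add: minus_mod_eq_mult_div)
  have "N * psum (\<lambda>c. fl l (v c) - fl l c) = psum (\<lambda>c. N * fl l (v c) - N * fl l c)"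
    unfolding psum_def by (simp add: sum_distrib_left right_diff_distrib)
  also have "\<dots> = psum (\<lambda>c. (v c - c) - (?r (v c) - ?r c))"
    unfolding f by (rule arg_cong[of _ _ psum]) (auto simp: fun_eq_iff)
  also have "\<dots> = psum (\<lambda>c. v c - c) - (psum (\<lambda>c. ?r (v c)) - psum ?r)" by (simp only: psum_diff)
  also have "\<dots> = 0" using r assms by (simp add: aperm_def)
  finally show ?thesis using N3 by simp
qed

text \<open>From \<open>max 0 x - max 0 (- x) = x\<close>: upward crossings minus downward crossings
  is a linear expression whose sum is known. On the diagonal this makes the rank invariant under
  inversion.\<close>

lemma rk_inv: assumes "aperm v" shows "rk v i l = i - l + rk (inv v) l i"
proof -
  let ?p = "\<lambda>c. max 0 (fl i (inv v c) - fl l c)"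
  have "rk (inv v) l i = psum (\<lambda>c. ?p (v c))"
    unfolding rk_def
    by (rule psum_reindex[symmetric]) (use assms aperm_inv[OF assms] in \<open>auto simp: aperm_def intro!: rk_periodic\<close>)
  also have "\<dots> = psum (\<lambda>c. max 0 (fl i c - fl l (v c)))" using assms by (simp add: aperm_inv_f)
  finally have "rk v i l - rk (inv v) l i
      = psum (\<lambda>c. max 0 (fl l (v c) - fl i c) - max 0 (fl i c - fl l (v c)))"
    unfolding psum_diff by (simp add: rk_def)
  also have "\<dots> = psum (\<lambda>c. (fl l (v c) - fl l c) + (fl l c - fl i c))"
    by (rule arg_cong[of _ _ psum]) (auto simp: fun_eq_iff)
  also have "\<dots> = i - l" unfolding psum_add by (simp only: psum_fl_aperm[OF assms] psum_fl_diff)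
  finally show ?thesis by simp
qed

lemma rk_diag_inv: "aperm v \<Longrightarrow> rk (inv v) k k = rk v k k" using rk_inv[of v k k] by simp

lemma rk_step2: assumes "aperm v"
  shows "rk v i (l + 1) = rk v i l - (if inv v (l + 1) \<le> i then 1 else 0)"
  using rk_inv[OF assms, of i "l+1"] rk_inv[OF assms, of i l] rk_step[OF aperm_ashift[OF aperm_inv[OF assms]], of l i]
  by auto

text \<open>Passing from \<open>k - 1\<close> to \<open>k\<close> opens the arc starting at
  \<open>k\<close> if it goes up, and closes the arc ending at \<open>k\<close> if it comes from
  below.\<close>

lemma rk_diag_step: assumes "aperm v"
  shows "rk v k k = rk v (k-1) (k-1) + (if k < v k then 1 else 0) - (if inv v k < k then 1 else 0)"
  using rk_step[OF aperm_ashift[OF assms], of "k-1" k] rk_step2[OF assms, of "k-1" "k-1"] by auto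

lemma rk_mono1: assumes "ashift v" "i \<le> i'" shows "rk v i l \<le> rk v i' l \<and> rk v i' l \<le> rk v i l + (i' - i)"
  using assms(2)
proof (induction i' rule: int_ge_induct)
  case (step j) then show ?case using rk_step[OF assms(1), of j l] by auto
qed simp
lemma rk_mono2: assumes "aperm v" "l \<le> l'" shows "rk v i l' \<le> rk v i l \<and> rk v i l \<le> rk v i l' + (l' - l)"
  using assms(2)
proof (induction l' rule: int_ge_induct)
  case (step j) then show ?case using rk_step2[OF assms(1), of i j] by auto
qed simp

text \<open>The rank is monotone in each argument with steps of at most one. Used at diagonal
  points, this turns bounds by the degree into bounds everywhere.\<close>

lemma rk_upper: assumes "aperm v" shows "rk v i l \<le> rk v k j + max 0 (i - k) + max 0 (j - l)"
proof -
  have "rk v i l \<le> rk v k l + max 0 (i - k)"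
    using rk_mono1[OF aperm_ashift[OF assms], of i k l] rk_mono1[OF aperm_ashift[OF assms], of k i l] by linarith
  moreover have "rk v k l \<le> rk v k j + max 0 (j - l)"
    using rk_mono2[OF assms, of l j k] rk_mono2[OF assms, of j l k] by linarith
  ultimately show ?thesis by linarith
qed

lemma rk_lower: assumes "aperm v" shows "max 0 (i - l) \<le> rk v i l"
  using rk_inv[OF assms, of i l] rk_nonneg[of v i l] rk_nonneg[of "inv v" l i] by linarith

lemma rk_id: "rk id i l = max 0 (i - l)"
proof -
  have z: "rk id i l = 0" if "i \<le> l" for i l
  proof -
    have "fl l c \<le> fl i c" for c unfolding fl_def using that N3 by (intro zdiv_mono1) auto
    then show ?thesis unfolding rk_def psum_def by (intro sum.neutral) auto
  qed
  show ?thesis using z[of i l] z[of l i] rk_inv[OF aperm_id, of i l] by (cases "i \<le> l") auto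
qed

text \<open>By \<open>rk_step\<close> the jump of the rank from \<open>i - 1\<close> to
  \<open>i\<close> is 1 exactly for \<open>l < v i\<close>, which reveals
  \<open>v i\<close>.\<close>

lemma rk_ext: assumes "ashift v" "ashift w" "\<And>i l. rk v i l = rk w i l" shows "v = w"
proof
  fix i
  have "l < v i \<longleftrightarrow> l < w i" for l
    using rk_step[OF assms(1), of "i - 1" l] rk_step[OF assms(2), of "i - 1" l] assms(3)
    by (auto split: if_splits)
  from this[of "v i"] this[of "w i"] show "v i = w i" by auto
qed

lemma rk_swap: assumes "ashift v" "\<not> eqm i j"
  shows "rk (v \<circ> tr i j) p q - rk v p q = max 0 (fl q (v j) - fl p i) + max 0 (fl q (v i) - fl p j)
    - max 0 (fl q (v i) - fl p i) - max 0 (fl q (v j) - fl p j)"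
proof -
  have "rk (v \<circ> tr i j) p q - rk v p q =
    (max 0 (fl q ((v \<circ> tr i j) i) - fl p i) - max 0 (fl q (v i) - fl p i))
    + (max 0 (fl q ((v \<circ> tr i j) j) - fl p j) - max 0 (fl q (v j) - fl p j))"
    unfolding rk_def
    by (rule psum_change2) (use assms in \<open>auto intro!: rk_periodic simp: ashift_comp[unfolded comp_def] tr_ashift tr_vals\<close>)
  then show ?thesis using assms(2) by (simp add: tr_vals)
qed

lemma rk_swap_mono: assumes "ashift v" "\<not> eqm i j" "i < j" "v i < v j"
  shows "rk v p q \<le> rk (v \<circ> tr i j) p q"
proof -
  have "fl p i \<le> fl p j" "fl q (v i) \<le> fl q (v j)" using assms by (auto intro: fl_mono)
  then show ?thesis using rk_swap[OF assms(1,2), of p q] by (simp add: max_def split: if_splits)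
qed

text \<open>Being monotone, \<open>fl k\<close> commutes with \<open>min\<close> and
  \<open>max\<close>, and the four terms of \<open>rk_swap\<close> collapse. What remains counts the
  integers congruent to \<open>k\<close> from \<open>max i (v i)\<close> up to but excluding
  \<open>min j (v j)\<close>; when this stretch is empty, a step up in the Bruhat order costs no
  degree.\<close>

lemma rk_swap_diag: assumes "ashift v" "\<not> eqm i j" "i < j" "v i < v j"
  shows "rk (v \<circ> tr i j) k k = rk v k k + max 0 (fl k (min j (v j)) - fl k (max i (v i)))"
proof -
  have m: "mono (fl k)" by (intro monoI fl_mono)
  have "fl k i \<le> fl k j" "fl k (v i) \<le> fl k (v j)" using assms by (auto intro: fl_mono)
  then show ?thesis using rk_swap[OF assms(1,2), of k k] 
    unfolding min_of_mono[OF m, symmetric] max_of_mono[OF m, symmetric]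
    by (simp add: max_def min_def split: if_splits)
qed

text \<open>In the descending case the swap is undone by an ascending one, so the rank does not grow
  at all.\<close>

lemma rk_swap_bound: assumes "ashift v" "bij v" "\<not> eqm i j" "i < j"
  shows "rk (v \<circ> tr i j) k k \<le> rk v k k + (fl k j - fl k i)"
proof (cases "v i < v j")
  case True
  have "fl k (min j (v j)) \<le> fl k j" "fl k i \<le> fl k (max i (v i))" "fl k i \<le> fl k j"
    using assms(4) by (auto intro!: fl_mono)
  then show ?thesis using rk_swap_diag[OF assms(1,3,4) True, of k] by simp
next
  case False
  let ?w = "v \<circ> tr i j"
  have "v j \<noteq> v i" using assms by (auto simp: bij_def inj_def)
  then have "?w i < ?w j" using False assms(3) by (simp add: tr_vals)
  then have "rk ?w k k \<le> rk (?w \<circ> tr i j) k k"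
    by (intro rk_swap_mono) (use assms in \<open>auto simp: ashift_comp tr_ashift\<close>)
  also have "?w \<circ> tr i j = v" using tr_comp[OF assms(3)] by (simp add: comp_assoc)
  finally show ?thesis using fl_mono[of i j k] assms(4) by linarith
qed

subsection \<open>Length and Bruhat steps\<close>

definition gg :: "(int \<Rightarrow> int) \<Rightarrow> int \<Rightarrow> int \<Rightarrow> int" where
  "gg v i j = \<bar>(v j - v i) div N - (j - i) div N\<bar>"

text \<open>\<open>gg v i j\<close> counts the inversions between the residue classes of \<open>i\<close> and \<open>j\<close> (Shi's formula),
  so \<open>Lg\<close>, which sees every pair of classes twice, is twice the length.\<close>

definition Lg :: "(int \<Rightarrow> int) \<Rightarrow> int" where "Lg v = psum (\<lambda>i. psum (\<lambda>j. gg v i j))"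

lemma gg_same [simp]: "gg v i i = 0" by (simp add: gg_def)
lemma div_add_N: "(x + N) div N = x div N + 1" "(x - N) div N = x div N - 1"
  using N3 div_add_self2[of N x] div_add_self2[of N "x - N"] by auto
lemma gg_shift: assumes "ashift v" shows "gg v (i + N) j = gg v i j" "gg v i (j + N) = gg v i j"
proof -
  have "v j - (v i + N) = (v j - v i) - N" "j - (i + N) = (j - i) - N"
    "v j + N - v i = (v j - v i) + N" "j + N - i = (j - i) + N" by simp_all
  then show "gg v (i + N) j = gg v i j" "gg v i (j + N) = gg v i j"
    using assms unfolding gg_def ashift_def by (simp_all only: div_add_N)
qed
lemma div_neg: "\<not> N dvd x \<Longrightarrow> (- x) div N = - (x div N) - 1"
  using zdiv_zminus1_eq_if[of N x] N3 by (auto simp: dvd_eq_mod_eq_0)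
lemma gg_sym: assumes "aperm v" shows "gg v i j = gg v j i"
proof (cases "eqm i j")
  case True
  then obtain t where "i = j + t * N" by (rule eqm_E)
  then show ?thesis using ashift_shift[OF aperm_ashift[OF assms]] by (simp add: gg_def)
next
  case False
  then have "\<not> N dvd j - i" "\<not> N dvd v j - v i"
    using aperm_eqm_iff[OF assms, of i j] unfolding eqm_def by (simp_all add: dvd_diff_commute)
  from div_neg[OF this(1)] div_neg[OF this(2)] show ?thesis unfolding gg_def by simp
qed

text \<open>Only rows and columns of the classes of \<open>a\<close> and \<open>b\<close> change. By
  symmetry each change occurs once in a row and once in a column, hence the factors 2; entries
  between the two classes are taken out of the remaining sum so as not to be counted again.\<close>

lemma pair_change:
  fixes g g' :: "int \<Rightarrow> int \<Rightarrow> int"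
  assumes p: "\<And>i. periodic (g i)" "\<And>i. periodic (g' i)"
    and s: "\<And>i j. g i j = g j i" "\<And>i j. g' i j = g' j i"
    and z: "\<And>i. g i i = 0" "\<And>i. g' i i = 0"
    and e: "\<And>i j. \<not> eqm i a \<Longrightarrow> \<not> eqm i b \<Longrightarrow> \<not> eqm j a \<Longrightarrow> \<not> eqm j b \<Longrightarrow> g' i j = g i j"
    and ab: "\<not> eqm a b"
  shows "psum (\<lambda>i. psum (g' i)) - psum (\<lambda>i. psum (g i)) = 2 * g' a b - 2 * g a b
    + 2 * psum (\<lambda>c. if eqm c a \<or> eqm c b then 0 else g' a c - g a c + (g' b c - g b c))"
proof -
  define row where "row i = psum (g' i) - psum (g i)" for i
  define ee where "ee c = g' a c - g a c + (g' b c - g b c)" for c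
  define e0 where "e0 c = (if eqm c a \<or> eqm c b then 0 else ee c)" for c
  have q: "g (i + N) j = g i j" "g' (i + N) j = g' i j" for i j
    using p unfolding periodic_def by (metis s(1)) (metis p(2) periodic_def s(2))
  have pr: "periodic row" unfolding row_def periodic_def psum_def by (simp add: q)
  have pe: "periodic ee" using p unfolding ee_def periodic_def by simp
  have pe0: "periodic e0" using pe unfolding e0_def periodic_def by simp
  have r: "row c = ee c" if "\<not> eqm c a" "\<not> eqm c b" for c
    unfolding row_def ee_def using psum_change2[OF p(2) p(1) ab, of c c] e[OF that] s(1)[of c] s(2)[of c] by simp
  have "psum row - psum ee = (row a - ee a) + (row b - ee b)"
    by (rule psum_change2[OF pr pe ab]) (rule r)
  moreover have "psum ee = row a + row b"
    unfolding row_def ee_def by (simp only: psum_add psum_diff)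
  moreover have "psum ee - psum e0 = (ee a - e0 a) + (ee b - e0 b)"
    by (rule psum_change2[OF pe pe0 ab]) (simp add: e0_def)
  moreover have "ee a = g' a b - g a b" "ee b = g' a b - g a b" "e0 a = 0" "e0 b = 0"
    using s z by (auto simp: ee_def e0_def)
  moreover have "psum row = psum (\<lambda>i. psum (g' i)) - psum (\<lambda>i. psum (g i))"
    unfolding row_def by (rule psum_diff)
  ultimately have "psum (\<lambda>i. psum (g' i)) - psum (\<lambda>i. psum (g i)) = 2 * g' a b - 2 * g a b + 2 * psum e0"
    by simp
  then show ?thesis unfolding e0_def ee_def .
qed

lemma Lg_change:
  assumes "aperm v" "aperm w" "\<not> eqm a b" "\<And>c. \<not> eqm c a \<Longrightarrow> \<not> eqm c b \<Longrightarrow> w c = v c"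
  shows "Lg w - Lg v = 2 * gg w a b - 2 * gg v a b
    + 2 * psum (\<lambda>c. if eqm c a \<or> eqm c b then 0 else gg w a c - gg v a c + (gg w b c - gg v b c))"
  unfolding Lg_def
proof (rule pair_change)
  show "periodic (gg v i)" "periodic (gg w i)" for i
    using gg_shift(2)[OF aperm_ashift] assms(1,2) by (auto simp: periodic_def)
  show "gg v i j = gg v j i" "gg w i j = gg w j i" for i j using gg_sym assms by auto
  show "\<not> eqm i a \<Longrightarrow> \<not> eqm i b \<Longrightarrow> \<not> eqm j a \<Longrightarrow> \<not> eqm j b \<Longrightarrow> gg w i j = gg v i j" for i j
    using assms(4) by (simp add: gg_def)
qed (use assms(3) in auto)

text \<open>For the swapped pair the count goes from \<open>\<bar>X - Y\<bar>\<close> to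
  \<open>X + Y + 1\<close> with nonnegative \<open>X\<close> and \<open>Y\<close>. Against a third
  class the change is nonnegative by the rearrangement inequality for absolute differences, and it
  vanishes when \<open>a\<close> and \<open>b\<close> are neighbours, since nothing separates
  them.\<close>

lemma Lg_swap: assumes "aperm v" "\<not> eqm a b" "a < b" "v a < v b"
  shows "Lg v < Lg (v \<circ> tr a b)" "b = a + 1 \<Longrightarrow> Lg (v \<circ> tr a b) = Lg v + 2"
proof -
  let ?w = "v \<circ> tr a b"
  have w: "aperm ?w" using assms by (intro aperm_comp tr_aperm)
  have wv: "?w a = v b" "?w b = v a" "\<And>c. \<not> eqm c a \<Longrightarrow> \<not> eqm c b \<Longrightarrow> ?w c = v c"
    using assms(2) by (simp_all add: tr_vals)
  have L: "Lg ?w - Lg v = 2 * gg ?w a b - 2 * gg v a b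
    + 2 * psum (\<lambda>c. if eqm c a \<or> eqm c b then 0 else gg ?w a c - gg v a c + (gg ?w b c - gg v b c))"
    by (rule Lg_change[OF assms(1) w assms(2) wv(3)])
  have "\<not> N dvd v b - v a" using aperm_eqm_iff[OF assms(1), of b a] assms(2) eqm_sym unfolding eqm_def by blast
  from div_neg[OF this] have n: "(v a - v b) div N = - ((v b - v a) div N) - 1" by simp
  have X: "0 \<le> (v b - v a) div N" and Y: "0 \<le> (b - a) div N"
    using assms(3,4) N3 by (auto simp: pos_imp_zdiv_nonneg_iff)
  have D: "gg ?w a b = (v b - v a) div N + (b - a) div N + 1" using X Y n unfolding gg_def wv by simp
  have D2: "gg v a b = \<bar>(v b - v a) div N - (b - a) div N\<bar>" unfolding gg_def ..
  have e: "0 \<le> gg ?w a c - gg v a c + (gg ?w b c - gg v b c)" if "\<not> eqm c a" "\<not> eqm c b" for c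
  proof -
    have "(v c - v b) div N \<le> (v c - v a) div N" "(c - b) div N \<le> (c - a) div N"
      using assms N3 by (auto intro!: zdiv_mono1)
    then show ?thesis unfolding gg_def wv(1,2) wv(3)[OF that] by linarith
  qed
  have "0 \<le> psum (\<lambda>c. if eqm c a \<or> eqm c b then 0 else gg ?w a c - gg v a c + (gg ?w b c - gg v b c))"
    by (rule psum_nonneg) (use e in auto)
  then show "Lg v < Lg ?w" using L D D2 X Y by linarith
  assume b: "b = a + 1"
  have "(c - b) div N = (c - a) div N" if "\<not> eqm c a" for c
    using fl_step[of a c] that b unfolding fl_def by (simp add: algebra_simps)
  then have "gg ?w a c - gg v a c + (gg ?w b c - gg v b c) = 0" if "\<not> eqm c a" "\<not> eqm c b" for c
    using that wv unfolding gg_def by simp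
  then have z: "psum (\<lambda>c. if eqm c a \<or> eqm c b then 0 else gg ?w a c - gg v a c + (gg ?w b c - gg v b c)) = 0"
    unfolding psum_def by (intro sum.neutral) auto
  have "(b - a) div N = 0" using b N3 by simp
  then show "Lg ?w = Lg v + 2" using L D D2 X unfolding z by simp
qed

section \<open>Simple reflections, words and length\<close>

definition sw :: "(int \<Rightarrow> int) \<Rightarrow> int \<Rightarrow> int \<Rightarrow> int" where "sw v k = v \<circ> tr k (k + 1)"

lemma sw_aperm: "aperm v \<Longrightarrow> aperm (sw v k)" unfolding sw_def by (intro aperm_comp tr_aperm) auto
lemma sw_sw: "sw (sw v k) k = v" using tr_comp[of k "k+1"] by (simp add: sw_def comp_assoc)
lemma sw_vals: "sw v k k = v (k + 1)" "sw v k (k + 1) = v k" by (simp_all add: sw_def tr_vals)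
lemma Lg_sw: assumes "aperm v" shows "v k < v (k + 1) \<Longrightarrow> Lg (sw v k) = Lg v + 2"
  "\<not> v k < v (k + 1) \<Longrightarrow> Lg (sw v k) = Lg v - 2"
proof -
  show "v k < v (k + 1) \<Longrightarrow> Lg (sw v k) = Lg v + 2" unfolding sw_def by (rule Lg_swap(2)) (use assms in auto)
  assume "\<not> v k < v (k + 1)"
  moreover have "v k \<noteq> v (k + 1)" using aperm_inj[OF assms, of k "k+1"] by simp
  ultimately have lt: "sw v k k < sw v k (k + 1)" by (simp add: sw_vals)
  have "Lg (sw v k \<circ> tr k (k+1)) = Lg (sw v k) + 2"
    by (rule Lg_swap(2)) (use lt sw_aperm[OF assms] in auto)
  then show "Lg (sw v k) = Lg v - 2" using sw_sw[of v k] unfolding sw_def[of "sw v k"] by simp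
qed

lemma Lg_id: "Lg id = 0" unfolding Lg_def psum_def by (simp add: gg_def)
lemma Lg_nonneg: "0 \<le> Lg v" unfolding Lg_def by (intro psum_nonneg) (simp add: gg_def)

definition wp :: "nat list \<Rightarrow> int \<Rightarrow> int" where "wp is = foldl (\<lambda>v i. sw v (int i)) id is"

lemma wp_simps: "wp [] = id" "wp (is @ [i]) = sw (wp is) (int i)" by (simp_all add: wp_def)
lemma wp_aperm: "aperm (wp is)"
proof (induction "is" rule: rev_induct)
  case Nil show ?case unfolding wp_simps by (rule aperm_id)
qed (simp add: sw_aperm wp_simps)
lemma foldr_comp_append: "foldr (\<circ>) (xs @ ys) id = foldr (\<circ>) xs id \<circ> foldr (\<circ>) ys id"
  by (induction xs) (auto simp: comp_assoc)
lemma word_append: "word n (is @ [i]) = word n is \<circ> sref n i"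
  unfolding word_def by (simp add: foldr_comp_append del: foldr_append)
lemma act_sw: "aperm v \<Longrightarrow> k < n \<Longrightarrow> act v \<circ> sref n k = act (sw v (int k))"
  by (simp add: sref_act act_comp aperm_ashift sw_def)
lemma word_wp: "set is \<subseteq> {..<n} \<Longrightarrow> word n is = act (wp is)"
proof (induction "is" rule: rev_induct)
  case Nil show ?case unfolding wp_simps act_id by (simp add: word_def)
next
  case (snoc i xs) then show ?case by (simp add: word_append act_sw wp_aperm wp_simps)
qed
lemma Lg_wp: "Lg (wp is) \<le> 2 * int (length is)"
proof (induction "is" rule: rev_induct)
  case Nil show ?case unfolding wp_simps Lg_id by simp
next
  case (snoc i xs)
  then show ?case using Lg_sw[OF wp_aperm, of xs "int i"] by (cases "wp xs (int i) < wp xs (int i + 1)") (auto simp: wp_simps)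
qed

text \<open>Increasing at every step, \<open>v\<close> gains at least 1 each time, and periodicity
  leaves no slack, so \<open>v\<close> is a shift; the vanishing sum makes it the identity.\<close>

lemma no_descent: assumes "aperm v" "\<And>i. 0 \<le> i \<Longrightarrow> i < N \<Longrightarrow> v i < v (i + 1)" shows "v = id"
proof -
  have step: "v i < v (i + 1)" for i
  proof -
    have e: "i = i mod N + (i div N) * N" "i + 1 = (i mod N + 1) + (i div N) * N" by simp_all
    have "v i = v (i mod N) + (i div N) * N" "v (i + 1) = v (i mod N + 1) + (i div N) * N"
      using ashift_shift[OF aperm_ashift[OF assms(1)]] e by metis+
    then show ?thesis using assms(2)[of "i mod N"] N3 by simp
  qed
  have ge: "v i + (j - i) \<le> v j" if "i \<le> j" for i j
    using that
  proof (induction j rule: int_ge_induct)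
    case (step k) then show ?case using \<open>\<And>i. v i < v (i + 1)\<close>[of k] by simp
  qed simp
  have c: "v j - j = v 0 - 0" if "0 \<le> j" "j < N" for j
    using ge[of 0 j] ge[of j N] that aperm_ashift[OF assms(1)] unfolding ashift_def
    by (metis (no_types, opaque_lifting) add.commute add_0 diff_0_right diff_diff_eq2 eq_iff le_diff_eq less_imp_le diff_add_eq)
  have "psum (\<lambda>c. v c - c) = psum (\<lambda>c. v 0 - 0)" unfolding psum_def by (rule sum.cong) (use c in auto)
  then have v0: "v 0 = 0" using assms(1) N3 by (simp add: aperm_def psum_def)
  have h: "v x - x = v (x mod N) - x mod N" for x
    by (rule periodic_eqm[OF ashift_periodic[OF aperm_ashift[OF assms(1)]]]) simp
  have "v x = x" for x using h[of x] c[of "x mod N"] v0 N3 by simp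
  then show ?thesis by auto
qed

text \<open>Bubble sort: each swap at a descent lowers \<open>Lg\<close> by 2, and only the identity
  has no descents.\<close>

lemma reduced_exists: "aperm v \<Longrightarrow> \<exists>is. set is \<subseteq> {..<n} \<and> wp is = v \<and> 2 * int (length is) = Lg v"
proof (induction "nat (Lg v)" arbitrary: v rule: less_induct)
  case less
  show ?case
  proof (cases "\<forall>i. 0 \<le> i \<and> i < N \<longrightarrow> v i < v (i + 1)")
    case True
    then have "v = id" using no_descent less.prems by blast
    then show ?thesis using Lg_id by (intro exI[of _ "[]"]) (simp add: wp_simps)
  next
    case False
    then obtain i where i: "0 \<le> i" "i < N" "\<not> v i < v (i + 1)" by blast
    have L: "Lg (sw v i) = Lg v - 2" using Lg_sw(2)[OF less.prems i(3)] .
    then have "nat (Lg (sw v i)) < nat (Lg v)" using Lg_nonneg[of "sw v i"] by simp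
    from less.hyps[OF this sw_aperm[OF less.prems]] obtain xs
      where xs: "set xs \<subseteq> {..<n}" "wp xs = sw v i" "2 * int (length xs) = Lg (sw v i)" by blast
    show ?thesis
      using xs i L sw_sw[of v i] by (intro exI[of _ "xs @ [nat i]"]) (auto simp: wp_simps)
  qed
qed

lemma Waff_eq: "Waff n = {act v | v. aperm v}"
proof (intro equalityI subsetI)
  fix x assume "x \<in> Waff n"
  then show "x \<in> {act v | v. aperm v}" unfolding Waff_def using word_wp wp_aperm by blast
next
  fix x assume "x \<in> {act v | v. aperm v}"
  then obtain v where "x = act v" "aperm v" by blast
  then show "x \<in> Waff n" using reduced_exists[of v] word_wp unfolding Waff_def by force
qed

lemma len_act: assumes "aperm v" shows "2 * int (len n (act v)) = Lg v"
proof -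
  obtain "is" where i: "set is \<subseteq> {..<n}" "wp is = v" "2 * int (length is) = Lg v"
    using reduced_exists[OF assms] by blast
  have "len n (act v) = length is" unfolding len_def
  proof (rule Least_equality)
    show "\<exists>js. set js \<subseteq> {..<n} \<and> word n js = act v \<and> length js = length is"
      using i word_wp by blast
  next
    fix k assume "\<exists>js. set js \<subseteq> {..<n} \<and> word n js = act v \<and> length js = k"
    then obtain js where js: "set js \<subseteq> {..<n}" "word n js = act v" "length js = k" by blast
    then have "wp js = v" using act_inj[OF wp_aperm assms] word_wp by auto
    then show "length is \<le> k" using Lg_wp[of js] js i by simp
  qed
  then show ?thesis using i by simp
qed

lemma len_less: "aperm v \<Longrightarrow> aperm w \<Longrightarrow> len n (act v) < len n (act w) \<longleftrightarrow> Lg v < Lg w"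
  using len_act[of v] len_act[of w] by linarith

section \<open>Bruhat steps as transpositions of ascending pairs\<close>

lemma bruhat_stepI: assumes "aperm v" "\<not> eqm i j" "i < j" "v i < v j"
  shows "bruhat_step n (act v) (act (v \<circ> tr i j))"
proof -
  have "root i j \<in> pos_real_roots n" unfolding pos_real_roots_eq using assms by blast
  moreover have "act (v \<circ> tr i j) = act v \<circ> refl n (root i j)"
    using assms by (simp add: refl_root act_comp aperm_ashift)
  moreover have "len n (act v) < len n (act (v \<circ> tr i j))"
    using len_less[OF assms(1) aperm_comp[OF assms(1) tr_aperm[OF assms(2)]]] Lg_swap(1)[OF assms] by simp
  ultimately show ?thesis unfolding bruhat_step_def Waff_eq using assms(1) by blast
qed

lemma bruhat_stepE: assumes "bruhat_step n w w'" "aperm v" "w = act v"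
  obtains i j where "i < j" "\<not> eqm i j" "v i < v j" "w' = act (v \<circ> tr i j)"
proof -
  obtain a where a: "a \<in> pos_real_roots n" "w' = w \<circ> refl n a" "len n w < len n w'"
    using assms(1) unfolding bruhat_step_def by blast
  then obtain i j where ij: "a = root i j" "i < j" "\<not> eqm i j" unfolding pos_real_roots_eq by blast
  have w': "w' = act (v \<circ> tr i j)"
    using a ij assms by (simp add: refl_root act_comp aperm_ashift)
  have ap: "aperm (v \<circ> tr i j)" using assms ij by (intro aperm_comp tr_aperm)
  have "Lg v < Lg (v \<circ> tr i j)" using len_less[OF assms(2) ap] a w' assms(3) by simp
  moreover have "Lg (v \<circ> tr i j) < Lg v" if "\<not> v i < v j"
  proof -
    have "v i \<noteq> v j" using aperm_inj[OF assms(2)] ij by simp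
    then have "(v \<circ> tr i j) i < (v \<circ> tr i j) j" using that ij by (simp add: tr_vals)
    from Lg_swap(1)[OF ap ij(3,2) this] show ?thesis by (simp only: comp_assoc tr_comp[OF ij(3)] comp_id)
  qed
  ultimately show ?thesis using that ij w' by fastforce
qed

lemma bruhat_step_aperm: assumes "bruhat_step n (act v) w'" "aperm v"
  obtains v' where "aperm v'" "w' = act v'" "Lg v < Lg v'" "\<And>k. rk v k k \<le> rk v' k k"
proof -
  obtain i j where ij: "i < j" "\<not> eqm i j" "v i < v j" "w' = act (v \<circ> tr i j)"
    using bruhat_stepE[OF assms refl] by blast
  show ?thesis
    by (rule that[of "v \<circ> tr i j"])
      (use ij assms(2) in \<open>auto intro!: aperm_comp tr_aperm Lg_swap(1) rk_swap_mono aperm_ashift\<close>)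
qed

lemma bruhat_le_aperm: assumes "bruhat_le n (act v) w'" "aperm v"
  shows "\<exists>v'. aperm v' \<and> w' = act v' \<and> (v' = v \<or> Lg v < Lg v') \<and> (\<forall>k. rk v k k \<le> rk v' k k)"
  using assms(1) unfolding bruhat_le_def
proof (induction rule: rtranclp_induct)
  case base then show ?case using assms(2) by blast
next
  case (step y z)
  then obtain v1 where v1: "aperm v1" "y = act v1" "v1 = v \<or> Lg v < Lg v1" "\<And>k. rk v k k \<le> rk v1 k k" by blast
  obtain v2 where v2: "aperm v2" "z = act v2" "Lg v1 < Lg v2" "\<And>k. rk v1 k k \<le> rk v2 k k"
    using bruhat_step_aperm[of v1 z] step.hyps(2) v1 by metis
  have "v2 = v \<or> Lg v < Lg v2" using v1(3) v2(3) by auto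
  moreover have "rk v k k \<le> rk v2 k k" for k using v1(4)[of k] v2(4)[of k] by linarith
  ultimately show ?case using v2 by blast
qed

text \<open>Bruhat steps raise the length, so none can arrive at length zero. Hence all chains that
  count for \<open>reachable n d id\<close> start at the identity.\<close>

lemma bruhat_le_id: assumes "bruhat_le n u id" "u \<in> Waff n" shows "u = id"
proof -
  obtain v where v: "aperm v" "u = act v" using assms(2) unfolding Waff_eq by blast
  then obtain v' where v': "aperm v'" "id = act v'" "v' = v \<or> Lg v < Lg v'"
    using bruhat_le_aperm assms(1) by blast
  have "v' = id" using act_inj[OF v'(1) aperm_id] v'(2) act_id by simp
  then have "v = id" using v'(3) Lg_nonneg[of v] Lg_id by auto
  then show ?thesis using v act_id by simp
qed

subsection \<open>Reachability in the moment graph\<close>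

lemma id_Waff: "id \<in> Waff n"
  unfolding Waff_eq by (intro CollectI exI[of _ id] conjI act_id[symmetric] aperm_id)

definition Nv :: "(int \<Rightarrow> int) \<Rightarrow> lat" where
  "Nv v = (\<lambda>k. if k < n then rk v (int k) (int k) else 0)"

lemma Nv_id: "Nv id = 0" by (auto simp: Nv_def rk_id fun_eq_iff)

text \<open>As displacements sum to zero, some position moves up and some position moves down. For
  such a pair at least distance everything between is fixed, so by injectivity neither end can land
  between them. Undoing the reflection at this pair lowers each diagonal rank by the full
  coefficient of \<open>root i j\<close>.\<close>

lemma excedance_pair: assumes "aperm v" "v \<noteq> id"
  obtains i j where "i < j" "\<not> eqm i j" "j \<le> v i" "v j \<le> i"
proof -
  have nofix: "\<not> ((\<forall>c. v c \<le> c) \<or> (\<forall>c. c \<le> v c))"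
  proof
    assume a: "(\<forall>c. v c \<le> c) \<or> (\<forall>c. c \<le> v c)"
    have z: "(\<Sum>c\<in>{0..<N}. v c - c) = 0" using assms(1) by (simp add: aperm_def psum_def)
    have z': "(\<Sum>c\<in>{0..<N}. c - v c) = 0" using z by (simp add: sum_subtractf)
    have c: "v c = c" if "0 \<le> c" "c < N" for c
      using a
    proof
      assume "\<forall>c. v c \<le> c"
      then show ?thesis using sum_nonneg_eq_0_iff[of "{0..<N}" "\<lambda>c. c - v c"] z' that by auto
    next
      assume "\<forall>c. c \<le> v c"
      then show ?thesis using sum_nonneg_eq_0_iff[of "{0..<N}" "\<lambda>c. v c - c"] z that by auto
    qed
    have "v x - x = v (x mod N) - x mod N" for x
      by (rule periodic_eqm[OF ashift_periodic[OF aperm_ashift[OF assms(1)]]]) simp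
    moreover have "v (x mod N) = x mod N" for x using c[of "x mod N"] N3 by simp
    ultimately show False using assms(2) by (auto simp: fun_eq_iff)
  qed
  then obtain a b0 where a: "a < v a" and b0: "v b0 < b0" by (meson not_le)
  obtain t where "a \<le> b0 + t * N" by (rule eqm_rep)
  moreover have "v (b0 + t * N) < b0 + t * N" using b0 ashift_shift[OF aperm_ashift[OF assms(1)]] by simp
  ultimately have ex: "\<exists>k a b. b = a + int k \<and> a < v a \<and> v b < b"
    using a by (metis zle_iff_zadd)
  define k where "k = (LEAST k. \<exists>a b. b = a + int k \<and> a < v a \<and> v b < b)"
  obtain a b where ab: "b = a + int k" "a < v a" "v b < b"
    using LeastI_ex[OF ex] unfolding k_def by blast
  have min: "int k \<le> d - c" if "c < d" "c < v c" "v d < d" for c d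
  proof -
    have "k \<le> nat (d - c)" unfolding k_def by (rule Least_le, rule exI[of _ c], rule exI[of _ d]) (use that in simp)
    then show ?thesis using that by simp
  qed
  have lt: "a < b" using ab by (cases "k = 0") auto
  have fx: "v x = x" if "a < x" "x < b" for x
    using min[of x b] min[of a x] that ab by force
  have 1: "b \<le> v a"
  proof (rule ccontr)
    assume "\<not> b \<le> v a"
    then have "v (v a) = v a" using fx[of "v a"] ab by simp
    then show False using aperm_inj[OF assms(1)] ab by auto
  qed
  have 2: "v b \<le> a"
  proof (rule ccontr)
    assume "\<not> v b \<le> a"
    then have "v (v b) = v b" using fx[of "v b"] ab by simp
    then show False using aperm_inj[OF assms(1)] ab by auto
  qed
  have "\<not> eqm a b"
  proof
    assume "eqm a b"
    then obtain t where "a = b + t * N" by (rule eqm_E)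
    then show False using ab(2,3) ashift_shift[OF aperm_ashift[OF assms(1)]] by simp
  qed
  then show ?thesis using that lt 1 2 by blast
qed

lemma root_pos: "a < b \<Longrightarrow> 0 \<le> root a b k" by (simp add: root_def fl_mono)

text \<open>Induction on the height of \<open>Nv v\<close>: the reflection from
  \<open>excedance_pair\<close> spends exactly its degree. By \<open>chain_Nv\<close> no chain from
  the identity gets by with less.\<close>

lemma Nv_chain: "aperm v \<Longrightarrow> chain n id (act v) (Nv v)"
proof (induction "nat (\<Sum>k<n. Nv v k)" arbitrary: v rule: less_induct)
  case less
  show ?case
  proof (cases "v = id")
    case True
    show ?thesis using chain.empty[OF id_Waff] unfolding True Nv_id act_id .
  next
    case False
    then obtain i j where ij: "i < j" "\<not> eqm i j" "j \<le> v i" "v j \<le> i"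
      using excedance_pair less.prems by blast
    let ?w = "v \<circ> tr i j"
    have w: "aperm ?w" using less.prems ij by (intro aperm_comp tr_aperm)
    have ww: "?w \<circ> tr i j = v" unfolding comp_assoc tr_comp[OF ij(2)] by simp
    have wi: "?w i = v j" "?w j = v i" using ij by (simp_all add: tr_vals)
    have "rk v k k = rk ?w k k + (fl k j - fl k i)" for k
    proof -
      have "rk (?w \<circ> tr i j) k k = rk ?w k k + max 0 (fl k (min j (?w j)) - fl k (max i (?w i)))"
        by (rule rk_swap_diag[OF aperm_ashift[OF w] ij(2,1)]) (use ij wi in auto)
      then show ?thesis unfolding ww wi using ij fl_mono[of i j k] by (simp add: min_def max_def)
    qed
    then have N: "Nv v = Nv ?w + root i j" by (auto simp: Nv_def root_def fun_eq_iff)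
    have "(\<Sum>k<n. Nv v k) = (\<Sum>k<n. Nv ?w k) + (j - i)"
      unfolding N by (simp add: sum.distrib root_height)
    moreover have "0 \<le> (\<Sum>k<n. Nv ?w k)" by (intro sum_nonneg) (simp add: Nv_def rk_nonneg)
    ultimately have "nat (\<Sum>k<n. Nv ?w k) < nat (\<Sum>k<n. Nv v k)" using ij(1) by simp
    from less.hyps[OF this w] have c: "chain n id (act ?w) (Nv ?w)" .
    have "root i j \<in> pos_real_roots n" unfolding pos_real_roots_eq using ij by blast
    from chain.edge[OF c this] have "chain n id (act ?w \<circ> refl n (root i j)) (Nv v)" unfolding N .
    moreover have "act ?w \<circ> refl n (root i j) = act v"
      unfolding refl_root[OF ij(2)] act_comp[OF aperm_ashift[OF w]] ww ..
    ultimately show ?thesis by simp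
  qed
qed

lemma chain_Nv: "chain n u w e \<Longrightarrow> u = id \<Longrightarrow> \<exists>v. aperm v \<and> w = act v \<and> Nv v \<le> e"
proof (induction rule: chain.induct)
  case (empty u)
  show ?case unfolding empty.prems
    by (intro exI[of _ id] conjI act_id[symmetric] aperm_id) (simp only: Nv_id order_refl)
next
  case (edge u w e a)
  then obtain v where v: "aperm v" "w = act v" "Nv v \<le> e" by blast
  obtain i j where ij: "a = root i j" "i < j" "\<not> eqm i j" using edge.hyps(2) unfolding pos_real_roots_eq by blast
  have "Nv (v \<circ> tr i j) k \<le> (e + a) k" for k
  proof -
    have "bij v" using v by (simp add: aperm_def)
    then show ?thesis
      using rk_swap_bound[OF aperm_ashift[OF v(1)] _ ij(3,2), of "int k"] v(3)[unfolded le_fun_def, rule_format, of k]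
      unfolding ij(1) Nv_def root_def by auto
  qed
  then have "Nv (v \<circ> tr i j) \<le> e + a" by (simp add: le_fun_def)
  moreover have "w \<circ> refl n a = act (v \<circ> tr i j)" using v ij by (simp add: refl_root act_comp aperm_ashift)
  moreover have "aperm (v \<circ> tr i j)" using v ij by (intro aperm_comp tr_aperm)
  ultimately show ?case by blast
qed

lemma reachable_eq: "reachable n d id = {act v | v. aperm v \<and> Nv v \<le> d}"
proof (intro equalityI subsetI)
  fix x assume "x \<in> reachable n d id"
  then obtain u' e where u: "u' \<in> Waff n" "bruhat_le n u' id" "chain n u' x e" "e \<le> d"
    unfolding reachable_def by blast
  have "u' = id" using bruhat_le_id u by blast
  then obtain v where "aperm v" "x = act v" "Nv v \<le> e" using chain_Nv[OF u(3)] by blast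
  then show "x \<in> {act v | v. aperm v \<and> Nv v \<le> d}" using u(4) order_trans by blast
next
  fix x assume "x \<in> {act v | v. aperm v \<and> Nv v \<le> d}"
  then obtain v where v: "x = act v" "aperm v" "Nv v \<le> d" by blast
  have "x \<in> Waff n" unfolding Waff_eq using v by blast
  moreover note id_Waff
  moreover have "bruhat_le n id id" by (simp add: bruhat_le_def)
  ultimately show "x \<in> reachable n d id" unfolding reachable_def using v Nv_chain[OF v(2)] by blast
qed

lemma disp_bound: assumes "aperm v" "\<And>k. rk v k k \<le> D" shows "\<bar>v a - a\<bar> \<le> D * N"
proof -
  have one: "w a - a \<le> D * N" if w: "aperm w" "\<And>k. rk w k k \<le> D" for w a
  proof -
    have "max 0 (fl a (w a) - fl a a) \<le> rk w a a"
      unfolding rk_def by (rule psum_ge[OF rk_periodic[OF aperm_ashift[OF w(1)]]]) simp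
    then have "fl a (w a) < D" using w(2)[of a] by (simp add: fl_self)
    then show ?thesis using fl_less_iff[of a "w a" D] by simp
  qed
  have "inv v (v a) - v a \<le> D * N"
    by (rule one[OF aperm_inv[OF assms(1)]]) (simp add: rk_diag_inv assms)
  then show ?thesis using one[OF assms(1,2), of a] by (simp add: aperm_inv_f assms(1))
qed

text \<open>Bounded ranks bound the displacements by \<open>D * N\<close>, hence each term of Shi's
  formula. This lets the climb in \<open>curve_nbhd_eq\<close> terminate.\<close>

lemma Lg_bound: assumes "0 \<le> D" shows "\<exists>B. \<forall>v. aperm v \<longrightarrow> (\<forall>k. rk v k k \<le> D) \<longrightarrow> Lg v \<le> B"
proof (intro exI allI impI)
  fix v assume v: "aperm v" "\<forall>k. rk v k k \<le> D"
  have "gg v i j \<le> 2 * D + 1" for i j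
  proof -
    have "\<bar>v i - i\<bar> \<le> D * N" "\<bar>v j - j\<bar> \<le> D * N" using disp_bound[OF v(1)] v(2) by auto
    moreover have "2 * D * N = D * N + D * N" by simp
    ultimately have "v j - v i \<le> (j - i) + 2 * D * N" "(j - i) + (- 2 * D) * N \<le> v j - v i"
      by (simp_all add: abs_le_iff)
    then have "(v j - v i) div N \<le> (j - i + 2 * D * N) div N" "(j - i + (- 2 * D) * N) div N \<le> (v j - v i) div N"
      by - (rule zdiv_mono1, assumption, use N3 in simp)+
    moreover have "(j - i + 2 * D * N) div N = (j - i) div N + 2 * D"
      "(j - i + (- 2 * D) * N) div N = (j - i) div N + (- 2 * D)"
      using N3 div_mult_self1[of N "j - i" "2 * D"] div_mult_self1[of N "j - i" "- 2 * D"] by (auto simp: add.commute)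
    ultimately show ?thesis unfolding gg_def by linarith
  qed
  then have "Lg v \<le> psum (\<lambda>i. psum (\<lambda>j. 2 * D + 1))" unfolding Lg_def by (intro psum_mono)
  then show "Lg v \<le> psum (\<lambda>i. psum (\<lambda>j. 2 * D + 1))" .
qed

text \<open>From here on a degree is extended to a periodic function \<open>dd\<close> on the integers.\<close>

definition below :: "(int \<Rightarrow> int) \<Rightarrow> (int \<Rightarrow> int) \<Rightarrow> bool" where
  "below dd v \<longleftrightarrow> aperm v \<and> (\<forall>k. rk v k k \<le> dd k)"

definition lmax :: "(int \<Rightarrow> int) \<Rightarrow> (int \<Rightarrow> int) \<Rightarrow> bool" where
  "lmax dd v \<longleftrightarrow> below dd v \<and>
    (\<forall>i j. i < j \<longrightarrow> \<not> eqm i j \<longrightarrow> v i < v j \<longrightarrow> \<not> below dd (v \<circ> tr i j))"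

definition pext :: "lat \<Rightarrow> int \<Rightarrow> int" where "pext d x = d (nat (x mod N))"

lemma pext_periodic: "periodic (pext d)" by (simp add: periodic_def pext_def)
lemma pext_nat: "k < n \<Longrightarrow> pext d (int k) = d k" by (simp add: pext_def)

lemma rk_diag_periodic: "periodic (\<lambda>k. rk v k k)" unfolding periodic_def using rk_shift by blast

lemma below_iff: assumes "is_degree n d" shows "below (pext d) v \<longleftrightarrow> aperm v \<and> Nv v \<le> d"
proof -
  have "(\<forall>k. rk v k k \<le> pext d k) \<longleftrightarrow> (\<forall>k<n. rk v (int k) (int k) \<le> d k)"
  proof (intro iffI allI impI)
    fix k assume "\<forall>k. rk v k k \<le> pext d k" "k < n"
    then show "rk v (int k) (int k) \<le> d k" using pext_nat by metis
  next
    fix x assume a: "\<forall>k<n. rk v (int k) (int k) \<le> d k"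
    define k where "k = nat (x mod N)"
    have k: "int k = x mod N" "k < n" using N3 by (auto simp: k_def nat_less_iff)
    have "rk v x x = rk v (x mod N) (x mod N)" by (rule periodic_eqm[OF rk_diag_periodic]) simp
    then show "rk v x x \<le> pext d x" using a k unfolding pext_def k_def[symmetric] by auto
  qed
  then show ?thesis using assms unfolding below_def Nv_def le_fun_def is_degree_def by auto
qed

text \<open>Every element below the degree climbs, one reflection at a time, into \<open>C\<close>.
  As \<open>C\<close> lies in a single length, nothing reachable can be strictly above a member of
  \<open>C\<close>: it would climb on to a member of greater length.\<close>

lemma curve_nbhd_eq:
  assumes d: "is_degree n d" and C: "\<And>v. v \<in> C \<Longrightarrow> below (pext d) v"
    and L: "\<And>v. v \<in> C \<Longrightarrow> Lg v = K" and lm: "\<And>v. lmax (pext d) v \<Longrightarrow> v \<in> C"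
  shows "curve_nbhd n d id = act ` C"
proof -
  have re: "reachable n d id = {act v | v. below (pext d) v}"
    unfolding reachable_eq below_iff[OF d] ..
  obtain D where D: "\<And>k. pext d k \<le> D" "0 \<le> D"
  proof
    fix k
    have "nat (k mod N) < n" using N3 by (simp add: nat_less_iff)
    then show "pext d k \<le> (\<Sum>i<n. d i)" unfolding pext_def
      using d by (intro member_le_sum) (auto simp: is_degree_def)
    show "0 \<le> (\<Sum>i<n. d i)" using d by (intro sum_nonneg) (auto simp: is_degree_def)
  qed
  obtain B where B: "\<And>v. below (pext d) v \<Longrightarrow> Lg v \<le> B"
    using Lg_bound[OF D(2)] D(1) unfolding below_def by (meson order_trans)
  have up: "\<exists>w\<in>C. bruhat_le n (act v) (act w)" if "below (pext d) v" for v
    using that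
  proof (induction "nat (B - Lg v)" arbitrary: v rule: less_induct)
    case less
    show ?case
    proof (cases "lmax (pext d) v")
      case True then show ?thesis using lm by (auto simp: bruhat_le_def)
    next
      case False
      then obtain i j where ij: "i < j" "\<not> eqm i j" "v i < v j" "below (pext d) (v \<circ> tr i j)"
        using less.prems unfolding lmax_def by blast
      have av: "aperm v" using less.prems by (simp add: below_def)
      have "Lg v < Lg (v \<circ> tr i j)" using Lg_swap(1) av ij by blast
      then have "nat (B - Lg (v \<circ> tr i j)) < nat (B - Lg v)" using B[OF ij(4)] by simp
      from less.hyps[OF this ij(4)] obtain w where w: "w \<in> C" "bruhat_le n (act (v \<circ> tr i j)) (act w)" by blast
      have "bruhat_step n (act v) (act (v \<circ> tr i j))" using bruhat_stepI av ij by blast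
      then show ?thesis using w unfolding bruhat_le_def by (meson converse_rtranclp_into_rtranclp)
    qed
  qed
  show ?thesis
  proof (intro equalityI subsetI)
    fix x assume x: "x \<in> curve_nbhd n d id"
    then obtain v where v: "x = act v" "below (pext d) v" unfolding curve_nbhd_def re by blast
    then obtain w where w: "w \<in> C" "bruhat_le n (act v) (act w)" using up by blast
    moreover have "act w \<in> {act v | v. below (pext d) v}" using C[OF w(1)] by blast
    ultimately have "act w = x" using x v(1) unfolding curve_nbhd_def re by auto
    then show "x \<in> act ` C" using w by blast
  next
    fix x assume "x \<in> act ` C"
    then obtain v where v: "v \<in> C" "x = act v" by blast
    have av: "aperm v" using C[OF v(1)] by (simp add: below_def)
    have "act v' = act v" if v': "below (pext d) v'" "bruhat_le n (act v) (act v')" for v'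
    proof -
      have av': "aperm v'" using v' by (simp add: below_def)
      obtain v1 where v1: "aperm v1" "act v' = act v1" "v1 = v \<or> Lg v < Lg v1"
        using bruhat_le_aperm[OF v'(2) av] by blast
      have [simp]: "v1 = v'" using act_inj[OF v1(1) av'] v1(2) by simp
      obtain w where w: "w \<in> C" "bruhat_le n (act v') (act w)" using up[OF v'(1)] by blast
      have aw: "aperm w" using C[OF w(1)] by (simp add: below_def)
      obtain w1 where w1: "aperm w1" "act w = act w1" "w1 = v' \<or> Lg v' < Lg w1"
        using bruhat_le_aperm[OF w(2) av'] by blast
      have [simp]: "w1 = w" using act_inj[OF w1(1) aw] w1(2) by simp
      show ?thesis using v1(3) w1(3) L[OF v(1)] L[OF w(1)] by auto
    qed
    then show "x \<in> curve_nbhd n d id" using C[OF v(1)] v(2) unfolding curve_nbhd_def re by blast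
  qed
qed

subsection \<open>Hecke products and \<open>z\<^sub>d\<close>\<close>

definition hs :: "(int \<Rightarrow> int) \<Rightarrow> int \<Rightarrow> int \<Rightarrow> int" where
  "hs u k = (if u k < u (k + 1) then sw u k else u)"

lemma hs_aperm: "aperm u \<Longrightarrow> aperm (hs u k)" by (simp add: hs_def sw_aperm)

lemma hecke_simple_act: assumes "aperm u" "k < n"
  shows "hecke_simple n (act u) k = act (hs u (int k))"
proof -
  have "len n (act u \<circ> sref n k) > len n (act u) \<longleftrightarrow> u (int k) < u (int k + 1)"
    unfolding act_sw[OF assms] len_less[OF assms(1) sw_aperm[OF assms(1)]]
    using Lg_sw[OF assms(1), of "int k"] by linarith
  then show ?thesis unfolding hecke_simple_def hs_def by (simp add: act_sw[OF assms])
qed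

text \<open>The larger of \<open>u k\<close> and \<open>u (k + 1)\<close> ends up at place
  \<open>k\<close>, so row \<open>k\<close> gains one over row \<open>k - 1\<close> as soon as
  either value exceeds \<open>l\<close>. Rows outside the class of \<open>k\<close> see only the
  unordered pair.\<close>

lemma rk_hs: assumes "aperm u"
  shows "rk (hs u k) i l = (if eqm i k then min (rk u (i - 1) l + 1) (rk u (i + 1) l) else rk u i l)"
proof -
  have as: "ashift u" "ashift (hs u k)" using assms hs_aperm aperm_ashift by blast+
  have far: "rk (hs u k) i l = rk u i l" if "\<not> eqm i k" for i
  proof -
    have "fl i (k + 1) = fl i k" using that by (simp add: fl_step eqm_sym)
    then have "rk (sw u k) i l = rk u i l" using rk_swap[OF as(1), of k "k+1" i l] unfolding sw_def by simp
    then show ?thesis unfolding hs_def by simp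
  qed
  show ?thesis
  proof (cases "eqm i k")
    case True
    then obtain t where t: "i = k + t * N" by (rule eqm_E)
    have "hs u k k = max (u k) (u (k + 1))" unfolding hs_def using sw_vals[of u k] by simp
    moreover have "k + t * N + 1 = (k + 1) + t * N" by simp
    ultimately have m: "hs u k i = max (u i) (u (i + 1))"
      unfolding t using ashift_shift[OF as(1)] ashift_shift[OF as(2)] by (metis max_add_distrib_left)
    have "\<not> eqm (i - 1) k" using True not_eqm_succ(4)[of i] eqm_sym eqm_trans by blast
    then have "rk (hs u k) (i - 1) l = rk u (i - 1) l" by (rule far)
    then have "rk (hs u k) i l = rk u (i - 1) l + (if l < max (u i) (u (i + 1)) then 1 else 0)"
      using rk_step[OF as(2), of "i - 1" l] m by simp
    moreover have "rk u (i + 1) l = rk u (i - 1) l + (if l < u i then 1 else 0) + (if l < u (i + 1) then 1 else 0)"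
      using rk_step[OF as(1), of "i - 1" l] rk_step[OF as(1), of i l] by simp
    ultimately show ?thesis using True by auto
  qed (use far in simp)
qed

text \<open>The rank function of a Hecke product is the min-plus matrix product of the rank functions.\<close>

definition mp :: "(int \<Rightarrow> int) \<Rightarrow> (int \<Rightarrow> int) \<Rightarrow> (int \<Rightarrow> int) \<Rightarrow> bool" where
  "mp u v w \<longleftrightarrow> (\<forall>i j l. rk w i j \<le> rk u l j + rk v i l) \<and> (\<forall>i j. \<exists>l. rk w i j = rk u l j + rk v i l)"

lemma mp_id: assumes "aperm u" shows "mp u id u"
  unfolding mp_def
proof (intro conjI allI)
  fix i j l
  show "rk u i j \<le> rk u l j + rk id i l" using rk_upper[OF assms, of i j l j] by (simp only: rk_id)
next
  fix i j
  show "\<exists>l. rk u i j = rk u l j + rk id i l" by (intro exI[of _ i]) (simp only: rk_id)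
qed

text \<open>By \<open>rk_hs\<close> both rank functions are rewritten in the argument
  \<open>i\<close> by the same minimum of two shifted rows, and a min-plus product distributes over
  it; the left factor is untouched.\<close>

lemma mp_hs: assumes "mp u v w" "aperm v" "aperm w" shows "mp u (hs v k) (hs w k)"
proof -
  have le: "rk (hs w k) i j \<le> rk u l j + rk (hs v k) i l" for i j l
    using assms(1)[unfolded mp_def, THEN conjunct1, rule_format, of i j l]
      assms(1)[unfolded mp_def, THEN conjunct1, rule_format, of "i - 1" j l]
      assms(1)[unfolded mp_def, THEN conjunct1, rule_format, of "i + 1" j l]
    unfolding rk_hs[OF assms(2)] rk_hs[OF assms(3)] by auto
  have at: "\<exists>l. rk w i j = rk u l j + rk v i l" for i j using assms(1) unfolding mp_def by blast
  have "\<exists>l. rk (hs w k) i j = rk u l j + rk (hs v k) i l" for i j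
  proof (cases "eqm i k")
    case False
    then show ?thesis unfolding rk_hs[OF assms(2)] rk_hs[OF assms(3)] using at by simp
  next
    case True
    obtain l1 where l1: "rk w (i - 1) j = rk u l1 j + rk v (i - 1) l1" using at by blast
    obtain l2 where l2: "rk w (i + 1) j = rk u l2 j + rk v (i + 1) l2" using at by blast
    show ?thesis
    proof (cases "rk w (i - 1) j + 1 \<le> rk w (i + 1) j")
      case c: True
      then show ?thesis using l1 le[of i j l1] True
        unfolding rk_hs[OF assms(2)] rk_hs[OF assms(3)] by (intro exI[of _ l1]) auto
    next
      case c: False
      then show ?thesis using l2 le[of i j l2] True
        unfolding rk_hs[OF assms(2)] rk_hs[OF assms(3)] by (intro exI[of _ l2]) auto
    qed
  qed
  then show ?thesis unfolding mp_def using le by blast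
qed

definition hsl :: "(int \<Rightarrow> int) \<Rightarrow> nat list \<Rightarrow> int \<Rightarrow> int" where
  "hsl u is = foldl (\<lambda>v i. hs v (int i)) u is"

lemma hsl_simps: "hsl u [] = u" "hsl u (is @ [i]) = hs (hsl u is) (int i)" by (simp_all add: hsl_def)

lemma hsl_aperm: "aperm u \<Longrightarrow> aperm (hsl u is)"
  by (induction "is" rule: rev_induct) (simp_all add: hsl_simps hs_aperm)

lemma foldl_hecke: "aperm u \<Longrightarrow> set is \<subseteq> {..<n} \<Longrightarrow> foldl (hecke_simple n) (act u) is = act (hsl u is)"
  by (induction "is" rule: rev_induct) (simp_all add: hsl_simps hecke_simple_act hsl_aperm)

text \<open>Along a reduced word every step must be an ascent, so the Hecke product never
  idles.\<close>

lemma hsl_reduced: "Lg (wp is) = 2 * int (length is) \<Longrightarrow> hsl id is = wp is"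
proof (induction "is" rule: rev_induct)
  case Nil show ?case unfolding hsl_simps wp_simps ..
next
  case (snoc i xs)
  have L: "Lg (sw (wp xs) (int i)) = 2 * int (length xs) + 2" using snoc.prems by (simp add: wp_simps)
  have a: "wp xs (int i) < wp xs (int i + 1)"
    using Lg_sw(2)[OF wp_aperm, of xs "int i"] Lg_wp[of xs] L by linarith
  then have "Lg (wp xs) = 2 * int (length xs)" using Lg_sw(1)[OF wp_aperm, of xs "int i"] L by linarith
  from snoc.IH[OF this] show ?case using a by (simp add: hsl_simps wp_simps hs_def)
qed

lemma hsl_mp: assumes "aperm u" shows "mp u (hsl id is) (hsl u is)"
proof (induction "is" rule: rev_induct)
  case Nil show ?case unfolding hsl_simps by (rule mp_id[OF assms])
next
  case (snoc i xs)
  show ?case unfolding hsl_simps by (rule mp_hs[OF snoc.IH]) (intro hsl_aperm aperm_id assms)+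
qed

lemma hecke_act: assumes "aperm u" "aperm v"
  shows "\<exists>w. aperm w \<and> hecke n (act u) (act v) = act w \<and> mp u v w"
proof -
  define xs where "xs = (SOME is. reduced_word n (act v) is)"
  obtain ys where ys: "set ys \<subseteq> {..<n}" "wp ys = v" "2 * int (length ys) = Lg v"
    using reduced_exists[OF assms(2)] by blast
  have "reduced_word n (act v) ys" unfolding reduced_word_def
    using ys word_wp[OF ys(1)] len_act[OF assms(2)] by auto
  then have xs: "reduced_word n (act v) xs" unfolding xs_def by (rule someI)
  then have "act (wp xs) = act v" using word_wp unfolding reduced_word_def by auto
  then have wx: "wp xs = v" using act_inj wp_aperm assms(2) by blast
  moreover have "Lg v = 2 * int (length xs)" using xs len_act[OF assms(2)] unfolding reduced_word_def by simp
  ultimately have "hsl id xs = v" using hsl_reduced[of xs] by simp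
  then have "mp u v (hsl u xs)" using hsl_mp[OF assms(1), of xs] by simp
  moreover have "hecke n (act u) (act v) = act (hsl u xs)"
    unfolding hecke_def xs_def[symmetric] using foldl_hecke[OF assms(1)] xs unfolding reduced_word_def by blast
  ultimately show ?thesis using hsl_aperm[OF assms(1)] by blast
qed

text \<open>The rank function \<open>\<lambda>i j. Min\<^sub>k (dd k + (i - k)\<^sup>+ + (k - j)\<^sup>+)\<close> is an upper bound for the rank
  function of every element below \<open>dd\<close>; \<open>zinv dd v\<close> says that \<open>v\<close> attains it.\<close>

definition zinv :: "(int \<Rightarrow> int) \<Rightarrow> (int \<Rightarrow> int) \<Rightarrow> bool" where
  "zinv dd v \<longleftrightarrow> below dd v \<and> (\<forall>i j. \<exists>k. dd k + max 0 (i - k) + max 0 (k - j) \<le> rk v i j)"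

section \<open>The rank function of z_d along a run of the recursion\<close>

lemma arc_fl: assumes "p \<le> q" "q \<le> p + N"
  shows "fl k q - fl k p = (if \<exists>t. p + t * N \<le> k \<and> k < q + t * N then 1 else 0)"
proof -
  define t where "t = - fl k p - 1"
  have t1: "p + t * N \<le> k" using fl_neg_iff[of k "p + t * N"] by (simp add: t_def)
  have t2: "k < p + t * N + N" using fl_nonneg_iff[of k "p + t * N + N"] by (simp add: t_def)
  show ?thesis
  proof (cases "k < q + t * N")
    case True
    then have "0 \<le> fl k (q + t * N)" using fl_nonneg_iff by blast
    moreover have "fl k (q + t * N) \<le> fl k (p + N + t * N)" by (rule fl_mono) (use assms in simp)
    moreover have "fl k (p + N + t * N) = fl k p + 1 + t" by simp
    ultimately have "fl k q - fl k p = 1" by (simp add: t_def)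
    then show ?thesis using t1 True by auto
  next
    case False
    then have "fl k (q + t * N) < 0" using fl_neg_iff[of k "q + t * N"] by simp
    moreover have "fl k p \<le> fl k q" using assms by (simp add: fl_mono)
    ultimately have "fl k q - fl k p = 0" by (simp add: t_def)
    moreover have "\<not> (p + s * N \<le> k \<and> k < q + s * N)" for s
    proof
      assume s: "p + s * N \<le> k \<and> k < q + s * N"
      have "s \<noteq> t" using s False by auto
      then consider "s \<le> t - 1" | "t + 1 \<le> s" by linarith
      then show False
      proof cases
        case 1
        then have "s * N \<le> (t - 1) * N" by (intro mult_right_mono) auto
        then have "s * N \<le> t * N - N" by (simp add: algebra_simps)
        then show False using s t1 assms by linarith
      next
        case 2
        then have "(t + 1) * N \<le> s * N" by (intro mult_right_mono) auto
        then have "t * N + N \<le> s * N" by (simp add: algebra_simps)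
        then show False using s t2 by linarith
      qed
    qed
    ultimately show ?thesis by auto
  qed
qed

lemma arc_end: assumes "p < q" "q < p + N" shows "fl q q - fl q p = 0" "fl (p-1) q - fl (p-1) p = 0"
proof -
  have "fl q q \<le> fl q p" "fl (p-1) q \<le> fl (p - 1) p"
    using fl_self(1)[of q] fl_ge_iff[of "-1" q p] assms fl_less_iff[of "p-1" q 1] fl_nonneg_iff[of "p-1" p] by linarith+
  moreover have "fl q p \<le> fl q q" "fl (p-1) p \<le> fl (p-1) q" using assms by (simp_all add: fl_mono)
  ultimately show "fl q q - fl q p = 0" "fl (p-1) q - fl (p-1) p = 0" by simp_all
qed

lemma pext_root: "pext (root p q) x = fl x q - fl x p" by (simp add: pext_def root_eq_fl)

lemma le_pext: assumes "is_degree n d" "\<And>k. n \<le> k \<Longrightarrow> a k = 0"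
  shows "a \<le> d \<longleftrightarrow> (\<forall>x. pext a x \<le> pext d x)"
proof
  assume "a \<le> d" then show "\<forall>x. pext a x \<le> pext d x" by (simp add: pext_def le_fun_def)
next
  assume h: "\<forall>x. pext a x \<le> pext d x"
  show "a \<le> d" unfolding le_fun_def
  proof
    fix k show "a k \<le> d k"
      using h[rule_format, of "int k"] assms unfolding is_degree_def by (cases "k < n") (auto simp: pext_nat)
  qed
qed

lemma root_le: assumes "is_degree n d" shows "root p q \<le> d \<longleftrightarrow> (\<forall>x. fl x q - fl x p \<le> pext d x)"
  using le_pext[OF assms, of "root p q"] by (simp add: root_def[of p q, THEN fun_cong] pext_root)

text \<open>If the degree had room at the position next to an end, the root could be prolonged
  there. The result fails to be a real root only if the prolonged interval has length
  \<open>N\<close>; then the zero of the degree is the one uncovered class, which is that of both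
  \<open>p - 1\<close> and \<open>q\<close>.\<close>

lemma max_root_ends:
  assumes d: "is_degree n d" and k0: "k0 < n" "d k0 = 0" and mx: "maximal_root_below n d a"
  obtains p q where "p < q" "q < p + N" "\<not> eqm p q" "a = root p q" "pext d (p - 1) = 0" "pext d q = 0"
proof -
  obtain p q where pq: "a = root p q" "p < q" "\<not> eqm p q"
    using mx unfolding maximal_root_below_def pos_real_roots_eq by blast
  have le: "fl x q - fl x p \<le> pext d x" for x
    using mx root_le[OF d] unfolding maximal_root_below_def pq(1) by blast
  have mxx: "\<not> (root p' q' \<le> d \<and> root p q < root p' q')" if "p' < q'" "\<not> eqm p' q'" for p' q'
    using mx that unfolding maximal_root_below_def pq(1) pos_real_roots_eq by blast
  have dn: "0 \<le> pext d x" for x using d by (simp add: pext_def is_degree_def)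
  have z: "pext d (int k0) = 0" using k0 by (simp add: pext_nat)
  have len: "q < p + N"
  proof (rule ccontr)
    assume "\<not> q < p + N"
    then have "fl (int k0) (p + N) \<le> fl (int k0) q" by (intro fl_mono) simp
    then show False using le[of "int k0"] z by simp
  qed
  have peq: "pext d x = pext d y" if "eqm x y" for x y using periodic_eqm[OF pext_periodic that] .
  have full: "pext d q = 0" if "eqm (p - 1) q"
  proof -
    obtain t where t: "p \<le> int k0 + t * N" "int k0 + t * N < p + N" by (rule eqm_rep)
    have "q = p - 1 + N"
    proof -
      have "eqm (p - 1 + N) q" using that by simp
      then show ?thesis using eqm_close[of "p-1+N" q] pq(2) len by simp
    qed
    moreover have "\<not> int k0 + t * N < q"
    proof
      assume "int k0 + t * N < q"
      then have "fl (int k0 + t * N) q - fl (int k0 + t * N) p = 1"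
        using arc_fl[of p q "int k0 + t * N"] t pq(2) len by (auto intro!: exI[of _ 0])
      then show False using le[of "int k0 + t * N"] peq[of "int k0 + t * N" "int k0"] z by simp
    qed
    ultimately have "q = int k0 + t * N" using t by simp
    then show ?thesis using peq[of q "int k0"] z by simp
  qed
  have A: "pext d (p - 1) = 0"
  proof (rule ccontr)
    assume n0: "pext d (p - 1) \<noteq> 0"
    have ne: "\<not> eqm (p - 1) q" using full peq n0 by metis
    have s: "fl x p = fl x (p - 1) + (if eqm (p - 1) x then 1 else 0)" for x using fl_step[of x "p-1"] by simp
    have "fl x q - fl x (p - 1) \<le> pext d x" for x
    proof (cases "eqm (p - 1) x")
      case True
      have "fl x q - fl x p = fl (p - 1) q - fl (p - 1) p"
        using periodic_eqm[OF pext_periodic True, of "root p q"] by (simp add: pext_root)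
      then show ?thesis using arc_end(2)[OF pq(2) len] s[of x] True n0 dn[of "p-1"] peq[OF True] by simp
    qed (use le[of x] s[of x] in simp)
    then have "root (p - 1) q \<le> d" using root_le[OF d] by blast
    moreover have "root p q < root (p - 1) q"
    proof -
      have "root p q \<le> root (p - 1) q" by (auto simp: le_fun_def root_def fl_mono)
      moreover have "root p q \<noteq> root (p - 1) q"
      proof
        assume "root p q = root (p - 1) q"
        then have "fl (p-1) q - fl (p-1) p = fl (p-1) q - fl (p-1) (p-1)" using pext_root by metis
        then show False using s[of "p-1"] by simp
      qed
      ultimately show ?thesis by simp
    qed
    ultimately show False using mxx[of "p - 1" q] pq(2) ne by simp
  qed
  have B: "pext d q = 0"
  proof (rule ccontr)
    assume n0: "pext d q \<noteq> 0"
    have "\<not> eqm (p - 1) q" using full n0 by blast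
    then have ne: "\<not> eqm p (q + 1)" using eqm_add_cancel[of "p - 1" 1 q] by simp
    have s: "fl x (q + 1) = fl x q + (if eqm q x then 1 else 0)" for x using fl_step[of x q] by simp
    have "fl x (q + 1) - fl x p \<le> pext d x" for x
    proof (cases "eqm q x")
      case True
      have "fl x q - fl x p = fl q q - fl q p"
        using periodic_eqm[OF pext_periodic True, of "root p q"] by (simp add: pext_root)
      then show ?thesis using arc_end(1)[OF pq(2) len] s[of x] True n0 dn[of q] peq[OF True] by simp
    qed (use le[of x] s[of x] in simp)
    then have "root p (q + 1) \<le> d" using root_le[OF d] by blast
    moreover have "root p q < root p (q + 1)"
    proof -
      have "root p q \<le> root p (q + 1)" by (auto simp: le_fun_def root_def fl_mono)
      moreover have "root p q \<noteq> root p (q + 1)"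
      proof
        assume "root p q = root p (q + 1)"
        then have "fl q q - fl q p = fl q (q + 1) - fl q p" using pext_root by metis
        then show False using s[of q] by simp
      qed
      ultimately show ?thesis by simp
    qed
    ultimately show False using mxx[of p "q + 1"] pq(2) ne by simp
  qed
  show ?thesis using that pq len A B by blast
qed

lemma rk_tr: assumes "p < q" "\<not> eqm p q" shows "rk (tr p q) k k = fl k q - fl k p"
proof -
  have "rk (id \<circ> tr p q) k k = rk id k k + max 0 (fl k (min q (id q)) - fl k (max p (id p)))"
    by (rule rk_swap_diag) (use assms aperm_id aperm_ashift in auto)
  then show ?thesis using assms fl_mono[of p q k] by (simp only: rk_id id_comp id_apply) simp
qed

text \<open>If \<open>l\<close> and \<open>j\<close> lie under the same translate of the arc,
  \<open>k = l\<close> works because that arc is counted; otherwise some \<open>k\<close> between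
  them has coefficient 0, where the trivial bound \<open>rk_lower\<close> suffices. So a reflection
  has the largest rank function that its own degree allows.\<close>

lemma tr_lower:
  assumes "p < q" "q < p + N" "\<not> eqm p q"
  shows "\<exists>k. fl k q - fl k p + max 0 (l - k) + max 0 (k - j) \<le> rk (tr p q) l j"
proof -
  have one: "1 \<le> rk (tr p q) l j" if "p + t * N \<le> l" "l < q + t * N" "p + t * N \<le> j" "j < q + t * N" for l j t
  proof -
    have "max 0 (fl j (tr p q (p + t * N)) - fl l (p + t * N)) \<le> rk (tr p q) l j"
      unfolding rk_def by (rule psum_ge[OF rk_periodic[OF tr_ashift]]) simp
    moreover have "tr p q (p + t * N) = q + t * N" by (simp add: tr_def)
    moreover have "0 \<le> fl j (q + t * N)" "fl l (p + t * N) < 0" using that fl_nonneg_iff fl_neg_iff by blast+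
    ultimately show ?thesis by simp
  qed
  have ap: "aperm (tr p q)" using assms by (intro tr_aperm)
  have inv: "inv (tr p q) = tr p q" using tr_comp[OF assms(3)] by (metis inv_unique_comp)
  have af: "fl k q - fl k p = (if \<exists>t. p + t * N \<le> k \<and> k < q + t * N then 1 else 0)" for k
    using arc_fl[of p q k] assms by simp
  show ?thesis
  proof (cases "\<exists>t. p + t * N \<le> min l j \<and> max l j < q + t * N")
    case True
    then obtain t where t: "p + t * N \<le> l" "l < q + t * N" "p + t * N \<le> j" "j < q + t * N" by auto
    have "1 + max 0 (l - j) \<le> rk (tr p q) l j"
      using one[OF t] one[OF t(3,4,1,2)] rk_inv[OF ap, of l j] unfolding inv by linarith
    moreover have "fl l q - fl l p = 1" unfolding af using t by auto
    ultimately show ?thesis by (intro exI[of _ l]) simp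
  next
    case False
    have "\<exists>k. fl k q - fl k p = 0 \<and> min l j \<le> k \<and> k \<le> max l j"
    proof (cases "\<exists>t. p + t * N \<le> min l j \<and> min l j < q + t * N")
      case c: True
      then obtain t where t: "p + t * N \<le> min l j" "min l j < q + t * N" by blast
      have "q + t * N \<le> max l j" using False t by (meson not_le)
      moreover have "fl (q + t * N) q - fl (q + t * N) p = 0" using arc_end(1)[OF assms(1,2)] by simp
      ultimately show ?thesis using t by (intro exI[of _ "q + t * N"]) auto
    next
      case c: False
      then have "fl (min l j) q - fl (min l j) p = 0" unfolding af by auto
      then show ?thesis by (intro exI[of _ "min l j"]) auto
    qed
    then obtain k where k: "fl k q - fl k p = 0" "min l j \<le> k" "k \<le> max l j" by blast
    then show ?thesis using rk_lower[OF ap, of l j] by (intro exI[of _ k]) (auto simp: max_def min_def split: if_splits)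
  qed
qed

text \<open>The rank of the Hecke product is a sum at some \<open>l\<close>; its two summands are
  bounded through a \<open>k\<close> and a \<open>k'\<close>. If the coefficient of the root at
  \<open>k'\<close> is at most that at \<open>k\<close>, the triangle inequality makes
  \<open>k'\<close> a witness. Otherwise \<open>k'\<close> lies under an arc and \<open>k\<close>
  does not, so the way between them passes a translate of \<open>p - 1\<close> or \<open>q\<close>;
  the degree vanishes there, and that position is the witness.\<close>

lemma zinv_step:
  assumes pq: "p < q" "q < p + N" "\<not> eqm p q" and e: "dd (p - 1) = 0" "dd q = 0" "periodic dd"
    and z: "zinv (\<lambda>k. dd k - (fl k q - fl k p)) w'" and m: "mp (tr p q) w' w" and w: "aperm w"
  shows "zinv dd w"
  unfolding zinv_def below_def
proof (intro conjI allI w)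
  let ?a = "\<lambda>k. fl k q - fl k p"
  have b: "rk w' k k \<le> dd k - ?a k" for k using z unfolding zinv_def below_def by blast
  fix k
  show "rk w k k \<le> dd k"
    using m[unfolded mp_def, THEN conjunct1, rule_format, of k k k] b[of k] rk_tr[OF pq(1,3), of k] by linarith
next
  let ?a = "\<lambda>k. fl k q - fl k p"
  have b: "rk w' k k \<le> dd k - ?a k" for k using z unfolding zinv_def below_def by blast
  fix i j
  obtain l where l: "rk w i j = rk (tr p q) l j + rk w' i l" using m unfolding mp_def by blast
  obtain k where k: "?a k + max 0 (l - k) + max 0 (k - j) \<le> rk (tr p q) l j" using tr_lower[OF pq] by blast
  obtain k' where k': "dd k' - ?a k' + max 0 (i - k') + max 0 (k' - l) \<le> rk w' i l" using z unfolding zinv_def by blast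
  have d': "0 \<le> dd k' - ?a k'" using b[of k'] rk_nonneg[of w' k' k'] by linarith
  have af: "?a k = (if \<exists>t. p + t * N \<le> k \<and> k < q + t * N then 1 else 0)" for k
    using arc_fl[of p q k] pq by simp
  show "\<exists>k. dd k + max 0 (i - k) + max 0 (k - j) \<le> rk w i j"
  proof (cases "?a k' \<le> ?a k")
    case True
    then have "dd k' + max 0 (i - k') + max 0 (k' - j) \<le> rk w i j" using l k k' by linarith
    then show ?thesis by blast
  next
    case False
    then have k0: "?a k = 0" "?a k' = 1" unfolding af by (auto split: if_splits)
    obtain t where t: "p + t * N \<le> k'" "k' < q + t * N" using k0(2) af[of k'] by (auto split: if_splits)
    have "\<not> (p + t * N \<le> k \<and> k < q + t * N)" using k0(1) af[of k] by (auto split: if_splits)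
    then consider "k < p + t * N" | "q + t * N \<le> k" by linarith
    then show ?thesis
    proof cases
      case 1
      have "dd (p - 1 + t * N) = 0" using periodic_shift[OF e(3)] e(1) by simp
      then have "dd (p - 1 + t * N) + max 0 (i - (p - 1 + t * N)) + max 0 ((p - 1 + t * N) - j) \<le> rk w i j"
        using 1 t l k k' d' k0(1) by linarith
      then show ?thesis by blast
    next
      case 2
      have "dd (q + t * N) = 0" using periodic_shift[OF e(3)] e(2) by simp
      then have "dd (q + t * N) + max 0 (i - (q + t * N)) + max 0 ((q + t * N) - j) \<le> rk w i j"
        using 2 t l k k' d' k0(1) by linarith
      then show ?thesis by blast
    qed
  qed
qed

lemma z_rel_zinv: "z_rel n d w \<Longrightarrow> \<exists>v. w = act v \<and> zinv (pext d) v"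
proof (induction rule: z_rel.induct)
  case zero
  have "zinv (pext 0) id" unfolding zinv_def below_def
  proof (intro conjI allI aperm_id)
    show "rk id k k \<le> pext 0 k" for k by (simp only: rk_id) (simp add: pext_def)
    show "\<exists>k. pext 0 k + max 0 (i - k) + max 0 (k - j) \<le> rk id i j" for i j
      by (intro exI[of _ i], simp only: rk_id) (simp add: pext_def)
  qed
  then show ?case using act_id by metis
next
  case (step d a w)
  then obtain k0 where k0: "k0 < n" "d k0 = 0" by blast
  obtain p q where pq: "p < q" "q < p + N" "\<not> eqm p q" "a = root p q" "pext d (p - 1) = 0" "pext d q = 0"
    using max_root_ends[OF step.hyps(1) k0 step.hyps(4)] by blast
  obtain v where v: "w = act v" "zinv (pext (d - a)) v" using step.IH by blast
  have "pext (d - a) = (\<lambda>k. pext d k - (fl k q - fl k p))"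
    unfolding pq(4) pext_root[symmetric] by (auto simp: pext_def fun_eq_iff)
  then have zv: "zinv (\<lambda>k. pext d k - (fl k q - fl k p)) v" using v(2) by simp
  have "aperm v" using v(2) unfolding zinv_def below_def by blast
  then obtain u where u: "aperm u" "hecke n (act (tr p q)) (act v) = act u" "mp (tr p q) v u"
    using hecke_act[OF tr_aperm[OF pq(3)]] by blast
  have "zinv (pext d) u" by (rule zinv_step[OF pq(1-3,5,6) pext_periodic zv u(3,1)])
  then show ?case using u(2) unfolding v(1) pq(4) refl_root[OF pq(3)] by blast
qed

lemma root_beyond: "n \<le> k \<Longrightarrow> root a b k = 0" by (simp add: root_def)

text \<open>A root of greatest height below \<open>d\<close> will do: a strictly larger root is
  higher, because roots vanish from \<open>n\<close> on.\<close>

lemma maximal_root_exists: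
  assumes "is_degree n d" "d \<noteq> 0" shows "\<exists>a. maximal_root_below n d a"
proof -
  obtain i where i: "d i \<noteq> 0" using assms(2) by (auto simp: fun_eq_iff)
  then have "i < n" "1 \<le> d i" using assms(1) unfolding is_degree_def by (meson not_le, smt (verit))
  define P where "P a \<longleftrightarrow> a \<in> pos_real_roots n \<and> a \<le> d" for a
  define f where "f a = nat (\<Sum>k<n. a k)" for a :: lat
  have "root (int i) (int i + 1) \<in> pos_real_roots n" unfolding pos_real_roots_eq using not_eqm_succ(1) by fastforce
  moreover have "root (int i) (int i + 1) \<le> d"
    unfolding root_simple[OF \<open>i < n\<close>] using \<open>1 \<le> d i\<close> assms(1) by (auto simp: simple_def le_fun_def is_degree_def)
  ultimately have "P (simple i)" unfolding P_def root_simple[OF \<open>i < n\<close>] by blast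
  moreover have "\<forall>a. P a \<longrightarrow> f a < Suc (f d)" unfolding P_def f_def
    by (auto simp: le_fun_def less_Suc_eq_le intro!: nat_mono sum_mono)
  ultimately obtain a where a: "P a" "\<And>b. P b \<Longrightarrow> f b \<le> f a" using ex_has_greatest_nat[of P _ f] by blast
  have "\<not> a < b" if Pb: "P b" for b
  proof
    assume "a < b"
    obtain p q where p: "a = root p q" "p < q" using a(1) unfolding P_def pos_real_roots_eq by blast
    obtain p' q' where p': "b = root p' q'" "p' < q'" using Pb unfolding P_def pos_real_roots_eq by blast
    have "(\<Sum>k<n. a k) < (\<Sum>k<n. b k)"
    proof (rule ccontr)
      assume "\<not> ?thesis"
      then have "(\<Sum>k<n. b k - a k) \<le> 0" by (simp add: sum_subtractf)
      moreover have nn: "0 \<le> b k - a k" for k using \<open>a < b\<close> by (simp add: less_fun_def le_fun_def)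
      ultimately have "\<forall>k\<in>{..<n}. b k - a k = 0"
        using sum_nonneg_eq_0_iff[of "{..<n}" "\<lambda>k. b k - a k"] sum_nonneg[of "{..<n}" "\<lambda>k. b k - a k"] by force
      then have "a = b" using p(1) p'(1) root_beyond by (metis eq_iff_diff_eq_0 ext lessThan_iff not_le)
      then show False using \<open>a < b\<close> by simp
    qed
    then have "f a < f b" unfolding f_def using p p' root_height by simp
    then show False using a(2)[OF Pb] by simp
  qed
  then show ?thesis unfolding maximal_root_below_def using a(1) unfolding P_def by blast
qed

lemma z_rel_exists: "is_degree n d \<Longrightarrow> \<exists>k<n. d k = 0 \<Longrightarrow> \<exists>w. z_rel n d w"
proof (induction "nat (\<Sum>k<n. d k)" arbitrary: d rule: less_induct)
  case less
  show ?case
  proof (cases "d = 0")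
    case True then show ?thesis using z_rel.zero by blast
  next
    case False
    obtain a where a: "maximal_root_below n d a" using maximal_root_exists less.prems(1) False by blast
    then obtain p q where pq: "a = root p q" "p < q" "a \<le> d"
      unfolding maximal_root_below_def pos_real_roots_eq by blast
    have a0: "0 \<le> a k" for k unfolding pq(1) using root_pos[OF pq(2)] .
    have deg: "is_degree n (d - a)" using less.prems(1) pq(3) root_beyond
      unfolding is_degree_def le_fun_def pq(1) by auto
    obtain k0 where k0: "k0 < n" "d k0 = 0" using less.prems(2) by blast
    then have "a k0 = 0" using pq(3) a0[of k0] by (metis le_fun_def order_antisym)
    then have "\<exists>k<n. (d - a) k = 0" using k0 by auto
    moreover have "(\<Sum>k<n. (d - a) k) = (\<Sum>k<n. d k) - (q - p)"
      unfolding pq(1) by (simp add: sum_subtractf root_height)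
    moreover have "0 \<le> (\<Sum>k<n. (d - a) k)" using deg by (intro sum_nonneg) (simp only: is_degree_def)
    ultimately obtain w where "z_rel n (d - a) w" using less.hyps[of "d - a"] deg pq(2) by auto
    then show ?thesis using z_rel.step[OF less.prems(1) False less.prems(2) a] by blast
  qed
qed

lemma zel_zinv: assumes "is_degree n d" "\<exists>k<n. d k = 0"
  obtains v where "zel n d = act v" "zinv (pext d) v"
proof -
  have "z_rel n d (zel n d)" unfolding zel_def by (rule someI_ex[OF z_rel_exists[OF assms]])
  then show ?thesis using z_rel_zinv that by blast
qed

subsection \<open>Locally maximal elements\<close>

text \<open>\<open>spread\<close> says that a swap at \<open>i < j\<close> with \<open>v i < v j\<close> always increases the degree, see
  \<open>rk_swap_diag\<close>.\<close>

definition spread :: "(int \<Rightarrow> int) \<Rightarrow> bool" where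
  "spread v \<longleftrightarrow> (\<forall>i j. i < j \<longrightarrow> \<not> eqm i j \<longrightarrow> v i < v j \<longrightarrow> max i (v i) < min j (v j))"

text \<open>When the stretch in \<open>rk_swap_diag\<close> is empty, the swap leaves all diagonal
  ranks unchanged and so stays below \<open>dd\<close>.\<close>

lemma lmax_spread: assumes "lmax dd v" shows "spread v"
  unfolding spread_def
proof (intro allI impI)
  fix i j assume ij: "i < j" "\<not> eqm i j" "v i < v j"
  have av: "aperm v" and b: "\<And>k. rk v k k \<le> dd k" using assms unfolding lmax_def below_def by auto
  show "max i (v i) < min j (v j)"
  proof (rule ccontr)
    assume "\<not> ?thesis"
    then have "fl k (min j (v j)) \<le> fl k (max i (v i))" for k by (intro fl_mono) linarith
    then have "rk (v \<circ> tr i j) k k = rk v k k" for k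
      using rk_swap_diag[OF aperm_ashift[OF av] ij(2,1,3), of k] by simp
    then have "below dd (v \<circ> tr i j)" unfolding below_def using b av ij(2) by (simp add: aperm_comp tr_aperm)
    then show False using assms ij unfolding lmax_def by blast
  qed
qed

text \<open>Here the stretch in \<open>rk_swap_diag\<close> is the single position \<open>K\<close>:
  the swap raises the rank by one in the class of \<open>K\<close> and nowhere else, and only a lack
  of room at \<open>K\<close> can forbid it.\<close>

lemma lmax_tight: assumes "lmax dd v" "periodic dd" "i < j" "\<not> eqm i j" "v i < v j"
  "max i (v i) = K" "min j (v j) = K + 1" shows "rk v K K = dd K"
proof (rule ccontr)
  assume ne: "rk v K K \<noteq> dd K"
  have av: "aperm v" and b: "\<And>k. rk v k k \<le> dd k" using assms(1) unfolding lmax_def below_def by auto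
  have lt: "rk v K K < dd K" using ne b[of K] by simp
  have "rk (v \<circ> tr i j) k k \<le> dd k" for k
  proof (cases "eqm K k")
    case True
    then have "rk v k k < dd k"
      using periodic_eqm[OF rk_diag_periodic, of K k v] periodic_eqm[OF assms(2), of K k] lt by simp
    then show ?thesis using rk_swap_diag[OF aperm_ashift[OF av] assms(4,3,5), of k] True unfolding assms(6,7) fl_step by simp
  next
    case False
    then show ?thesis using rk_swap_diag[OF aperm_ashift[OF av] assms(4,3,5), of k] b[of k] unfolding assms(6,7) fl_step by simp
  qed
  then have "below dd (v \<circ> tr i j)" unfolding below_def using av assms(4) by (simp add: aperm_comp tr_aperm)
  then show False using assms unfolding lmax_def by blast
qed

lemma spread_N1: assumes "spread v" "aperm v" "i < j" "j \<le> v i" "\<not> eqm i j" shows "v j < v i"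
proof (rule ccontr)
  assume "\<not> v j < v i"
  moreover have "v i \<noteq> v j" using aperm_inj[OF assms(2), of i j] assms(3) by simp
  ultimately have "v i < v j" by linarith
  then have "max i (v i) < min j (v j)" using assms(1,3,5) unfolding spread_def by blast
  then show False using assms(4) by simp
qed

text \<open>The counterpart of \<open>spread_N1\<close> for descending arcs, with positions and
  values exchanged.\<close>

lemma spread_N2: assumes "spread v" "v a < v b" "v b \<le> a" "\<not> eqm a b" shows "b < a"
proof (rule ccontr)
  assume "\<not> b < a"
  then have "a < b" using assms(2) by (metis less_irrefl linorder_neqE)
  then have "max a (v a) < min b (v b)" using assms unfolding spread_def by blast
  then show False using assms(3) by simp
qed

text \<open>\<open>kap v a\<close> is the number of full turns of the arc from \<open>a\<close> to \<open>v a\<close>, and \<open>zz v\<close> is \<open>v\<close>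
  with all full turns removed.\<close>

definition kap :: "(int \<Rightarrow> int) \<Rightarrow> int \<Rightarrow> int" where
  "kap v a = (if a \<le> v a then (v a - a) div N else - ((a - v a) div N))"

definition zz :: "(int \<Rightarrow> int) \<Rightarrow> int \<Rightarrow> int" where "zz v a = v a - kap v a * N"

lemma kap_periodic: "ashift v \<Longrightarrow> periodic (kap v)" by (simp add: periodic_def kap_def ashift_def)
lemma kap_pos: assumes "a \<le> v a" shows "0 \<le> kap v a" "a \<le> zz v a" "zz v a < a + N" "zz v a \<le> v a"
proof -
  have e: "zz v a = a + (v a - a) mod N" using assms
    by (simp add: zz_def kap_def minus_div_mult_eq_mod[symmetric])
  show k: "0 \<le> kap v a" using assms N3 by (simp add: kap_def pos_imp_zdiv_nonneg_iff)
  show "a \<le> zz v a" "zz v a < a + N" unfolding e using N3 by simp_all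
  show "zz v a \<le> v a" using k by (simp add: zz_def)
qed
lemma kap_neg: assumes "v a \<le> a" shows "kap v a \<le> 0" "zz v a \<le> a" "a - N < zz v a" "v a \<le> zz v a"
proof -
  have e: "zz v a = a - (a - v a) mod N" using assms
    by (cases "v a = a") (simp_all add: zz_def kap_def minus_div_mult_eq_mod[symmetric])
  show k: "kap v a \<le> 0" using assms N3 by (auto simp: kap_def pos_imp_zdiv_nonneg_iff)
  show "zz v a \<le> a" "a - N < zz v a" unfolding e using N3 by simp_all
  show "v a \<le> zz v a" using k by (simp add: zz_def mult_nonpos_nonneg)
qed
lemma zz_ashift: "ashift v \<Longrightarrow> ashift (zz v)"
  using kap_periodic[of v] by (simp add: zz_def ashift_def periodic_def)
lemma zz_bij: assumes "aperm v" shows "bij (zz v)"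
proof (rule bijI)
  have as: "ashift v" using assms by (rule aperm_ashift)
  show "inj (zz v)"
  proof (rule injI)
    fix a b assume e: "zz v a = zz v b"
    then have "v a = v b + (kap v a - kap v b) * N" by (simp add: zz_def algebra_simps)
    then have "eqm a b" using aperm_eqm_iff[OF assms] eqm_shift(1) by metis
    then obtain t where t: "a = b + t * N" by (rule eqm_E)
    then have "t * N = 0" using e ashift_shift[OF zz_ashift[OF as]] by simp
    then show "a = b" using t by simp
  qed
  show "surj (zz v)"
  proof (rule surjI)
    fix y
    show "zz v (inv v y + kap v (inv v y) * N) = y"
      unfolding ashift_shift[OF zz_ashift[OF as]] by (simp add: zz_def aperm_inv_f assms)
  qed
qed
text \<open>The full turns are moved from the end of the arc to its start, which lets the
  non-crossing conditions on \<open>v\<close> be applied to arcs of \<open>zz v\<close>.\<close>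

lemma v_back: assumes "ashift v" shows "v (x - kap v x * N) = zz v x"
  using ashift_shift[OF assms, of x "- kap v x"] by (simp add: zz_def)

text \<open>Non-crossing of ascending arcs only, all shorter than a period. The descending arcs of
  \<open>f\<close> are the ascending arcs of its inverse and are treated there.\<close>

definition nc :: "(int \<Rightarrow> int) \<Rightarrow> bool" where
  "nc f \<longleftrightarrow> bij f \<and> ashift f \<and> (\<forall>x. x < f x \<longrightarrow> f x < x + N) \<and>
    (\<forall>x j. x < j \<longrightarrow> j \<le> f x \<longrightarrow> \<not> eqm x j \<longrightarrow> f j < f x)"

text \<open>Matching of parentheses, by joint induction on the length of arcs. If \<open>g\<close>
  sends the opening \<open>x\<close> further than \<open>f\<close> does, the closing
  \<open>f x\<close> ends another arc of \<open>g\<close>. Starting after \<open>x\<close>, that arc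
  is shorter and so an arc of \<open>f\<close>, against injectivity; starting before
  \<open>x\<close>, it would be crossed by the arc of \<open>g\<close> at \<open>x\<close>.\<close>

lemma nc_unique:
  assumes f: "nc f" and g: "nc g" and st: "\<And>x. x < f x \<longleftrightarrow> x < g x" and en: "\<And>y. inv f y < y \<longleftrightarrow> inv g y < y"
  shows "x < f x \<Longrightarrow> g x = f x"
proof -
  have half: "g x = f x"
    if f: "nc f" and g: "nc g" and st: "\<And>x. x < f x \<longleftrightarrow> x < g x" and en: "\<And>y. inv f y < y \<longleftrightarrow> inv g y < y"
    and IH: "\<And>x. x < g x \<Longrightarrow> g x - x < L \<Longrightarrow> f x = g x" and x: "x < f x" "f x - x = L" for f g x L
  proof -
    have inj: "f a = f b \<longleftrightarrow> a = b" for a b using f by (auto simp: nc_def bij_def inj_def)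
    have gx: "x < g x" using st x by blast
    have fi: "inv f (f x) = x" using f by (simp add: nc_def bij_is_inj)
    consider "g x < f x" | "g x = f x" | "f x < g x" by linarith
    then show ?thesis
    proof cases
      case 1
      then show ?thesis using IH[OF gx] x by simp
    next
      case 3
      define s where "s = inv g (f x)"
      have gs: "g s = f x" using g by (simp add: nc_def s_def bij_is_surj surj_f_inv_f)
      have sl: "s < f x" using en[of "f x"] fi x by (simp add: s_def)
      have "s \<noteq> x" using gs 3 by auto
      then consider "x < s" | "s < x" by linarith
      then show ?thesis
      proof cases
        case 1
        then have "f s = g s" using IH[of s] gs sl x by simp
        then show ?thesis using gs inj[of s x] 1 by simp
      next
        case 2
        have "\<not> eqm s x"
        proof
          assume "eqm s x"
          then have "eqm (f x) (g x)" using gs g ashift_eqm unfolding nc_def by metis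
          moreover have "g x < x + N" using g gx by (simp add: nc_def)
          ultimately have "f x = g x" using eqm_close[of "f x" "g x"] 3 x by simp
          then show False using 3 by simp
        qed
        moreover have "x \<le> g s" using gs x by simp
        ultimately have "g x < g s" using g 2 unfolding nc_def by blast
        then show ?thesis using gs 3 by simp
      qed
    qed
  qed
  have all: "\<forall>x. (x < f x \<longrightarrow> f x - x = int L \<longrightarrow> g x = f x) \<and> (x < g x \<longrightarrow> g x - x = int L \<longrightarrow> f x = g x)" for L
  proof (induction L rule: less_induct)
    case (less L)
    have I: "f x = g x" if "x < g x" "g x - x < int L" for x
    proof -
      have "nat (g x - x) < L" "int (nat (g x - x)) = g x - x" using that by linarith+
      then show ?thesis using less[of "nat (g x - x)"] that(1) by metis
    qed
    have J: "g x = f x" if "x < f x" "f x - x < int L" for x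
    proof -
      have "nat (f x - x) < L" "int (nat (f x - x)) = f x - x" using that by linarith+
      then show ?thesis using less[of "nat (f x - x)"] that(1) by metis
    qed
    show ?case
    proof (intro allI conjI impI)
      fix x assume "x < f x" "f x - x = int L"
      then show "g x = f x" using half[OF f g st en I] by blast
    next
      fix x assume "x < g x" "g x - x = int L"
      then show "f x = g x" using half[OF g f st[symmetric] en[symmetric] J] by blast
    qed
  qed
  assume x: "x < f x"
  then have "f x - x = int (nat (f x - x))" by simp
  then show "g x = f x" using all[of "nat (f x - x)"] x by blast
qed

definition nci :: "(int \<Rightarrow> int) \<Rightarrow> bool" where "nci f \<longleftrightarrow> nc f \<and> f \<circ> f = id"

lemma nci_invol: "nci f \<Longrightarrow> f (f x) = x" by (metis nci_def comp_apply id_apply)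
lemma nci_inv: "nci f \<Longrightarrow> inv f = f" by (metis nci_def inv_unique_comp)
text \<open>In an involution no point both opens and closes an ascending arc, so the difference of
  the two indicators reveals each of them.\<close>

lemma nci_eqI: assumes "nci f" "nci g"
  "\<And>k. (if k < f k then 1 else 0) - (if f k < k then 1 else 0) = (if k < g k then 1 else 0 :: int) - (if g k < k then 1 else 0)"
  shows "f = g"
proof
  fix x
  have s: "k < f k \<longleftrightarrow> k < g k" "f k < k \<longleftrightarrow> g k < k" for k using assms(3)[of k] by (auto split: if_splits)
  have u: "g k = f k" if "k < f k" for k
    by (rule nc_unique) (use assms s that in \<open>auto simp: nci_inv nci_def[of f] nci_def[of g]\<close>)
  consider "x < f x" | "f x < x" | "f x = x" by linarith
  then show "f x = g x"
  proof cases
    case 2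
    then have "g (f x) = x" using u[of "f x"] nci_invol[OF assms(1)] by simp
    then show ?thesis using nci_invol[OF assms(2)] by metis
  next
    case 3 then show ?thesis using s[of x] by linarith
  qed (use u in simp)
qed

lemma nci_aperm: assumes "nci f" shows "aperm f"
proof -
  have f: "bij f" "ashift f" using assms by (auto simp: nci_def nc_def)
  have "psum (\<lambda>c. f (f c) - f c) = psum (\<lambda>c. f c - c)" by (rule psum_reindex[OF ashift_periodic f]) (rule f)
  moreover have "psum (\<lambda>c. f (f c) - f c) = - psum (\<lambda>c. f c - c)"
    by (simp add: nci_invol[OF assms] psum_def sum_negf[symmetric])
  ultimately show ?thesis using f by (simp add: aperm_def)
qed

text \<open>Put a start of the second class between \<open>a\<close> and \<open>a + N\<close>. Each
  long arc covers the next start, so by \<open>spread_N1\<close> the values at \<open>a\<close>,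
  \<open>b'\<close> and \<open>a + N\<close> decrease, although \<open>v (a + N)\<close> exceeds
  \<open>v a\<close>.\<close>

lemma spread_long_pos: assumes "spread v" "aperm v" "1 \<le> kap v a" "1 \<le> kap v b" shows "eqm a b"
proof (rule ccontr)
  assume ne: "\<not> eqm a b"
  have as: "ashift v" using assms(2) by (rule aperm_ashift)
  have long: "x + N \<le> v x" if "1 \<le> kap v x" for x
  proof -
    have "x \<le> v x" using kap_neg(1)[of v x] that by linarith
    then have "1 \<le> (v x - x) div N" using that by (simp add: kap_def)
    then have "0 + 1 * N < v x - x + 1" using fl_ge_iff[of 1 0 "v x - x + 1"] by (simp add: fl_def)
    then show ?thesis by simp
  qed
  obtain t where t: "a < b + t * N" "b + t * N < a + N" using shift_rep[OF ne] by blast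
  define b' where "b' = b + t * N"
  have ne': "\<not> eqm a b'" "\<not> eqm b' (a + N)" using ne eqm_sym by (auto simp: b'_def)
  (metis eqm_shift(1,2) eqm_trans eqm_sym, metis eqm_shift_left eqm_sym)
  have k: "1 \<le> kap v b'" using assms(4) periodic_shift[OF kap_periodic[OF as]] by (simp add: b'_def)
  have "v b' < v a" using spread_N1[OF assms(1,2), of a b'] t ne' long[OF assms(3)] by (simp add: b'_def)
  moreover have "v (a + N) < v b'"
    using spread_N1[OF assms(1,2), of b' "a + N"] t ne' long[OF k] by (simp add: b'_def)
  moreover have "v (a + N) = v a + N" using as by (simp add: ashift_def)
  ultimately show False using N3 by simp
qed

lemma spread_long_neg: assumes "spread v" "aperm v" "kap v a \<le> -1" "kap v b \<le> -1" shows "eqm a b"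
proof (rule ccontr)
  assume ne: "\<not> eqm a b"
  have as: "ashift v" using assms(2) by (rule aperm_ashift)
  have long: "v x \<le> x - N" if "kap v x \<le> -1" for x
  proof -
    have x: "v x < x" using kap_pos(1)[of x v] that by linarith
    then have "1 \<le> (x - v x) div N" using that by (simp add: kap_def)
    then have "0 + 1 * N < x - v x + 1" using fl_ge_iff[of 1 0 "x - v x + 1"] by (simp add: fl_def)
    then show ?thesis by simp
  qed
  have "\<not> eqm (v a) (v b)" using ne aperm_eqm_iff[OF assms(2)] by blast
  then obtain t where t: "v a < v b + t * N" "v b + t * N < v a + N" using shift_rep by blast
  define b' where "b' = b + t * N"
  have vb: "v b' = v b + t * N" using ashift_shift[OF as] by (simp add: b'_def)
  have ne': "\<not> eqm a b'" "\<not> eqm b' (a + N)" using ne eqm_sym by (auto simp: b'_def)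
  (metis eqm_shift(1,2) eqm_trans eqm_sym, metis eqm_shift_left eqm_sym)
  have k: "kap v b' \<le> -1" using assms(4) periodic_shift[OF kap_periodic[OF as]] by (simp add: b'_def)
  have va: "v (a + N) = v a + N" using as by (simp add: ashift_def)
  have "b' < a" using spread_N2[OF assms(1), of a b'] t ne' long[OF assms(3)] vb by simp
  moreover have "a + N < b'"
    using spread_N2[OF assms(1), of b' "a + N"] t ne' long[OF k] vb va by simp
  ultimately show False using N3 by simp
qed

text \<open>By \<open>v_back\<close> an ascending arc of \<open>zz v\<close> is an arc of
  \<open>v\<close> whose start has been moved to the right, so it covers fewer positions.\<close>

lemma zz_nc: assumes "spread v" "aperm v" shows "nc (zz v)"
  unfolding nc_def
proof (intro conjI allI impI)
  have as: "ashift v" using assms(2) by (rule aperm_ashift)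
  show "bij (zz v)" using zz_bij assms(2) .
  show "ashift (zz v)" using zz_ashift as .
  fix x
  have pos: "x \<le> v x" if "x < zz v x" for x using that kap_neg(2)[of v x] by linarith
  show "x < zz v x \<Longrightarrow> zz v x < x + N" using pos kap_pos(3) by blast
  fix j assume j: "x < j" "j \<le> zz v x" "\<not> eqm x j"
  have xv: "x \<le> v x" using pos j by simp
  define i where "i = x - kap v x * N"
  have "0 \<le> kap v x * N" using kap_pos(1)[of x v, OF xv] by simp
  then have i: "i \<le> x" "v i = zz v x" using v_back[OF as] by (auto simp: i_def)
  have "\<not> eqm i j" using j(3) unfolding i_def by (metis eqm_shift(4) eqm_trans)
  then have lt: "v j < zz v x" using spread_N1[OF assms, of i j] i j by simp
  show "zz v j < zz v x"
  proof (cases "j \<le> v j")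
    case True then show ?thesis using kap_pos(4)[of j v, OF True] lt by simp
  next
    case False
    then have "zz v j \<le> zz v x" using kap_neg(2)[of v j] j by simp
    moreover have "zz v j \<noteq> zz v x" using zz_bij[OF assms(2)] j(1) by (auto simp: bij_def inj_def)
    ultimately show ?thesis by simp
  qed
qed

lemma zz_inv_nc: assumes "spread v" "aperm v" shows "nc (inv (zz v))"
  unfolding nc_def
proof (intro conjI allI impI)
  have as: "ashift v" using assms(2) by (rule aperm_ashift)
  let ?i = "inv (zz v)"
  have b: "bij (zz v)" using zz_bij assms(2) .
  show "bij ?i" using b by (rule bij_imp_bij_inv)
  show "ashift ?i" using ashift_inv[OF b zz_ashift[OF as]] .
  have zi: "zz v (?i y) = y" for y using b by (simp add: bij_is_surj surj_f_inv_f)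
  fix x
  have neg: "v a < a" if "zz v a < a" for a using that kap_pos(2)[of a v] by linarith
  show "?i x < x + N" if "x < ?i x" using neg[of "?i x"] kap_neg(3)[of v "?i x"] that zi[of x] by simp
  fix j assume j: "x < j" "j \<le> ?i x" "\<not> eqm x j"
  define a b where "a = ?i x" and "b = ?i j"
  have ab: "zz v a = x" "zz v b = j" using zi by (auto simp: a_def b_def)
  have va: "v a < a" using neg[of a] ab j by (simp add: a_def)
  have ne: "\<not> eqm a b" using j(3) ashift_eqm_iff[OF \<open>bij (zz v)\<close> zz_ashift[OF as], of a b] ab by simp
  have "b < a"
  proof (cases "b \<le> v b")
    case True
    have "b \<noteq> a" using ne by auto
    then show ?thesis using kap_pos(2)[of b v, OF True] ab j by (simp add: a_def)
  next
    case False
    define b' where "b' = b - kap v b * N"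
    have "0 \<le> - kap v b * N" using kap_neg(1)[of v b] False by (simp add: mult_nonpos_nonneg)
    then have b': "b \<le> b'" "v b' = j" using v_back[OF as, of b] ab by (auto simp: b'_def)
    have "\<not> eqm a b'" using ne unfolding b'_def by (metis eqm_shift(3) eqm_trans)
    moreover have "v a < v b'" "v b' \<le> a" using kap_neg(4)[of v a] va ab j b' by (auto simp: a_def)
    ultimately have "b' < a" using spread_N2[OF assms(1)] by blast
    then show ?thesis using b' by simp
  qed
  then show "?i j < ?i x" by (simp add: a_def b_def)
qed

text \<open>A fixed point of \<open>zz v\<close> with nonzero \<open>kap\<close> may open and close
  an arc at once, and the two contributions cancel; elsewhere \<open>v\<close> and
  \<open>zz v\<close> go in the same direction. The second formula comes from the inverse of
  \<open>v\<close>, which has the same diagonal ranks.\<close>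

lemma zz_steps: assumes "aperm v"
  shows "rk v k k - rk v (k-1) (k-1) = (if k < zz v k then 1 else 0) - (if inv (zz v) k < k then 1 else 0)"
    and "rk v k k - rk v (k-1) (k-1) = (if k < inv (zz v) k then 1 else 0) - (if zz v k < k then 1 else 0)"
proof -
  have as: "ashift v" using assms by (rule aperm_ashift)
  let ?i = "inv (zz v)"
  have b: "bij (zz v)" using zz_bij assms .
  have zi: "zz v (?i y) = y" for y using b by (simp add: bij_is_surj surj_f_inv_f)
  have eqk: "?i k = k \<longleftrightarrow> zz v k = k" using b by (metis bij_inv_eq_iff)
  have fx: "v x = x + kap v x * N" if "zz v x = x" for x using that by (simp add: zz_def)
  have sgn: "0 < t * N \<longleftrightarrow> 1 \<le> t" "t * N < 0 \<longleftrightarrow> t \<le> -1" for t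
    using N3 by (auto simp: zero_less_mult_iff mult_less_0_iff)
  have 1: "k < v k \<longleftrightarrow> k < zz v k \<or> (zz v k = k \<and> 1 \<le> kap v k)"
    using kap_pos[of k v] kap_neg[of v k] fx[of k] sgn(1)[of "kap v k"] by (smt (verit))
  have 2: "v k < k \<longleftrightarrow> zz v k < k \<or> (zz v k = k \<and> kap v k \<le> -1)"
    using kap_pos[of k v] kap_neg[of v k] fx[of k] sgn(2)[of "kap v k"] by (smt (verit))
  define x where "x = ?i k"
  have zx: "zz v x = k" using zi by (simp add: x_def)
  have "v (x - kap v x * N) = k" using v_back[OF as, of x] zx by simp
  then have ivk: "inv v k = x - kap v x * N" using aperm_inv_f(1)[OF assms] by metis
  have kn: "x < k \<Longrightarrow> 0 \<le> kap v x * N" "k < x \<Longrightarrow> kap v x * N \<le> 0"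
    using kap_pos[of x v] kap_neg[of v x] zx N3 by (auto simp: mult_le_0_iff zero_le_mult_iff) (smt (verit))+
  have 3: "inv v k < k \<longleftrightarrow> ?i k < k \<or> (zz v k = k \<and> 1 \<le> kap v k)"
    unfolding ivk x_def[symmetric] eqk[symmetric] using kn sgn(1)[of "kap v x"] by (smt (verit))
  have 4: "k < inv v k \<longleftrightarrow> k < ?i k \<or> (zz v k = k \<and> kap v k \<le> -1)"
    unfolding ivk x_def[symmetric] eqk[symmetric] using kn sgn(2)[of "kap v x"] by (smt (verit))
  show "rk v k k - rk v (k-1) (k-1) = (if k < zz v k then 1 else 0) - (if ?i k < k then 1 else 0)"
    using rk_diag_step[OF assms, of k] 1 3 eqk by auto
  have "inv (inv v) k = v k" using assms by (simp add: aperm_def inv_inv_eq)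
  then show "rk v k k - rk v (k-1) (k-1) = (if k < ?i k then 1 else 0) - (if zz v k < k then 1 else 0)"
    using rk_diag_step[OF aperm_inv[OF assms], of k] 2 4 eqk unfolding rk_diag_inv[OF assms] by auto
qed

text \<open>The arc that closes at \<open>k\<close> also covers \<open>k\<close>, so non-crossing
  forces the value at \<open>k\<close> below \<open>k\<close>.\<close>

lemma nc_excl: assumes "nc f" "inv f k < k" shows "f k < k"
proof -
  have f: "f (inv f k) = k" using assms by (simp add: nc_def bij_is_surj surj_f_inv_f)
  have "\<not> eqm (inv f k) k"
  proof
    assume "eqm (inv f k) k"
    moreover have "k < inv f k + N" using assms f unfolding nc_def by metis
    ultimately show False using eqm_close[of "inv f k" k] assms(2) N3 by simp
  qed
  moreover have "\<forall>x j. x < j \<longrightarrow> j \<le> f x \<longrightarrow> \<not> eqm x j \<longrightarrow> f j < f x" using assms(1) by (simp add: nc_def)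
  from this[rule_format, of "inv f k" k] have "k \<le> f (inv f k) \<Longrightarrow> \<not> eqm (inv f k) k \<Longrightarrow> f k < f (inv f k)" using assms(2) .
  ultimately have "f k < f (inv f k)" using f by simp
  then show ?thesis using f by simp
qed

text \<open>By \<open>zz_steps\<close> the indicator differences of \<open>zz v\<close> and of its
  inverse agree, and by \<open>nc_excl\<close> openings and closings are disjoint. Both maps thus
  have the same parentheses, and \<open>nc_unique\<close> identifies them on openings.\<close>

lemma zz_nci: assumes "spread v" "aperm v" shows "nci (zz v)"
proof -
  let ?z = "zz v" and ?i = "inv (zz v)"
  have nz: "nc ?z" and ni: "nc ?i" using zz_nc zz_inv_nc assms by auto
  have b: "bij ?z" using zz_bij assms(2) .
  have ii: "inv ?i = ?z" using b by (simp add: inv_inv_eq)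
  have zi: "?z (?i y) = y" "?i (?z y) = y" for y using b by (simp_all add: bij_is_surj bij_is_inj surj_f_inv_f)
  have x1: "\<not> (k < ?z k \<and> ?i k < k)" "\<not> (k < ?i k \<and> ?z k < k)" for k
    using nc_excl[OF nz, of k] nc_excl[OF ni, of k] unfolding ii by auto
  have e: "(if k < ?z k then 1 else 0) - (if ?i k < k then 1 else 0) = (if k < ?i k then 1 else 0 :: int) - (if ?z k < k then 1 else 0)" for k
    using zz_steps[OF assms(2), of k] by simp
  have "(k < ?z k \<longleftrightarrow> k < ?i k) \<and> (?i k < k \<longleftrightarrow> ?z k < k)" for k
    using x1[of k] e[of k] by (cases "k < ?z k"; cases "?i k < k"; cases "k < ?i k"; cases "?z k < k"; simp)
  then have s: "k < ?z k \<longleftrightarrow> k < ?i k" "?i k < k \<longleftrightarrow> ?z k < k" for k by blast+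
  have "?i x = ?z x" if "x < ?z x" for x
    by (rule nc_unique[OF nz ni]) (use s that in \<open>auto simp: ii\<close>)
  then have u: "?z (?z x) = x" if "x < ?z x" for x using that zi by metis
  have "?z (?z x) = x" for x
  proof -
    consider "x < ?z x" | "?z x < x" | "?z x = x" by linarith
    then show ?thesis
    proof cases
      case 2
      then have "?z x < ?i (?z x)" using zi by simp
      then have "?z x < ?z (?z x)" using s(1)[of "?z x"] by simp
      then have "?z (?z (?z x)) = ?z x" by (rule u)
      then show ?thesis using b by (auto simp: bij_def inj_def)
    qed (use u in auto)
  qed
  then show ?thesis unfolding nci_def using nz by auto
qed

section \<open>Full turns as translations\<close>

lemma tsh_bij: assumes "\<not> eqm p q" shows "bij (tsh m p q)"
proof (rule bij_betw_byWitness[where f' = "tsh (-m) p q"])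
  have "tsh (-m) p q (tsh m p q x) = x" for m x
    using assms by (simp add: tsh_def)
  from this[of m] this[of "-m"] show "\<forall>a\<in>UNIV. tsh (-m) p q (tsh m p q a) = a"
    "\<forall>a'\<in>UNIV. tsh m p q (tsh (-m) p q a') = a'" by auto
qed auto

lemma tsh_vals: "eqm x p \<Longrightarrow> tsh m p q x = x + m * N" "\<not> eqm p q \<Longrightarrow> eqm x q \<Longrightarrow> tsh m p q x = x - m * N"
  "\<not> eqm x p \<Longrightarrow> \<not> eqm x q \<Longrightarrow> tsh m p q x = x"
  by (auto simp: tsh_def) (metis eqm_sym eqm_trans)

lemma tsh_aperm: assumes "\<not> eqm p q" shows "aperm (tsh m p q)"
proof -
  have "psum (\<lambda>c. tsh m p q c - c) - psum (\<lambda>c. 0) = (tsh m p q p - p - 0) + (tsh m p q q - q - 0)"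
    by (rule psum_change2) (use assms in \<open>auto simp: ashift_periodic tsh_ashift tsh_vals periodic_def tsh_ashift[unfolded ashift_def]\<close>)
  then show ?thesis using assms by (simp add: aperm_def tsh_bij tsh_ashift tsh_vals psum_def)
qed

text \<open>The turns \<open>kap\<close> sum to zero over a period, as \<open>v\<close> and the
  involution \<open>zz v\<close> both have displacement sum zero. At most one class turns up and at
  most one turns down, so the two numbers of turns are opposite.\<close>

lemma spread_structure: assumes "spread v" "aperm v"
  shows "v = zz v \<or> (\<exists>M p q. 1 \<le> M \<and> p < q \<and> q < p + N \<and> v = tsh M p q \<circ> zz v \<and> zz v p \<le> p \<and> q \<le> zz v q)"
proof (cases "\<forall>c. kap v c = 0")
  case True
  then show ?thesis by (auto simp: zz_def fun_eq_iff)
next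
  case False
  let ?z = "zz v"
  have as: "ashift v" using assms(2) by (rule aperm_ashift)
  have nz: "nci ?z" using zz_nci assms by blast
  have az: "aperm ?z" using nci_aperm[OF nz] .
  have kp: "periodic (kap v)" using kap_periodic[OF as] .
  have "psum (\<lambda>c. v c - c) = psum (\<lambda>c. (?z c - c) + N * kap v c)"
    by (rule arg_cong[of _ _ psum]) (auto simp: zz_def fun_eq_iff)
  also have "\<dots> = psum (\<lambda>c. ?z c - c) + N * psum (kap v)"
    unfolding psum_add by (simp add: psum_def sum_distrib_left)
  finally have s0: "psum (kap v) = 0" using assms(2) az N3 by (simp add: aperm_def)
  have ex: "(\<exists>u. 1 \<le> kap v u) \<and> (\<exists>w. kap v w \<le> -1)"
  proof (rule ccontr)
    assume "\<not> ?thesis"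
    then have "(\<forall>u. \<not> 1 \<le> kap v u) \<or> (\<forall>u. \<not> kap v u \<le> -1)" by blast
    then have "(\<forall>u. kap v u \<le> 0) \<or> (\<forall>u. 0 \<le> kap v u)"
      by (metis add1_zle_eq add.left_neutral linorder_not_le zle_diff1_eq diff_0)
    then have "kap v c = 0" for c
    proof
      assume "\<forall>u. 0 \<le> kap v u" then show ?thesis using psum_ge[OF kp, of c] s0 by (simp add: order_antisym)
    next
      assume a: "\<forall>u. kap v u \<le> 0"
      have "- kap v c \<le> psum (\<lambda>c. - kap v c)"
        by (rule psum_ge) (use kp a in \<open>auto simp: periodic_def\<close>)
      also have "\<dots> = 0" using s0 by (simp add: psum_def sum_negf)
      finally show ?thesis using a by (simp add: order_antisym)
    qed
    then show False using False by blast
  qed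
  then obtain u w0 where u: "1 \<le> kap v u" and w0: "kap v w0 \<le> -1" by blast
  have uw: "\<not> eqm u w0" using periodic_eqm[OF kp, of u w0] u w0 by auto
  have k0: "kap v c = 0" if "\<not> eqm c u" "\<not> eqm c w0" for c
    using spread_long_pos[OF assms, of c u] spread_long_neg[OF assms, of c w0] that u w0 by force
  have "psum (kap v) - psum (\<lambda>c. 0) = (kap v u - 0) + (kap v w0 - 0)"
    by (rule psum_change2[OF kp _ uw]) (use k0 in \<open>auto simp: periodic_def\<close>)
  then have kw: "kap v w0 = - kap v u" using s0 by (simp add: psum_def)
  \<comment> \<open>\<open>tsh\<close> acts after \<open>zz v\<close>, so its two classes are the
    images under \<open>zz v\<close> of the turning classes.\<close>
  define M p where "M = kap v u" and "p = ?z u"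
  have "\<not> eqm p (?z w0)" using uw aperm_eqm_iff[OF az] by (simp add: p_def)
  then obtain t where t: "p < ?z w0 + t * N" "?z w0 + t * N < p + N" using shift_rep by blast
  define w q where "w = w0 + t * N" and "q = ?z w"
  have q: "q = ?z w0 + t * N" using ashift_shift[OF aperm_ashift[OF az]] by (simp add: q_def w_def)
  have kw': "kap v w = - M" using periodic_shift[OF kp] kw by (simp add: w_def M_def)
  have ew: "eqm c w0 \<longleftrightarrow> eqm c w" for c unfolding w_def by (metis eqm_shift(1,2) eqm_trans)
  have e: "eqm (?z c) p \<longleftrightarrow> eqm c u" "eqm (?z c) q \<longleftrightarrow> eqm c w" for c
    using aperm_eqm_iff[OF az] by (auto simp: p_def q_def)
  have pq: "\<not> eqm p q" using uw ew aperm_eqm_iff[OF az] by (simp add: p_def q_def)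
  have "v c = (tsh M p q \<circ> ?z) c" for c
  proof -
    have vc: "v c = ?z c + kap v c * N" by (simp add: zz_def)
    consider "eqm c u" | "eqm c w" | "\<not> eqm c u" "\<not> eqm c w" by blast
    then show ?thesis
    proof cases
      case 1
      then show ?thesis using vc periodic_eqm[OF kp 1] e(1)[of c] tsh_vals(1) by (simp add: M_def)
    next
      case 2
      then show ?thesis using vc periodic_eqm[OF kp 2] e(2)[of c] tsh_vals(2)[OF pq] kw' by simp
    next
      case 3
      then show ?thesis using vc k0[of c] ew e[of c] tsh_vals(3) by simp
    qed
  qed
  moreover have "?z p \<le> p"
  proof -
    have "u \<le> v u" using u kap_neg(1)[of v u] by linarith
    then have "u \<le> p" using kap_pos(2) by (simp add: p_def)
    then show ?thesis using nci_invol[OF nz] by (simp add: p_def)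
  qed
  moreover have "q \<le> ?z q"
  proof -
    have "\<not> w \<le> v w" using kw' u kap_pos(1)[of w v] unfolding M_def by linarith
    then have "v w \<le> w" by simp
    then have "q \<le> w" using kap_neg(2) by (simp add: q_def)
    then show ?thesis using nci_invol[OF nz] by (simp add: q_def)
  qed
  moreover have "1 \<le> M" using u by (simp add: M_def)
  ultimately show ?thesis using t q by (intro disjI2 exI[of _ M] exI[of _ p] exI[of _ q]) auto
qed

text \<open>Only the arcs of the classes of \<open>z p\<close> and \<open>z q\<close> change. The
  one reaching \<open>p\<close> comes from \<open>z p \<le> p\<close> and gains \<open>M\<close>
  full turns, each passing every class once; the one reaching \<open>q\<close> does not ascend
  before or after and is never counted.\<close>

lemma rk_tsh: assumes "nci z" "z p \<le> p" "q \<le> z q" "\<not> eqm p q" "0 \<le> M"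
  shows "rk (tsh M p q \<circ> z) k k = M + rk z k k"
proof -
  have az: "aperm z" using nci_aperm assms(1) .
  have e: "eqm (z c) p \<longleftrightarrow> eqm c (z p)" "eqm (z c) q \<longleftrightarrow> eqm c (z q)" for c
    using aperm_eqm_iff[OF az, of c "z p"] aperm_eqm_iff[OF az, of c "z q"] nci_invol[OF assms(1)] by auto
  have ne: "\<not> eqm (z p) (z q)" using aperm_eqm_iff[OF az] assms(4) by simp
  let ?f = "\<lambda>v c. max 0 (fl k (v c) - fl k c)"
  have "rk (tsh M p q \<circ> z) k k - rk z k k
    = (?f (tsh M p q \<circ> z) (z p) - ?f z (z p)) + (?f (tsh M p q \<circ> z) (z q) - ?f z (z q))"
    unfolding rk_def
    by (rule psum_change2[OF rk_periodic rk_periodic ne])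
      (use az e tsh_vals(3) in \<open>auto intro: ashift_comp[unfolded comp_def] tsh_ashift aperm_ashift\<close>)
  moreover have "fl k (z p) \<le> fl k p" "fl k q \<le> fl k (z q)" using assms by (auto intro: fl_mono)
  moreover have "(tsh M p q \<circ> z) (z p) = p + M * N" "(tsh M p q \<circ> z) (z q) = q - M * N"
    using nci_invol[OF assms(1)] tsh_vals(1,2) assms(4) by auto
  ultimately show ?thesis using nci_invol[OF assms(1)] assms(5) by simp
qed

text \<open>Where the diagonal rank \<open>f\<close> is below the degree, \<open>lmax_tight\<close>
  makes it drop by 1 towards one of the two neighbours. Walking on in that direction it keeps
  dropping until a tight position \<open>j\<close> is met, which must happen because
  \<open>f\<close> is nonnegative.\<close>

lemma lmax_lower: assumes "lmax dd v" "periodic dd"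
  shows "\<exists>j. dd j + \<bar>k - j\<bar> \<le> rk v k k"
proof -
  have av: "aperm v" and b: "\<And>k. rk v k k \<le> dd k" using assms unfolding lmax_def below_def by auto
  have sp: "spread v" using lmax_spread assms(1) by blast
  have as: "ashift v" using av by (rule aperm_ashift)
  have nz: "nci (zz v)" using zz_nci sp av by blast
  define f where "f k = rk v k k" for k
  have f0: "0 \<le> f k" for k by (simp add: f_def rk_nonneg)
  have st: "f k - f (k-1) = (if k < zz v k then 1 else 0) - (if zz v k < k then 1 else 0)" for k
    using zz_steps(1)[OF av, of k] unfolding nci_inv[OF nz] f_def .
  have H: "f k = f (k-1) + 1 \<or> f (k+1) = f k - 1" if "f k < dd k" for k
  proof (rule ccontr)
    assume n: "\<not> ?thesis"
    then have zk: "zz v k \<le> k" "k + 1 \<le> zz v (k+1)" using st[of k] st[of "k+1"] by (auto split: if_splits)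
    \<comment> \<open>If \<open>v\<close> goes up at \<open>k\<close>, then \<open>zz v\<close>
      fixes \<open>k\<close>, and \<open>v_back\<close> supplies an arc of \<open>v\<close> from
      further left that ends at \<open>k\<close>.\<close>
    have "\<exists>i. i \<le> k \<and> eqm i k \<and> max i (v i) = k"
    proof (cases "v k \<le> k")
      case True then show ?thesis by (intro exI[of _ k]) simp
    next
      case False
      then have "zz v k = k" "0 \<le> kap v k * N" using kap_pos[of k v] zk by auto
      then show ?thesis using v_back[OF as, of k] by (intro exI[of _ "k - kap v k * N"]) simp
    qed
    then obtain i where i: "i \<le> k" "eqm i k" "max i (v i) = k" by blast
    have "\<exists>j. k + 1 \<le> j \<and> eqm j (k+1) \<and> min j (v j) = k + 1"
    proof (cases "k + 1 \<le> v (k+1)")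
      case True then show ?thesis by (intro exI[of _ "k+1"]) simp
    next
      case False
      then have "zz v (k+1) = k+1" "0 \<le> - kap v (k+1) * N" using kap_neg[of v "k+1"] zk by (auto simp: mult_nonpos_nonneg)
      then show ?thesis using v_back[OF as, of "k+1"] by (intro exI[of _ "k + 1 - kap v (k+1) * N"]) simp
    qed
    then obtain j where j: "k + 1 \<le> j" "eqm j (k+1)" "min j (v j) = k + 1" by blast
    have "\<not> eqm i j" using i(2) j(2) not_eqm_succ(1)[of k] eqm_sym eqm_trans by blast
    moreover have "i < j" "v i < v j" using i j by linarith+
    ultimately have "rk v k k = dd k" using lmax_tight[OF assms _ _ _ i(3) j(3)] by blast
    then show False using that by (simp add: f_def)
  qed
  have R: "\<exists>j. dd j + \<bar>k - j\<bar> \<le> f k" if "f (k+1) = f k - 1" for k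
    using that
  proof (induction "nat (f k)" arbitrary: k rule: less_induct)
    case less
    show ?case
    proof (cases "f (k+1) < dd (k+1)")
      case True
      then have n: "f (k+1+1) = f (k+1) - 1" using H[OF True] less.prems by auto
      have "nat (f (k+1)) < nat (f k)" using less.prems f0[of "k+1"] by simp
      from less.hyps[OF this n] obtain j where "dd j + \<bar>k + 1 - j\<bar> \<le> f (k+1)" by blast
      then show ?thesis using less.prems by (intro exI[of _ j]) linarith
    next
      case False
      then show ?thesis using less.prems by (intro exI[of _ "k+1"]) simp
    qed
  qed
  have L: "\<exists>j. dd j + \<bar>k - j\<bar> \<le> f k" if "f k = f (k-1) + 1" for k
    using that
  proof (induction "nat (f k)" arbitrary: k rule: less_induct)
    case less
    show ?case
    proof (cases "f (k-1) < dd (k-1)")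
      case True
      then have n: "f (k-1) = f (k-1-1) + 1" using H[OF True] less.prems by auto
      have "nat (f (k-1)) < nat (f k)" using less.prems f0[of "k-1"] by simp
      from less.hyps[OF this n] obtain j where "dd j + \<bar>k - 1 - j\<bar> \<le> f (k-1)" by blast
      then show ?thesis using less.prems by (intro exI[of _ j]) linarith
    next
      case False
      then show ?thesis using less.prems by (intro exI[of _ "k-1"]) simp
    qed
  qed
  have "\<exists>j. dd j + \<bar>k - j\<bar> \<le> f k"
  proof (cases "f k < dd k")
    case True then show ?thesis using H[OF True] R L by blast
  next
    case False then show ?thesis by (intro exI[of _ k]) simp
  qed
  then show ?thesis by (simp add: f_def)
qed

lemma below_upper: assumes "below dd v" shows "rk v k k \<le> dd j + \<bar>k - j\<bar>"
  using rk_upper[of v k k j j] assms unfolding below_def by (smt (verit))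

text \<open>The rank function is already the largest possible, so an upward swap within the degree
  could not change it; by \<open>rk_ext\<close> it would not change \<open>v\<close>.\<close>

lemma zinv_lmax: assumes "zinv dd v" shows "lmax dd v"
  unfolding lmax_def
proof (intro conjI allI impI notI)
  show b: "below dd v" using assms by (simp add: zinv_def)
  fix i j assume ij: "i < j" "\<not> eqm i j" "v i < v j" "below dd (v \<circ> tr i j)"
  have av: "aperm v" "aperm (v \<circ> tr i j)" using b ij(4) by (auto simp: below_def)
  have "rk (v \<circ> tr i j) a l = rk v a l" for a l
  proof (rule order_antisym)
    show "rk v a l \<le> rk (v \<circ> tr i j) a l" using rk_swap_mono[OF aperm_ashift[OF av(1)] ij(2,1,3)] .
    obtain k where "dd k + max 0 (a - k) + max 0 (k - l) \<le> rk v a l" using assms unfolding zinv_def by blast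
    moreover have "rk (v \<circ> tr i j) k k \<le> dd k" using ij(4) by (simp add: below_def)
    ultimately show "rk (v \<circ> tr i j) a l \<le> rk v a l" using rk_upper[OF av(2), of a l k k] by linarith
  qed
  then have "v \<circ> tr i j = v" by (intro rk_ext) (use av aperm_ashift in auto)
  then have "v j = v i" by (metis comp_apply tr_vals(1))
  then show False using ij(3) by simp
qed

text \<open>Quantifying over all \<open>x\<close> includes all translates of the arcs. An arc may
  touch an end of the interval from outside or lie strictly inside; it may neither cross an end nor
  cover the interval.\<close>

definition compat :: "(int \<Rightarrow> int) \<Rightarrow> int \<Rightarrow> int \<Rightarrow> bool" where
  "compat z p q \<longleftrightarrow> p < q \<and> q < p + N \<and> (\<forall>x. x < z x \<longrightarrow> z x \<le> p \<or> q \<le> x \<or> (p < x \<and> z x < q))"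

lemma compat_ne: "compat z p q \<Longrightarrow> \<not> eqm p q" unfolding compat_def using eqm_close[of p q] N3 by auto

lemma nci_short: assumes "nci z" shows "z x < x + N" "x - N < z x"
proof -
  have s: "y < z y \<Longrightarrow> z y < y + N" for y using assms by (simp add: nci_def nc_def)
  show "z x < x + N" using s[of x] N3 by (cases "x < z x") auto
  show "x - N < z x" using s[of "z x"] nci_invol[OF assms, of x] N3 by (cases "z x < x") auto
qed

text \<open>Translates of the two long arcs of \<open>v\<close> end exactly at \<open>p\<close> and
  at \<open>q\<close> and act as walls. An arc of \<open>z\<close> passing over \<open>p\<close>
  would violate \<open>spread_N1\<close> against the first, one passing over \<open>q\<close> would
  violate \<open>spread_N2\<close> against the second.\<close>

lemma spread_compat:
  assumes sp: "spread v" and av: "aperm v" and z: "nci z" and v: "v = tsh M p q \<circ> z" and M: "1 \<le> M"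
    and pq: "p < q" "q < p + N" and zp: "z p \<le> p" and zq: "q \<le> z q"
  shows "compat z p q"
  unfolding compat_def
proof (intro conjI allI impI pq)
  fix x assume x: "x < z x"
  define y u w where "y = z x" and "u = z p" and "w = z q"
  have ne: "\<not> eqm p q" using eqm_close[of p q] pq N3 by auto
  have az: "aperm z" using nci_aperm z .
  have inv: "z (z c) = c" for c using nci_invol z .
  have zs: "z (c + t * N) = z c + t * N" for c t using ashift_shift[OF aperm_ashift[OF az]] .
  have vs: "v (c + t * N) = v c + t * N" for c t using ashift_shift[OF aperm_ashift[OF av]] .
  have y: "x < y" "y < x + N" "z y = x" using x inv nci_short[OF z] by (auto simp: y_def)
  have u: "u \<le> p" "p < u + N" "z u = p" using zp nci_short[OF z, of p] inv by (auto simp: u_def)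
  have w: "q \<le> w" "w < q + N" "z w = q" using zq nci_short[OF z, of q] inv by (auto simp: w_def)
  have MN: "N \<le> M * N" using M N3 mult_right_mono[of 1 M N] by simp
  have vu: "v (u - M * N) = p" using vs[of u "-M"] u(3) v tsh_vals(1)[of p p] by simp
  have vw: "v (w + M * N) = q" using vs[of w "M"] w(3) v tsh_vals(2)[OF ne, of q] by simp
  have eu: "eqm (z c) p \<longleftrightarrow> eqm c u" "eqm (z c) q \<longleftrightarrow> eqm c w" for c
    using aperm_eqm_iff[OF az, of c u] aperm_eqm_iff[OF az, of c w] u w by auto
  have vc: "v c = z c" if "\<not> eqm c u" "\<not> eqm c w" for c using that eu v tsh_vals(3) by simp
  have xw: "\<not> eqm x w"
  proof
    assume "eqm x w"
    then obtain t where "x = w + t * N" by (rule eqm_E)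
    then show False using zs[of w t] w y by (simp add: y_def)
  qed
  have yu: "\<not> eqm y u"
  proof
    assume "eqm y u"
    then obtain t where "y = u + t * N" by (rule eqm_E)
    then show False using zs[of u t] u y by simp
  qed
  have main: "p < x \<and> y < q" if c: "p < y" "x < q"
  proof
    show "p < x"
    proof (rule ccontr)
      assume "\<not> p < x"
      moreover have "x \<noteq> p" using u y c by (auto simp: y_def u_def)
      ultimately have xp: "x < p" by simp
      have xu: "\<not> eqm x u"
      proof
        assume "eqm x u"
        then have "eqm y p" using eu by (simp add: y_def)
        then show False using eqm_close[of y p] c y xp by simp
      qed
      have xu': "\<not> eqm (u - M * N) x" using xu by (metis eqm_shift(4) eqm_sym eqm_trans)
      show False
      proof (cases "u - M * N < x")
        case True
        then have "v x < p" using spread_N1[OF sp av True _ xu'] vu xp by simp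
        then show False using vc[OF xu xw] c by (simp add: y_def)
      next
        case False
        then show False using u y c MN by linarith
      qed
    qed
    show "y < q"
    proof (rule ccontr)
      assume "\<not> y < q"
      moreover have "y \<noteq> q" using w y c by (auto simp: w_def)
      ultimately have yq: "q < y" by simp
      have yw: "\<not> eqm y w"
      proof
        assume "eqm y w"
        then have "eqm x q" using eu(2)[of y] y by simp
        then show False using eqm_close[of x q] c y yq by simp
      qed
      have yw': "\<not> eqm y (w + M * N)" using yw by (metis eqm_shift(1) eqm_trans)
      have "w + M * N < y" by (rule spread_N2[OF sp _ _ yw']) (use vc[OF yu yw] vw y c yq in auto)
      then show False using y c w MN by linarith
    qed
  qed
  then show "z x \<le> p \<or> q \<le> x \<or> (p < x \<and> z x < q)" unfolding y_def by linarith
qed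

lemma compat_ends: assumes "compat z p q" "nci z" shows "z p \<le> p" "q \<le> z q"
proof -
  show "z p \<le> p" using assms(1) unfolding compat_def by (meson linorder_not_less order_less_irrefl order_less_le_trans order.trans)
  show "q \<le> z q"
  proof (rule ccontr)
    assume "\<not> q \<le> z q"
    then have "z q < z (z q)" using nci_invol[OF assms(2)] by simp
    then show False using assms(1) nci_invol[OF assms(2), of q] \<open>\<not> q \<le> z q\<close> unfolding compat_def by force
  qed
qed

text \<open>Against each of the other \<open>N - 2\<close> classes both moved classes gain
  \<open>m\<close>, and against each other they gain \<open>2 * m\<close>; over ordered pairs this
  makes \<open>4 * m * (N - 1)\<close>, twice the gain in length. Compatibility gives every
  difference the sign for which the translation enlarges the absolute value.\<close>

lemma Lg_tsh: assumes c: "compat z p q" and z: "nci z" and m: "0 \<le> m"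
  shows "Lg (tsh m p q \<circ> z) = Lg z + 4 * m * (N - 1)"
proof -
  let ?v = "tsh m p q \<circ> z"
  define u w where "u = z p" and "w = z q"
  have pq: "p < q" "q < p + N" and ar: "\<And>x. x < z x \<Longrightarrow> z x \<le> p \<or> q \<le> x \<or> (p < x \<and> z x < q)"
    using c unfolding compat_def by auto
  have ne: "\<not> eqm p q" using compat_ne c .
  have az: "aperm z" using nci_aperm z .
  have av: "aperm ?v" using aperm_comp tsh_aperm[OF ne] az by blast
  have inv: "z (z x) = x" for x using nci_invol z .
  have zsh: "z (x - N) = z x - N" "z (x + N) = z x + N" for x
    using ashift_shift[OF aperm_ashift[OF az], of x "-1"] ashift_shift[OF aperm_ashift[OF az], of x 1] by simp_all
  have u: "u \<le> p" "p < u + N" "z u = p" using compat_ends(1)[OF c z] nci_short[OF z, of p] inv by (auto simp: u_def)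
  have w: "q \<le> w" "w < q + N" "z w = q" using compat_ends(2)[OF c z] nci_short[OF z, of q] inv by (auto simp: w_def)
  have zinj: "z a = z b \<longleftrightarrow> a = b" for a b using aperm_inj az by blast
  \<comment> \<open>Otherwise the translate \<open>x - N\<close> would start an arc that passes over
    \<open>p\<close>.\<close>
  have up: "z x < p + N" if "u < x" "x < u + N" for x
  proof (rule ccontr)
    assume "\<not> z x < p + N"
    moreover have "z x \<noteq> z (u + N)" using zinj that by simp
    ultimately have "p < z (x - N)" using zsh u by simp
    moreover have "x - N < u" using that by simp
    ultimately show False using ar[of "x - N"] u pq by linarith
  qed
  have lo: "q < z x" if "w < x" "x < w + N" for x
  proof (rule ccontr)
    assume "\<not> q < z x"
    moreover have "z x \<noteq> z w" using zinj that by simp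
    ultimately have "z x < q" using w by simp
    then show False using ar[of "z x"] inv[of x] w pq that by linarith
  qed
  have eu: "eqm (z x) p \<longleftrightarrow> eqm x u" "eqm (z x) q \<longleftrightarrow> eqm x w" for x
    using aperm_eqm_iff[OF az, of x u] aperm_eqm_iff[OF az, of x w] u w by auto
  have uw: "\<not> eqm u w" using ne aperm_eqm_iff[OF az] by (simp add: u_def w_def)
  have vx: "?v x = z x" if "\<not> eqm x u" "\<not> eqm x w" for x using that eu tsh_vals(3) by simp
  have vu: "?v u = p + m * N" using u tsh_vals(1) by simp
  have vw: "?v x = z x - m * N" if "eqm x w" for x using that eu tsh_vals(2)[OF ne] by simp
  have shift: "gg f a (x + t * N) = gg f a x" if "ashift f" for f a x t
    using gg_shift(2)[OF that] periodic_shift[of "gg f a" x t] unfolding periodic_def by blast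
  have G: "(z x - p) div N \<le> 0" "(x - u) div N = 0" if "u < x" "x < u + N" for x
  proof -
    have "(z x - p) div N < 1" using up[OF that] N3 fl_less_iff[of 0 "z x - p + 1" 1] by (simp add: fl_def)
    then show "(z x - p) div N \<le> 0" by simp
    show "(x - u) div N = 0" using that by simp
  qed
  have gu: "gg ?v u x - gg z u x = m" if nx: "\<not> eqm x u" "\<not> eqm x w" for x
  proof -
    obtain t where t: "u < x + t * N" "x + t * N < u + N" using shift_rep[of u x] nx eqm_sym by blast
    define x' where "x' = x + t * N"
    have e: "?v x' = z x'" by (rule vx) (use nx in \<open>auto simp: x'_def\<close>)
    have "(z x' - (p + m * N)) div N = (z x' - p) div N - m"
      using div_mult_self1[of N "z x' - p" "-m"] N3 by (simp add: algebra_simps)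
    then have "gg ?v u x' - gg z u x' = m"
      unfolding gg_def e vu u(3) using G[of x'] t m by (simp add: x'_def)
    then show ?thesis using shift[OF aperm_ashift[OF av]] shift[OF aperm_ashift[OF az]] by (simp add: x'_def)
  qed
  have gw: "gg ?v w x - gg z w x = m" if nx: "\<not> eqm x u" "\<not> eqm x w" for x
  proof -
    obtain t where t: "w < x + t * N" "x + t * N < w + N" using shift_rep[of w x] nx eqm_sym by blast
    define x' where "x' = x + t * N"
    have e: "?v x' = z x'" by (rule vx) (use nx in \<open>auto simp: x'_def\<close>)
    have "(z x' - (q - m * N)) div N = (z x' - q) div N + m"
      using div_mult_self1[of N "z x' - q" m] N3 by (simp add: algebra_simps)
    moreover have "0 \<le> (z x' - q) div N" using lo[of x'] t N3 by (simp add: x'_def pos_imp_zdiv_nonneg_iff)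
    moreover have "(x' - w) div N = 0" using t by (simp add: x'_def)
    ultimately have "gg ?v w x' - gg z w x' = m"
      unfolding gg_def e vw[OF eqm_refl] w(3) using m by simp
    then show ?thesis using shift[OF aperm_ashift[OF av]] shift[OF aperm_ashift[OF az]] by (simp add: x'_def)
  qed
  have guw: "gg ?v u w - gg z u w = 2 * m"
  proof -
    obtain t where t: "u < w + t * N" "w + t * N < u + N" using shift_rep[OF uw] by blast
    define x' where "x' = w + t * N"
    have e: "?v x' = z x' - m * N" by (rule vw) (simp add: x'_def)
    have "(z x' - m * N - (p + m * N)) div N = (z x' - p) div N - 2 * m"
      using div_mult_self1[of N "z x' - p" "- 2 * m"] N3 by (simp add: algebra_simps)
    then have "gg ?v u x' - gg z u x' = 2 * m"
      unfolding gg_def e vu u(3) using G[of x'] t m by (simp add: x'_def)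
    then show ?thesis using shift[OF aperm_ashift[OF av]] shift[OF aperm_ashift[OF az]] by (simp add: x'_def)
  qed
  let ?h = "\<lambda>x. if eqm x u \<or> eqm x w then 0 else gg ?v u x - gg z u x + (gg ?v w x - gg z w x)"
  have "?h = (\<lambda>x. if eqm x u \<or> eqm x w then 0 else 2 * m)" using gu gw by (auto simp: fun_eq_iff)
  moreover have "psum (\<lambda>x. 2 * m) - psum (\<lambda>x. if eqm x u \<or> eqm x w then 0 else 2 * m) = (2 * m - 0) + (2 * m - 0)"
    using psum_change2[of "\<lambda>x. 2 * m" "\<lambda>x. if eqm x u \<or> eqm x w then 0 else 2 * m" u w] uw
    by (simp add: periodic_def)
  moreover have "psum (\<lambda>x. 2 * m) = N * (2 * m)" by (simp add: psum_def)
  ultimately have h: "psum ?h = 2 * m * N - 4 * m" by (simp add: algebra_simps)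
  have "Lg ?v - Lg z = 2 * gg ?v u w - 2 * gg z u w + 2 * psum ?h"
    by (rule Lg_change[OF az av uw]) (use vx in auto)
  then have "Lg ?v - Lg z = 2 * (2 * m) + 2 * (2 * m * N - 4 * m)" using guw h by simp
  then show ?thesis by (simp add: algebra_simps)
qed

text \<open>By \<open>rk_tsh\<close> a translation part would raise the rank at every position by at
  least 1, but at \<open>k0\<close> the degree is 0.\<close>

lemma zinv_nci: assumes "zinv dd z" "dd k0 = 0" shows "nci z"
proof -
  have l: "lmax dd z" using zinv_lmax assms(1) .
  have sp: "spread z" using lmax_spread l .
  have b: "aperm z" "\<And>k. rk z k k \<le> dd k" using assms(1) by (auto simp: zinv_def below_def)
  have nz: "nci (zz z)" using zz_nci sp b by blast
  have "z = zz z"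
  proof (rule ccontr)
    assume "z \<noteq> zz z"
    then obtain M p q where M: "1 \<le> M" "p < q" "q < p + N" "z = tsh M p q \<circ> zz z" "zz z p \<le> p" "q \<le> zz z q"
      using spread_structure[OF sp b(1)] by blast
    have "\<not> eqm p q" using eqm_close[of p q] M N3 by auto
    then have "rk (tsh M p q \<circ> zz z) k0 k0 = M + rk (zz z) k0 k0" using rk_tsh[OF nz M(5,6)] M(1) by simp
    then have "rk z k0 k0 = M + rk (zz z) k0 k0" using M(4) by simp
    then show False using b(2)[of k0] assms(2) M(1) rk_nonneg[of "zz z" k0 k0] by simp
  qed
  then show ?thesis using nz by simp
qed

text \<open>The diagonal ranks of \<open>z\<close> and \<open>v\<close> are both pinned to the
  minimum over \<open>j\<close> of \<open>d0 j + \<bar>k - j\<bar>\<close>, with \<open>m\<close>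
  added for \<open>v\<close>. Equal increments give \<open>zz v = z\<close>, and the constant
  difference \<open>m\<close> is then the number of full turns.\<close>

lemma lmax_classify:
  assumes z: "zinv d0 z" "periodic d0" "d0 k0 = 0" and m: "1 \<le> m" and v: "lmax (\<lambda>k. d0 k + m) v"
  shows "\<exists>p q. compat z p q \<and> v = tsh m p q \<circ> z"
proof -
  have nz: "nci z" using zinv_nci z by blast
  have sp: "spread v" using lmax_spread v .
  have b: "aperm v" "below (\<lambda>k. d0 k + m) v" using v by (auto simp: lmax_def below_def)
  have bz: "below d0 z" "aperm z" using z by (auto simp: zinv_def below_def)
  have nv: "nci (zz v)" using zz_nci sp b by blast
  have per: "periodic (\<lambda>k. d0 k + m)" using z(2) by (simp add: periodic_def)
  have r: "rk v k k = rk z k k + m" for k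
  proof (rule order_antisym)
    obtain j where "d0 j + max 0 (k - j) + max 0 (j - k) \<le> rk z k k" using z(1) unfolding zinv_def by blast
    then show "rk v k k \<le> rk z k k + m" using below_upper[OF b(2), of k j] by linarith
    obtain j where "d0 j + m + \<bar>k - j\<bar> \<le> rk v k k" using lmax_lower[OF v per] by blast
    then show "rk z k k + m \<le> rk v k k" using below_upper[OF bz(1), of k j] by linarith
  qed
  have e: "zz v = z"
  proof (rule nci_eqI[OF nv nz])
    fix k
    have "rk z k k - rk z (k-1) (k-1) = (if k < z k then 1 else 0) - (if z k < k then 1 else 0)"
      using rk_diag_step[OF bz(2), of k] unfolding nci_inv[OF nz] by simp
    then show "(if k < zz v k then 1 else 0) - (if zz v k < k then 1 else 0) = (if k < z k then 1 else 0 :: int) - (if z k < k then 1 else 0)"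
      using zz_steps(1)[OF b(1), of k] r[of k] r[of "k-1"] unfolding nci_inv[OF nv] by simp
  qed
  have "v \<noteq> z" using r[of 0] m by auto
  then obtain M p q where M: "1 \<le> M" "p < q" "q < p + N" "v = tsh M p q \<circ> z" "z p \<le> p" "q \<le> z q"
    using spread_structure[OF sp b(1)] unfolding e by blast
  have "\<not> eqm p q" using eqm_close[of p q] M N3 by auto
  then have "rk (tsh M p q \<circ> z) 0 0 = M + rk z 0 0" using rk_tsh[OF nz M(5,6)] M(1) by simp
  then have "M = m" using r[of 0] unfolding M(4)[symmetric] by simp
  then show ?thesis using M spread_compat[OF sp b(1) nz M(4,1,2,3,5,6)] by blast
qed

subsection \<open>Compatible roots\<close>

text \<open>Transpositions at two such pairs move different classes, so their product simply carries
  the arcs of both.\<close>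

definition disj_res :: "int \<times> int \<Rightarrow> int \<times> int \<Rightarrow> bool" where
  "disj_res a b \<longleftrightarrow> \<not> eqm (fst a) (fst b) \<and> \<not> eqm (fst a) (snd b) \<and> \<not> eqm (snd a) (fst b) \<and> \<not> eqm (snd a) (snd b)"

lemma supp_ends: assumes "x < y"
  shows "nat (x mod N) \<in> supp (root x y)" "nat ((y - 1) mod N) \<in> supp (root x y)"
proof -
  have "fl x y - fl x x \<ge> 1" using fl_nonneg_iff[of x y] assms by (simp add: fl_self)
  then show "nat (x mod N) \<in> supp (root x y)" using root_eq_fl[of x y x] by (simp add: supp_def)
  have "fl (y - 1) y - fl (y - 1) x \<ge> 1" using fl_neg_iff[of "y - 1" x] fl_nonneg_iff[of "y - 1" y] assms by simp
  then show "nat ((y - 1) mod N) \<in> supp (root x y)" using root_eq_fl[of x y "y - 1"] by (simp add: supp_def)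
qed

lemma adjacent_mod: "adjacent n (nat ((a - 1) mod N)) (nat (a mod N))"
proof -
  have "int ((nat ((a - 1) mod N) + 1) mod n) = ((a - 1) mod N + 1) mod N"
    using N3 by (simp add: zmod_int add.commute)
  also have "\<dots> = a mod N" by (simp add: mod_add_left_eq)
  finally have "nat (a mod N) = (nat ((a - 1) mod N) + 1) mod n" by linarith
  then show ?thesis unfolding adjacent_def by blast
qed

lemma mod_eqm: "eqm x y \<Longrightarrow> x mod N = y mod N" by (simp add: eqm_iff_mod)

text \<open>The support of \<open>root x y\<close> contains the classes of \<open>x\<close> and
  \<open>y - 1\<close>: disjointness separates like ends, and the lack of adjacency separates
  \<open>y\<close> from \<open>x'\<close> and \<open>x\<close> from \<open>y'\<close>.\<close>

lemma disconnected_disj: assumes "x < y" "x' < y'" "disconnected n (root x y) (root x' y')"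
  shows "disj_res (x, y) (x', y')"
proof -
  note s = supp_ends[OF assms(1)] supp_ends[OF assms(2)]
  have d: "k \<notin> supp (root x' y')" if "k \<in> supp (root x y)" for k
    using assms(3) that unfolding disconnected_def by blast
  have a: "\<not> adjacent n k l" if "k \<in> supp (root x y)" "l \<in> supp (root x' y')" for k l
    using assms(3) that unfolding disconnected_def by blast
  have sy: "adjacent n k l \<longleftrightarrow> adjacent n l k" for k l unfolding adjacent_def by blast
  have "\<not> eqm x x'" using d s mod_eqm by metis
  moreover have "\<not> eqm y y'"
  proof
    assume "eqm y y'"
    then have "eqm (y - 1) (y' - 1)" unfolding eqm_def by simp
    then show False using d s mod_eqm by metis
  qed
  moreover have "\<not> eqm x y'" using a[OF s(1) s(4)] adjacent_mod[of y'] sy mod_eqm by metis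
  moreover have "\<not> eqm y x'" using a[OF s(2) s(3)] adjacent_mod[of y] mod_eqm by metis
  ultimately show ?thesis by (simp add: disj_res_def)
qed

text \<open>The form is a sum of four signed indicators. Two of opposite sign never hold together,
  because the ends of each root are incongruent, so nothing can cancel.\<close>

lemma perp_disj: assumes "\<not> eqm x y" "\<not> eqm x' y'" "perp n (root x y) (root x' y')"
  shows "disj_res (x, y) (x', y')"
proof -
  have e: "dl x' x - dl y' x - dl x' y + dl y' y = 0" using assms(3) unfolding perp_def form_root_root .
  have t: "\<not> (eqm x x' \<and> eqm x y')" "\<not> (eqm y x' \<and> eqm y y')" "\<not> (eqm x x' \<and> eqm y x')" "\<not> (eqm x y' \<and> eqm y y')"
    using assms(1,2) eqm_sym eqm_trans by blast+
  show ?thesis using e t unfolding dl_def disj_res_def by (auto split: if_splits)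
qed

definition pt :: "(int \<times> int) list \<Rightarrow> int \<Rightarrow> int" where
  "pt ps = foldr (\<circ>) (map (\<lambda>(x, y). tr x y) ps) id"

lemma pt_simps: "pt [] = id" "pt ((x, y) # ps) = tr x y \<circ> pt ps" by (simp_all add: pt_def)

lemma pt_refl: assumes "\<And>x y. (x, y) \<in> set ps \<Longrightarrow> \<not> eqm x y"
  shows "refl_prod n (map (\<lambda>(x, y). root x y) ps) = act (pt ps) \<and> aperm (pt ps)"
  using assms
proof (induction ps)
  case Nil
  show ?case unfolding pt_simps act_id by (simp add: refl_prod_def aperm_id[unfolded id_def] id_def)
next
  case (Cons a ps)
  obtain x y where a: "a = (x, y)" by force
  have ne: "\<not> eqm x y" using Cons.prems a by auto
  have IH: "refl_prod n (map (\<lambda>(x, y). root x y) ps) = act (pt ps)" "aperm (pt ps)"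
    using Cons.IH Cons.prems by auto
  have "refl_prod n (map (\<lambda>(x, y). root x y) (a # ps)) = refl n (root x y) \<circ> refl_prod n (map (\<lambda>(x, y). root x y) ps)"
    by (simp add: refl_prod_def a)
  also have "\<dots> = act (pt (a # ps))" unfolding IH refl_root[OF ne] act_comp[OF tr_ashift] a pt_simps ..
  finally show ?case unfolding a pt_simps using aperm_comp[OF tr_aperm[OF ne] IH(2)] by blast
qed

lemma pt_fix: "(\<And>x y. (x, y) \<in> set ps \<Longrightarrow> \<not> eqm c x \<and> \<not> eqm c y) \<Longrightarrow> pt ps c = c"
proof (induction ps)
  case Nil show ?case unfolding pt_simps by simp
next
  case (Cons a ps)
  obtain x y where a: "a = (x, y)" by force
  have "pt ps c = c" using Cons.IH Cons.prems by auto
  then show ?case unfolding a pt_simps using Cons.prems[of x y] a by (simp add: tr_vals)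
qed

lemma pt_val: "sorted_wrt disj_res ps \<Longrightarrow> (\<And>x y. (x, y) \<in> set ps \<Longrightarrow> \<not> eqm x y) \<Longrightarrow>
  (x, y) \<in> set ps \<Longrightarrow> pt ps x = y \<and> pt ps y = x"
proof (induction ps)
  case Nil then show ?case by simp
next
  case (Cons a ps)
  obtain x' y' where a: "a = (x', y')" by force
  have dj: "disj_res (x', y') b" if "b \<in> set ps" for b using Cons.prems(1) that by (simp add: a)
  show ?case
  proof (cases "(x, y) \<in> set ps")
    case True
    then have "pt ps x = y \<and> pt ps y = x" using Cons.IH Cons.prems by auto
    moreover have "\<not> eqm x x'" "\<not> eqm x y'" "\<not> eqm y x'" "\<not> eqm y y'"
      using dj[OF True] eqm_sym by (auto simp: disj_res_def)
    ultimately show ?thesis unfolding a pt_simps by (simp add: tr_vals)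
  next
    case False
    then have [simp]: "x' = x" "y' = y" using Cons.prems(3) a by auto
    have "pt ps x = x" "pt ps y = y" by (rule pt_fix, use dj in \<open>force simp: disj_res_def\<close>)+
    moreover have "\<not> eqm x y" using Cons.prems(2)[of x y] a by simp
    ultimately show ?thesis unfolding a pt_simps by (simp add: tr_vals)
  qed
qed

text \<open>The factors transpose disjoint classes, so the ascending arcs of the product are theirs.
  The set of roots is thus read off from \<open>z\<close>, whatever factorisation is given.\<close>

lemma gs_arcs: assumes ad: "admissible n gs" and z: "aperm z" "refl_prod n gs = act z"
  shows "set gs = {root x (z x) | x. x < z x}"
proof -
  have "\<forall>g\<in>set gs. \<exists>p. g = root (fst p) (snd p) \<and> fst p < snd p \<and> \<not> eqm (fst p) (snd p)"
    using ad unfolding admissible_def pos_real_roots_eq by fastforce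
  then obtain P where P: "\<And>g. g \<in> set gs \<Longrightarrow> g = root (fst (P g)) (snd (P g)) \<and> fst (P g) < snd (P g) \<and> \<not> eqm (fst (P g)) (snd (P g))"
    by metis
  define ps where "ps = map P gs"
  have gs: "gs = map (\<lambda>(x, y). root x y) ps"
    unfolding ps_def map_map by (rule map_idI[symmetric]) (use P in \<open>simp add: case_prod_beta\<close>)
  have ps: "x < y" "\<not> eqm x y" if "(x, y) \<in> set ps" for x y
    using that P unfolding ps_def by (auto, (metis fst_conv snd_conv)+)
  have "sorted_wrt disj_res ps" unfolding sorted_wrt_iff_nth_less
  proof (intro allI impI)
    fix i j assume ij: "i < j" "j < length ps"
    obtain x y x' y' where e: "ps ! i = (x, y)" "ps ! j = (x', y')" by (meson surj_pair)
    then have m: "(x, y) \<in> set ps" "(x', y') \<in> set ps" using ij nth_mem by (metis order.strict_trans)+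
    have g: "gs ! i = root x y" "gs ! j = root x' y'" using e ij unfolding gs by auto
    have "disconnected n (root x y) (root x' y') \<or> perp n (root x y) (root x' y')"
      using ad ij g unfolding admissible_def by (metis gs length_map nat_neq_iff order.strict_trans)
    then show "disj_res (ps ! i) (ps ! j)"
      unfolding e using disconnected_disj perp_disj ps m by blast
  qed
  then have val: "pt ps x = y \<and> pt ps y = x" if "(x, y) \<in> set ps" for x y using pt_val ps that by blast
  have "act z = act (pt ps)" "aperm (pt ps)" using pt_refl[of ps] ps z(2) unfolding gs by auto
  then have zp: "z = pt ps" using act_inj z(1) by blast
  have zs: "z (c + t * N) = z c + t * N" for c t using ashift_shift[OF aperm_ashift[OF z(1)]] .
  show ?thesis
  proof (intro equalityI subsetI)
    fix g assume "g \<in> set gs"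
    then obtain x y where "(x, y) \<in> set ps" "g = root x y" unfolding gs by auto
    then show "g \<in> {root x (z x) | x. x < z x}" using val ps zp by (intro CollectI exI[of _ x]) auto
  next
    fix g assume "g \<in> {root x (z x) | x. x < z x}"
    then obtain x where x: "g = root x (z x)" "x < z x" by blast
    \<comment> \<open>A moved point lies in the class of an end of some factor; it is a lower end,
      as upper ends move down.\<close>
    obtain a b where ab: "(a, b) \<in> set ps" "eqm x a \<or> eqm x b"
      using pt_fix[of ps x] x(2) zp by (metis less_irrefl)
    have "\<not> eqm x b"
    proof
      assume "eqm x b"
      then obtain t where "x = b + t * N" by (rule eqm_E)
      then show False using zs[of b t] val[OF ab(1)] ps(1)[OF ab(1)] zp x(2) by simp
    qed
    then obtain t where t: "x = a + t * N" using ab(2) eqm_E by blast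
    then have "g = root a b" using zs[of a t] val[OF ab(1)] zp x(1) by simp
    then show "g \<in> set gs" unfolding gs using ab(1) by force
  qed
qed

lemma supp_root: assumes "p \<le> q" "q \<le> p + N"
  shows "nat (k mod N) \<in> supp (root p q) \<longleftrightarrow> (\<exists>t. p + t * N \<le> k \<and> k < q + t * N)"
  using arc_fl[OF assms, of k] root_eq_fl[of p q k] by (simp add: supp_def)

lemma root_less: assumes "p \<le> x" "x < y" "y \<le> q" "y - x < q - p" shows "root x y < root p q"
proof -
  have "root x y \<le> root p q"
    unfolding le_fun_def
  proof
    fix k
    have "fl (int k) y \<le> fl (int k) q" "fl (int k) p \<le> fl (int k) x" using assms by (auto intro: fl_mono)
    then show "root x y k \<le> root p q k" by (simp add: root_def)
  qed
  moreover have "root x y \<noteq> root p q" using root_height[of x y] root_height[of p q] assms(4) by auto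
  ultimately show ?thesis by simp
qed

lemma root_less_cc: assumes "p < q" shows "root p q < cc n \<longleftrightarrow> q < p + N"
proof -
  have c: "cc n = root p (p + N)" using root_full[of p 1] by (simp add: scale_def)
  show ?thesis
  proof
    assume l: "root p q < cc n"
    show "q < p + N"
    proof (rule ccontr)
      assume n: "\<not> q < p + N"
      have "cc n \<le> root p q" unfolding c le_fun_def
      proof
        fix k
        have "fl (int k) (p + N) \<le> fl (int k) q" using n by (intro fl_mono) simp
        then show "root p (p + N) k \<le> root p q k" by (auto simp: root_def simp del: fl_shift1)
      qed
      then show False using l by simp
    qed
  next
    assume "q < p + N"
    then show "root p q < cc n" unfolding c using assms by (intro root_less) auto
  qed
qed

text \<open>Disjoint supports mean that no translates of the two intervals overlap; otherwise
  containment puts the arc within the interval, and orthogonality keeps its ends off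
  \<open>p\<close> and \<open>q\<close>. Lying below the imaginary root is
  \<open>q < p + N\<close>.\<close>

lemma compat_roots_eq: assumes gs: "set gs = {root x (z x) | x. x < z x}" and z: "nci z"
  shows "compat_roots n gs = {root p q | p q. compat z p q}"
proof -
  have zs: "z (c + t * N) = z c + t * N" for c t using ashift_shift z unfolding nci_def nc_def by blast
  show ?thesis
  proof (intro equalityI subsetI)
    fix b assume b: "b \<in> compat_roots n gs"
    then obtain p q where pq: "b = root p q" "p < q" "\<not> eqm p q"
      unfolding compat_roots_def pos_real_roots_eq by blast
    have len: "q < p + N" using b root_less_cc[OF pq(2)] unfolding compat_roots_def pq(1) by blast
    have "p < x \<and> z x < q" if x: "x < z x" "p < z x" "x < q" for x
    proof -
      define y where "y = z x"
      have ys: "y < x + N" using nci_short[OF z] by (simp add: y_def)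
      have xy: "\<not> eqm x y" using eqm_close[of x y] x ys N3 by (auto simp: y_def)
      have "root x y \<in> set gs" unfolding gs using x y_def by blast
      then have c: "supp (root p q) \<inter> supp (root x y) = {} \<or> (root x y < root p q \<and> perp n (root p q) (root x y))"
        using b unfolding compat_roots_def pq(1) by blast
      \<comment> \<open>Both intervals contain \<open>max p x\<close>, which rules out disjoint
        supports.\<close>
      have "nat (max p x mod N) \<in> supp (root p q) \<inter> supp (root x y)"
        using supp_root[of p q "max p x"] supp_root[of x y "max p x"] x pq len ys
        by (auto simp: y_def intro!: exI[of _ 0])
      then have l: "root x y \<le> root p q" and pe: "perp n (root p q) (root x y)" using c by auto
      have le: "fl k y - fl k x \<le> fl k q - fl k p" for k
        using l[unfolded le_fun_def, rule_format, of "nat (k mod N)"] unfolding root_eq_fl .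
      have one: "fl k y - fl k x = 1" if "x \<le> k" "k < y" for k
        using arc_fl[of x y k] that x ys by (auto simp: y_def intro!: exI[of _ 0])
      have "p \<le> x" using one[of "p-1"] le[of "p-1"] arc_end(2)[OF pq(2) len] x by (force simp: y_def)
      moreover have "y \<le> q" using one[of q] le[of q] arc_end(1)[OF pq(2) len] x by (force simp: y_def)
      moreover have "disj_res (p, q) (x, y)" using perp_disj pq(3) xy pe by blast
      then have "x \<noteq> p" "y \<noteq> q" by (auto simp: disj_res_def)
      ultimately show ?thesis by (simp add: y_def)
    qed
    then have "compat z p q" unfolding compat_def using pq(2) len by (meson linorder_not_less)
    then show "b \<in> {root p q | p q. compat z p q}" using pq(1) by blast
  next
    fix b assume "b \<in> {root p q | p q. compat z p q}"
    then obtain p q where b: "b = root p q" and c: "compat z p q" by blast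
    have pq: "p < q" "q < p + N" using c by (auto simp: compat_def)
    have ne: "\<not> eqm p q" using compat_ne c .
    have "supp (root p q) \<inter> supp (root x (z x)) = {} \<or> (root x (z x) < root p q \<and> perp n (root p q) (root x (z x)))"
      if x: "x < z x" for x
    proof (cases "\<exists>t. p < x + t * N \<and> z x + t * N < q")
      case True
      then obtain t where t: "p < x + t * N" "z x + t * N < q" by blast
      define x' y' where "x' = x + t * N" and "y' = z x + t * N"
      have e: "root x (z x) = root x' y'" by (simp add: x'_def y'_def)
      have o: "p < x'" "x' < y'" "y' < q" using t x by (auto simp: x'_def y'_def)
      have "\<not> eqm p x'" "\<not> eqm p y'" "\<not> eqm q x'" "\<not> eqm q y'"
        using eqm_close[of p x'] eqm_close[of p y'] eqm_close[of q x'] eqm_close[of q y'] o pq by auto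
      then have "perp n (root p q) (root x' y')" unfolding perp_def form_root_root by (simp add: dl_def)
      moreover have "root x' y' < root p q" using o by (intro root_less) auto
      ultimately show ?thesis unfolding e by blast
    next
      case False
      have f: "z x + t * N \<le> p \<or> q \<le> x + t * N" for t
        using c False x zs[of x t] unfolding compat_def by (metis add_less_cancel_right)
      have "k \<notin> supp (root x (z x))" if k: "k \<in> supp (root p q)" for k
      proof
        assume k': "k \<in> supp (root x (z x))"
        have "k < n" using k by (auto simp: supp_def root_def split: if_splits)
        then have kk: "nat (int k mod N) = k" by simp
        obtain a where a: "p + a * N \<le> int k" "int k < q + a * N" using supp_root[of p q "int k"] k pq unfolding kk by auto
        obtain s where s: "x + s * N \<le> int k" "int k < z x + s * N"
          using supp_root[of x "z x" "int k"] k' x nci_short(1)[OF z, of x] unfolding kk by auto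
        \<comment> \<open>The common class may be met in different translates of the two intervals;
          only their relative shift \<open>s - a\<close> matters.\<close>
        have "(s - a) * N = s * N - a * N" by (simp add: algebra_simps)
        then show False using f[of "s - a"] a s by linarith
      qed
      then show ?thesis by blast
    qed
    moreover have "b \<in> pos_real_roots n" unfolding pos_real_roots_eq b using pq ne by blast
    moreover have "b < cc n" unfolding b using root_less_cc pq by blast
    ultimately show "b \<in> compat_roots n gs" unfolding compat_roots_def gs b by blast
  qed
qed

text \<open>The class moved up is that of \<open>p\<close>, the class moved down that of
  \<open>q\<close>. As both intervals are shorter than \<open>N\<close>, the classes determine the
  root.\<close>

lemma tsh_inj: assumes "1 \<le> m" "tsh m p q = tsh m p' q'" "p < q" "q < p + N" "p' < q'" "q' < p' + N"
  shows "root p q = root p' q'"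
proof -
  have pos: "0 < m * N" using assms(1) N3 by simp
  have ne: "\<not> eqm p q" using eqm_close[of p q] assms N3 by auto
  have "eqm p p'" using fun_cong[OF assms(2), of p] pos tsh_vals(1)[of p p] unfolding tsh_def[of m p' q'] by (auto split: if_splits)
  then obtain s where s: "p' = p + s * N" using eqm_sym eqm_E by blast
  have "eqm q q'"
    using fun_cong[OF assms(2), of q] pos tsh_vals(2)[OF ne, of q m] unfolding tsh_def[of m p' q'] by (auto split: if_splits)
  then have "eqm (q + s * N) q'" by simp
  then have "q + s * N = q'" using eqm_close[of "q + s * N" q'] assms s by simp
  then show ?thesis using s by (metis root_shift)
qed

section \<open>Curve neighbourhoods in terms of compatible roots\<close>

theorem curve_nbhd_compat:
  assumes d: "is_degree n d" "cc n < d" and m: "m = Min (d ` {..<n})"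
    and gs: "admissible n gs" "zel n (d - scale m (cc n)) = refl_prod n gs"
  defines "z \<equiv> zel n (d - scale m (cc n))"
  shows "curve_nbhd n d id = (\<lambda>b. transl n (scale m b) \<circ> z) ` compat_roots n gs"
    and "card (curve_nbhd n d id) = card (compat_roots n gs)"
    and "\<forall>w\<in>curve_nbhd n d id. int (len n w) = 2 * m * (N - 1) + int (len n z)"
proof -
  define d0 where "d0 = d - scale m (cc n)"
  have fin: "finite (d ` {..<n})" "d ` {..<n} \<noteq> {}" using n3 by (auto simp: lessThan_empty_iff)
  have dm: "m \<le> d k" if "k < n" for k unfolding m using fin that by simp
  obtain k0 where k0: "k0 < n" "d k0 = m" using Min_in[OF fin] unfolding m[symmetric] by auto
  have d0: "d0 k = (if k < n then d k - m else 0)" for k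
    using d(1) by (auto simp: d0_def scale_def cc_eq is_degree_def)
  have m1: "1 \<le> m" using less_imp_le[OF d(2), unfolded le_fun_def, rule_format, of k0] k0 by (simp add: cc_eq)
  have deg: "is_degree n d0" unfolding is_degree_def d0 using dm by auto
  have "\<exists>k<n. d0 k = 0" using k0 d0 by auto
  then obtain u where u: "z = act u" "zinv (pext d0) u"
    using zel_zinv[OF deg] unfolding z_def d0_def[symmetric] by blast
  \<comment> \<open>Under periodic extension, \<open>m\<close> times the imaginary root becomes the
    constant \<open>m\<close>.\<close>
  have pe: "pext d = (\<lambda>k. pext d0 k + m)"
  proof
    fix k
    have "nat (k mod N) < n" using N3 by (simp add: nat_less_iff)
    then show "pext d k = pext d0 k + m" by (simp add: pext_def d0)
  qed
  have p0: "pext d0 (int k0) = 0" using k0 by (simp add: pext_nat d0)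
  have nu: "nci u" using zinv_nci u(2) p0 .
  have bu: "aperm u" "\<And>k. rk u k k \<le> pext d0 k" using u(2) by (auto simp: zinv_def below_def)
  define C where "C = {tsh m p q \<circ> u | p q. compat u p q}"
  have LC: "Lg v = Lg u + 4 * m * (N - 1)" if "v \<in> C" for v
    using that Lg_tsh nu m1 unfolding C_def by force
  have cn: "curve_nbhd n d id = act ` C"
  proof (rule curve_nbhd_eq[OF d(1) _ LC])
    fix v assume "v \<in> C"
    then obtain p q where v: "v = tsh m p q \<circ> u" "compat u p q" unfolding C_def by blast
    have "aperm v" unfolding v(1) using aperm_comp tsh_aperm compat_ne[OF v(2)] bu(1) by blast
    moreover have "rk v k k \<le> pext d k" for k
      unfolding v(1) pe using rk_tsh[OF nu compat_ends[OF v(2) nu] compat_ne[OF v(2)]] m1 bu(2)[of k] by simp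
    ultimately show "below (pext d) v" by (simp add: below_def)
  next
    fix v assume "lmax (pext d) v"
    then show "v \<in> C" using lmax_classify[OF u(2) pext_periodic p0 m1] unfolding pe C_def by blast
  qed
  have cr: "compat_roots n gs = {root p q | p q. compat u p q}"
    by (rule compat_roots_eq[OF gs_arcs[OF gs(1) bu(1)] nu]) (use gs(2) u(1) in \<open>simp add: z_def\<close>)
  have tz: "transl n (scale m (root p q)) \<circ> z = act (tsh m p q \<circ> u)" if "compat u p q" for p q
    using transl_tsh[OF compat_ne[OF that]] act_comp[OF tsh_ashift] u(1) by simp
  show *: "curve_nbhd n d id = (\<lambda>b. transl n (scale m b) \<circ> z) ` compat_roots n gs"
  proof (intro equalityI subsetI)
    fix x assume "x \<in> curve_nbhd n d id"
    then obtain p q where "x = act (tsh m p q \<circ> u)" "compat u p q" unfolding cn C_def by blast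
    then show "x \<in> (\<lambda>b. transl n (scale m b) \<circ> z) ` compat_roots n gs"
      unfolding cr using tz by (intro image_eqI[of _ _ "root p q"]) auto
  next
    fix x assume "x \<in> (\<lambda>b. transl n (scale m b) \<circ> z) ` compat_roots n gs"
    then obtain p q where "x = transl n (scale m (root p q)) \<circ> z" "compat u p q" unfolding cr by blast
    then show "x \<in> curve_nbhd n d id" unfolding cn C_def using tz by blast
  qed
  have "inj_on (\<lambda>b. transl n (scale m b) \<circ> z) (compat_roots n gs)"
  proof (rule inj_onI)
    fix b b' assume b: "b \<in> compat_roots n gs" "b' \<in> compat_roots n gs"
      and e: "transl n (scale m b) \<circ> z = transl n (scale m b') \<circ> z"
    obtain p q p' q' where c: "b = root p q" "compat u p q" "b' = root p' q'" "compat u p' q'"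
      using b unfolding cr by blast
    have "act (tsh m p q \<circ> u) = act (tsh m p' q' \<circ> u)" using e tz c by metis
    then have "tsh m p q \<circ> u = tsh m p' q' \<circ> u"
      using act_inj aperm_comp tsh_aperm compat_ne c bu(1) by metis
    then have "tsh m p q x = tsh m p' q' x" for x
      using nci_invol[OF nu, of x] by (metis comp_apply)
    then have "tsh m p q = tsh m p' q'" by blast
    then show "b = b'" unfolding c(1,3) using tsh_inj m1 c(2,4) unfolding compat_def by blast
  qed
  then show "card (curve_nbhd n d id) = card (compat_roots n gs)" unfolding * by (rule card_image)
  show "\<forall>w\<in>curve_nbhd n d id. int (len n w) = 2 * m * (N - 1) + int (len n z)"
  proof
    fix w assume "w \<in> curve_nbhd n d id"
    then obtain p q where w: "w = act (tsh m p q \<circ> u)" "compat u p q" unfolding cn C_def by blast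
    have "aperm (tsh m p q \<circ> u)" using aperm_comp tsh_aperm compat_ne[OF w(2)] bu(1) by blast
    then have "2 * int (len n w) = Lg u + 4 * m * (N - 1)"
      using len_act Lg_tsh[OF w(2) nu] m1 unfolding w(1) by simp
    then show "int (len n w) = 2 * m * (N - 1) + int (len n z)" using len_act[OF bu(1)] u(1) by simp
  qed
qed

end

theorem theorem1p14:
  fixes n :: nat and d :: lat and m :: int and gs :: "lat list"
  assumes "n \<ge> 3"
    and "is_degree n d"
    and "d > cc n"
    and "m = Min (d ` {..<n})"
    and "admissible n gs"
    and "zel n (d - scale m (cc n)) = refl_prod n gs"
  shows "(curve_nbhd n d id =
           {transl n (scale m b) \<circ> zel n (d - scale m (cc n)) | b.
              b \<in> compat_roots n gs \<and> 0 \<notin> supp b} \<union>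
           {transl n (scale m (b - cc n)) \<circ> zel n (d - scale m (cc n)) | b.
              b \<in> compat_roots n gs \<and> 0 \<in> supp b}) \<and>
         card (curve_nbhd n d id) = card (compat_roots n gs) \<and>
         (\<forall>w\<in>curve_nbhd n d id.
           int (len n w) = 2 * m * (int n - 1) + int (len n (zel n (d - scale m (cc n)))))"
proof -
  interpret affine n using assms(1) by unfold_locales
  show ?thesis
    unfolding transl_cc using curve_nbhd_compat[OF assms(2-6)] by blast
qed

end
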